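(* Assume that the rewards are bounded in $[0,1]$ at all rounds and that the meta learner has access to the correct prior $\mathcal P$. Let $d^\star=\max_{\nu\in\mathrm{Supp}(\mathcal P)}\min_{i\in[M]}d^i_T(\nu,\delta)$, where $\delta\in(0,1)$ is the confidence parameter of the regret coefficients. Then the Bayesian regret of the algorithm B-MS satisfies $$\mathrm{BayesRegret}_T\;\le\;\widetilde{\mathcal O}\bigl(d^\star M\sqrt T+\sqrt{MT}\bigr),$$ where $\widetilde{\mathcal O}$ hides constants and logarithmic factors.
   Context: Bayesian bandit. $\mathcal A$ is an action set. An environment $\nu$ assigns to each $a\in\mathcal A$ a reward distribution $\nu(a)$ with mean $\mu_\nu(a)\in[0,1]$. Put $\mu^\star_\nu=\max_{a\in\mathcal A}\mu_\nu(a)$. The environment $\nu$ is drawn once from a prior $\mathcal P$ and then remains fixed for $T$ rounds. Model selection protocol. There are $M$ base learners $\mathcal B^1,\dots,\mathcal B^M$; each keeps an internal state and, when queried at round $t$, outputs a policy $\pi^i_t\in\Delta(\mathcal A)$ (a distribution on $\mathcal A$). At each round $t\in[T]$ the meta learner selects $i_t\in[M]$, plays $a_t\sim\pi^{i_t}_t$, observes $r_t\sim\nu(a_t)$, and passes $(a_t,r_t)$ to the selected base learner $\mathcal B^{i_t}$, which updates its state. Notation: $\mathcal I^i_t=\{l\in[t-1]: i_l=i\}$, $n^i_t=|\mathcal I^i_t|$, $\mathcal H_t=\{(a_s,r_s)\}_{s=1}^{t-1}$, and $\mathcal P_t(\cdot\mid\mathcal H_t)$ is the posterior given the history $\mathcal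 H_t$. Algorithm B-MS. For $t\le M$ select $i_t=t \bmod M$ (round-robin, residue $0$ meaning learner $M$). For $t>M$: sample a mean-reward function $\tilde\mu_t:\mathcal A\to\mathbb R$ from the posterior $\mathcal P_t(\cdot\mid\mathcal H_t)$; let $\tilde\mu^\star_t=\max_{a\in\mathcal A}\tilde\mu_t(a)$; compute $\phi_t(i)=n^i_t\tilde\mu^\star_t-\sum_{l\in\mathcal I^i_t}\tilde\mu_t(a_l)$ for each $i\in[M]$; select $i_t=\arg\min_{i\in[M]}\phi_t(i)$. Then play, observe and update as in the protocol, and update the posterior with $(a_t,r_t)$. Regret. $\mathrm{Regret}^i_t(\nu)=\sum_{l\in\mathcal I^i_t}\bigl(\mu^\star_\nu-\mu_\nu(a_l)\bigr)$ is the regret of base learner $i$. The Bayesian regret is $\mathrm{BayesRegret}_T=\mathbb E\bigl[\sum_{t=1}^T(\mu^\star_\nu-\mu_\nu(a_t))\bigr]$, the expectation being over $\nu\sim\mathcal P$ and the randomness of the interaction (including the internal randomization of the learners). Regret coefficient. For $\delta\in(0,1)$, $t\in[T]$ and an environment $\nu$, $d^i_t(\nu,\delta)$ is the minimum value such that, with probability at least $1-\delta$, $\mathrm{Regret}^i_l(\nu)\le d^i_t(\nu,\delta)\sqrt l$ for all $l\le t$.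
   Formalization: The stated bound fails for fixed δ (one coin-flipping learner, δ=1/2: d*=0 but regret T/2); the formal theorem proves it when δT ≤ √(MT), and for every δ in (0,1) with an extra term δT inside Õ. *)

theory Defs
  imports "HOL-Probability.Probability"
begin

(* A family of environments is an index type 'e with its Borel sigma-algebra, together with a
   probability kernel: reward Z \<nu> a is the reward distribution that environment \<nu> assigns
   to action a. *)

record ('e, 'a) bandit =
  actions :: "'a measure"
  reward :: "'e \<Rightarrow> 'a \<Rightarrow> real measure"
  prior :: "'e measure"

definition mean_reward :: "('e, 'a) bandit \<Rightarrow> 'e \<Rightarrow> 'a \<Rightarrow> real" where
  "mean_reward Z \<nu> a = (\<integral>r. r \<partial>reward Z \<nu> a)"

definition opt_mean :: "('e, 'a) bandit \<Rightarrow> 'e \<Rightarrow> real" where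
  "opt_mean Z \<nu> = (SUP a\<in>space (actions Z). mean_reward Z \<nu> a)"

(* The supremum in opt_mean need not be attained.  Its measurability is needed for the
   Bayesian regret to be defined; it is automatic for countably many actions. *)

definition bayesian_bandit :: "('e::topological_space, 'a) bandit \<Rightarrow> bool" where
  "bayesian_bandit Z \<longleftrightarrow>
     prob_space (prior Z) \<and> sets (prior Z) = sets borel \<and>
     (\<lambda>(\<nu>, a). reward Z \<nu> a) \<in> borel \<Otimes>\<^sub>M actions Z \<rightarrow>\<^sub>M prob_algebra borel \<and>
     opt_mean Z \<in> borel_measurable borel"

definition rewards_in_unit_interval :: "('e, 'a) bandit \<Rightarrow> bool" where
  "rewards_in_unit_interval Z \<longleftrightarrow>
     (\<forall>\<nu>. \<forall>a\<in>space (actions Z). AE r in reward Z \<nu> a. 0 \<le> r \<and> r \<le> 1)"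

definition supp :: "'e::topological_space measure \<Rightarrow> 'e set" where
  "supp P = {\<nu>. \<forall>U. open U \<and> \<nu> \<in> U \<longrightarrow> measure P U > 0}"

(* Internal randomization of a learner enters through a random initial state and a randomized
   update.  The natural number is the current round. *)

record ('a, 's) learner =
  states :: "'s measure"
  init_state :: "'s measure"
  policy :: "nat \<Rightarrow> 's \<Rightarrow> 'a measure"
  update_state :: "nat \<Rightarrow> 's \<Rightarrow> 'a \<Rightarrow> real \<Rightarrow> 's measure"

definition base_learner :: "('e, 'a) bandit \<Rightarrow> ('a, 's) learner \<Rightarrow> bool" where
  "base_learner Z L \<longleftrightarrow>
     init_state L \<in> space (prob_algebra (states L)) \<and>
     (\<forall>t. policy L t \<in> states L \<rightarrow>\<^sub>M prob_algebra (actions Z)) \<and>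
     (\<forall>t. (\<lambda>(s, a, r). update_state L t s a r)
        \<in> states L \<Otimes>\<^sub>M actions Z \<Otimes>\<^sub>M borel \<rightarrow>\<^sub>M prob_algebra (states L))"

(* A trace maps every past round l to (i_l, a_l, r_l); rounds and learners are numbered from 1. *)

type_synonym 'a trace = "nat \<Rightarrow> nat \<times> 'a \<times> real"

definition trace_space :: "('e, 'a) bandit \<Rightarrow> nat \<Rightarrow> nat \<Rightarrow> 'a trace measure" where
  "trace_space Z M n =
     PiM {1..n} (\<lambda>_. count_space {1..M} \<Otimes>\<^sub>M actions Z \<Otimes>\<^sub>M borel)"

definition selected :: "nat \<Rightarrow> nat \<Rightarrow> 'a trace \<Rightarrow> nat set" where
  "selected i t h = {l \<in> {1..<t}. fst (h l) = i}"

definition action :: "'a trace \<Rightarrow> nat \<Rightarrow> 'a" where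
  "action h l = fst (snd (h l))"

(* The history used for the posterior contains the actions and rewards, not the indices i_l. *)

definition history :: "nat \<Rightarrow> 'a trace \<Rightarrow> nat \<Rightarrow> 'a \<times> real" where
  "history t h = restrict (\<lambda>l. snd (h l)) {1..<t}"

definition history_space :: "('e, 'a) bandit \<Rightarrow> nat \<Rightarrow> (nat \<Rightarrow> 'a \<times> real) measure" where
  "history_space Z t = PiM {1..<t} (\<lambda>_. actions Z \<Otimes>\<^sub>M borel)"

definition regret :: "('e, 'a) bandit \<Rightarrow> 'e \<Rightarrow> nat \<Rightarrow> nat \<Rightarrow> 'a trace \<Rightarrow> real" where
  "regret Z \<nu> i t h = (\<Sum>l\<in>selected i t h. opt_mean Z \<nu> - mean_reward Z \<nu> (action h l))"

(* The quantity phi_t(i), with e the environment sampled from the posterior. *)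

definition bms_potential :: "('e, 'a) bandit \<Rightarrow> 'e \<Rightarrow> nat \<Rightarrow> 'a trace \<Rightarrow> nat \<Rightarrow> real" where
  "bms_potential Z e t h i =
     real (card (selected i t h)) * opt_mean Z e
       - (\<Sum>l\<in>selected i t h. mean_reward Z e (action h l))"

(* post t H is the distribution from which B-MS samples an environment in round t when the
   history is H. *)

type_synonym ('e, 'a) posterior = "nat \<Rightarrow> (nat \<Rightarrow> 'a \<times> real) \<Rightarrow> 'e measure"

definition bms_select ::
  "('e, 'a) bandit \<Rightarrow> nat \<Rightarrow> ('e, 'a) posterior \<Rightarrow> nat \<Rightarrow> 'a trace \<Rightarrow> nat measure" where
  "bms_select Z M post t h =
     (if t \<le> M then return (count_space {1..M}) (if t mod M = 0 then M else t mod M)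
      else distr (post t (history t h)) (count_space {1..M})
             (\<lambda>e. arg_min_on (bms_potential Z e t h) {1..M}))"

definition run_space ::
  "('e, 'a) bandit \<Rightarrow> nat \<Rightarrow> (nat \<Rightarrow> ('a, 's) learner) \<Rightarrow> nat
     \<Rightarrow> ('a trace \<times> (nat \<Rightarrow> 's)) measure" where
  "run_space Z M B n = trace_space Z M n \<Otimes>\<^sub>M PiM {1..M} (\<lambda>i. states (B i))"

definition bms_round ::
  "('e, 'a) bandit \<Rightarrow> nat \<Rightarrow> (nat \<Rightarrow> ('a, 's) learner) \<Rightarrow> ('e, 'a) posterior \<Rightarrow> 'e \<Rightarrow> nat
     \<Rightarrow> 'a trace \<times> (nat \<Rightarrow> 's) \<Rightarrow> ('a trace \<times> (nat \<Rightarrow> 's)) measure" where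
  "bms_round Z M B post \<nu> t = (\<lambda>(h, \<sigma>). do {
     i \<leftarrow> bms_select Z M post t h;
     a \<leftarrow> policy (B i) t (\<sigma> i);
     r \<leftarrow> reward Z \<nu> a;
     s \<leftarrow> update_state (B i) t (\<sigma> i) a r;
     return (run_space Z M B t) (h(t := (i, a, r)), \<sigma>(i := s))
   })"

(* The environment is fixed here, but post remains the posterior under the prior, as the
   algorithm does not know \<nu>. *)

primrec bms_run ::
  "('e, 'a) bandit \<Rightarrow> nat \<Rightarrow> (nat \<Rightarrow> ('a, 's) learner) \<Rightarrow> ('e, 'a) posterior \<Rightarrow> 'e \<Rightarrow> nat
     \<Rightarrow> ('a trace \<times> (nat \<Rightarrow> 's)) measure" where
  "bms_run Z M B post \<nu> 0 =
     return (trace_space Z M 0) (\<lambda>_. undefined) \<Otimes>\<^sub>M PiM {1..M} (\<lambda>i. init_state (B i))"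
| "bms_run Z M B post \<nu> (Suc n) =
     bms_run Z M B post \<nu> n \<bind> bms_round Z M B post \<nu> (Suc n)"

definition bayes_run ::
  "('e::topological_space, 'a) bandit \<Rightarrow> nat \<Rightarrow> (nat \<Rightarrow> ('a, 's) learner) \<Rightarrow> ('e, 'a) posterior
     \<Rightarrow> nat \<Rightarrow> ('e \<times> 'a trace \<times> (nat \<Rightarrow> 's)) measure" where
  "bayes_run Z M B post n = do {
     \<nu> \<leftarrow> prior Z;
     \<omega> \<leftarrow> bms_run Z M B post \<nu> n;
     return (borel \<Otimes>\<^sub>M run_space Z M B n) (\<nu>, \<omega>)
   }"

(* post t is a version of the conditional distribution of the environment given the history of
   the first t - 1 rounds: the joint law of (history, environment) disintegrates through it.
   That law involves post only at rounds before t, so this is not circular. *)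

definition is_posterior ::
  "('e::topological_space, 'a) bandit \<Rightarrow> nat \<Rightarrow> (nat \<Rightarrow> ('a, 's) learner) \<Rightarrow> ('e, 'a) posterior
     \<Rightarrow> nat \<Rightarrow> bool" where
  "is_posterior Z M B post t \<longleftrightarrow>
     post t \<in> history_space Z t \<rightarrow>\<^sub>M prob_algebra borel \<and>
     distr (bayes_run Z M B post (t - 1)) (history_space Z t \<Otimes>\<^sub>M borel)
         (\<lambda>(\<nu>, h, \<sigma>). (history t h, \<nu>)) =
       do {
         H \<leftarrow> distr (bayes_run Z M B post (t - 1)) (history_space Z t)
               (\<lambda>(\<nu>, h, \<sigma>). history t h);
         \<nu> \<leftarrow> post t H;
         return (history_space Z t \<Otimes>\<^sub>M borel) (H, \<nu>)
       }"

(* For a well-formed instance with t > 0 and 0 < \<delta> < 1 the set is closed, nonempty and bounded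
   below by 0, so the infimum is a minimum. *)

definition regret_coeff ::
  "('e, 'a) bandit \<Rightarrow> nat \<Rightarrow> (nat \<Rightarrow> ('a, 's) learner) \<Rightarrow> ('e, 'a) posterior
     \<Rightarrow> nat \<Rightarrow> nat \<Rightarrow> 'e \<Rightarrow> real \<Rightarrow> real" where
  "regret_coeff Z M B post i t \<nu> \<delta> =
     Inf {d. measure (bms_run Z M B post \<nu> t)
               {\<omega> \<in> space (bms_run Z M B post \<nu> t).
                  \<forall>l\<in>{1..t}. regret Z \<nu> i l (fst \<omega>) \<le> d * sqrt (real l)} \<ge> 1 - \<delta>}"

definition d_star ::
  "('e::topological_space, 'a) bandit \<Rightarrow> nat \<Rightarrow> (nat \<Rightarrow> ('a, 's) learner) \<Rightarrow> ('e, 'a) posterior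
     \<Rightarrow> nat \<Rightarrow> real \<Rightarrow> real" where
  "d_star Z M B post T \<delta> =
     (SUP \<nu>\<in>supp (prior Z). MIN i\<in>{1..M}. regret_coeff Z M B post i T \<nu> \<delta>)"

definition bayes_regret ::
  "('e::topological_space, 'a) bandit \<Rightarrow> nat \<Rightarrow> (nat \<Rightarrow> ('a, 's) learner) \<Rightarrow> ('e, 'a) posterior
     \<Rightarrow> nat \<Rightarrow> real" where
  "bayes_regret Z M B post T =
     (\<integral>(\<nu>, h, \<sigma>). (\<Sum>t\<in>{1..T}. opt_mean Z \<nu> - mean_reward Z \<nu> (action h t))
        \<partial>bayes_run Z M B post T)"

end

theory Submission
  imports Defs "HOL-Probability.Hoeffding"
begin

text \<open>
  Only the rewards depend on the environment \<open>\<nu>\<close>, so given the actions and rewards, \<open>\<nu>\<close> is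
  independent of the learner indices and the internal states. Hence a posterior sample may be
  exchanged for \<open>\<nu>\<close> jointly with the whole trace, and for \<open>t > M\<close> the selected learner has the law of
  a minimiser \<open>i\<close> of the true regrets. Off an event of probability \<open>\<delta> + O(1/T)\<close> this minimal regret is
  at most \<open>D \<approx> d* sqrt T\<close>, and sums of \<open>n\<close> mean rewards are within \<open>c sqrt n\<close> of the observed ones. If \<open>A\<close>
  is the average observed reward of \<open>i\<close> in its \<open>n\<close> past rounds, then \<open>\<mu>* \<le> A + (D + c sqrt n)/n\<close>, and
  this bound exceeds all earlier averages of \<open>i\<close> up to their own error \<open>c / sqrt n'\<close>.

  As \<open>\<mu>*\<close> of the sample and of \<open>\<nu>\<close> have the same expectation, a round costs at most the expectation
  of \<open>(D + c sqrt n)/n + A - r\<close>. The first part sums to \<open>O(M D log T + c sqrt (M T))\<close>. For the second,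
  \<open>r\<close> summed over the past rounds of one learner is \<open>n A\<close>, so its sum consists of the earlier
  averages minus the current one, which the second property bounds by \<open>O(D + c sqrt n)\<close>.
\<close>

section \<open>Kernels and conditional laws\<close>

text \<open>The obstacle is the exchange itself. \<open>is_posterior\<close> speaks of histories
  only, the selection rule and the learners use the whole run, and on arbitrary measurable spaces a
  regular conditional law of the run given the history need not exist. \<open>exchange\<close> is
  therefore proved by induction on the rounds; in each step the environment is drawn after the run,
  the index and the action, whose kernels do not see it. What is known about the true minimiser
  carries over to the selected learner only if it does not mention the environment. So the good
  event is used through two functions of the trace: the index \<open>ucb\<close> and the predicate
  \<open>settled\<close>. Expectations live in \<open>ennreal\<close>, where subtraction is unsafe.
  A round is measured as its gap plus 1, which splits into the nonnegative parts
  \<open>opt_mean\<close> and \<open>1 - mean_reward\<close>. The regret coefficient controls the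
  minimal regret only up to probability \<delta>, in every round. This failure is charged twice, for
  \<open>ucb\<close> and for \<open>settled\<close>, and is the source of the summand \<delta>
  T.\<close>

lemma nn_integral_bind_prob:
  assumes "f \<in> borel_measurable N" "K \<in> P \<rightarrow>\<^sub>M prob_algebra N"
  shows "(\<integral>\<^sup>+x. f x \<partial>(P \<bind> K)) = (\<integral>\<^sup>+x. \<integral>\<^sup>+y. f y \<partial>K x \<partial>P)"
  using assms by (intro nn_integral_bind[where B=N] measurable_prob_algebraD)

lemma nn_integral_kernel_measurable:
  assumes "(\<lambda>(x, y). f x y) \<in> borel_measurable (P \<Otimes>\<^sub>M N)" "K \<in> P \<rightarrow>\<^sub>M prob_algebra N"
  shows "(\<lambda>x. \<integral>\<^sup>+y. f x y \<partial>K x) \<in> borel_measurable P"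
  using assms by (intro nn_integral_measurable_subprob_algebra2[where N=N] measurable_prob_algebraD)

lemma prob_algebraD:
  assumes "K \<in> P \<rightarrow>\<^sub>M prob_algebra N" "x \<in> space P"
  shows "prob_space (K x)" "sets (K x) = sets N" "space (K x) = space N"
  using measurable_space[OF assms] by (auto simp: space_prob_algebra dest: sets_eq_imp_space_eq)

lemma measure_eqI_rectangles:
  assumes sets: "sets P = sets (A \<Otimes>\<^sub>M B)" "sets Q = sets (A \<Otimes>\<^sub>M B)"
    and fin: "emeasure P (space A \<times> space B) \<noteq> \<infinity>"
    and eq: "\<And>a b. a \<in> sets A \<Longrightarrow> b \<in> sets B \<Longrightarrow> emeasure P (a \<times> b) = emeasure Q (a \<times> b)"
  shows "P = Q"
proof (rule measure_eqI_generator_eq[OF Int_stable_pair_measure_generator[of A B] pair_measure_closed])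
  show "sets P = sigma_sets (space A \<times> space B) {a \<times> b |a b. a \<in> sets A \<and> b \<in> sets B}"
    "sets Q = sigma_sets (space A \<times> space B) {a \<times> b |a b. a \<in> sets A \<and> b \<in> sets B}"
    using sets by (simp_all add: sets_pair_measure)
  show "range (\<lambda>i::nat. space A \<times> space B) \<subseteq> {a \<times> b |a b. a \<in> sets A \<and> b \<in> sets B}" by blast
qed (use fin eq in auto)

text \<open>Here \<open>w\<close> stands for all that precedes the reward of a round (run, index,
  action), \<open>\<pi> w\<close> for the history and the action, \<open>p\<close> and
  \<open>p'\<close> for the posterior before and after the reward, and \<open>\<rho>\<close> for the
  reward law. Environment and reward see \<open>w\<close> only through
  \<open>\<pi> w\<close>.\<close>

locale disintegration_step =
  fixes \<Xi> :: "'w measure" and Q :: "'q measure" and E :: "'e measure" and R :: "'r measure"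
    and \<pi> :: "'w \<Rightarrow> 'q" and p :: "'q \<Rightarrow> 'e measure" and \<rho> :: "'e \<times> 'q \<Rightarrow> 'r measure"
    and p' :: "'q \<times> 'r \<Rightarrow> 'e measure"
  assumes \<Xi>: "prob_space \<Xi>"
    and \<pi>[measurable]: "\<pi> \<in> \<Xi> \<rightarrow>\<^sub>M Q"
    and p[measurable]: "p \<in> Q \<rightarrow>\<^sub>M prob_algebra E"
    and \<rho>[measurable]: "\<rho> \<in> E \<Otimes>\<^sub>M Q \<rightarrow>\<^sub>M prob_algebra R"
    and p'[measurable]: "p' \<in> Q \<Otimes>\<^sub>M R \<rightarrow>\<^sub>M prob_algebra E"
begin

abbreviation chain :: "('w \<Rightarrow> 'e \<Rightarrow> 'r \<Rightarrow> ennreal) \<Rightarrow> ennreal" where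
  "chain F \<equiv> (\<integral>\<^sup>+w. \<integral>\<^sup>+e. \<integral>\<^sup>+r. F w e r \<partial>\<rho> (e, \<pi> w) \<partial>p (\<pi> w) \<partial>\<Xi>)"

text \<open>\<open>chain\<close> is integration against this measure; the measure itself is needed
  to form densities and images.\<close>

definition joint :: "('w \<times> 'e \<times> 'r) measure" where
  "joint = \<Xi> \<bind> (\<lambda>w. p (\<pi> w) \<bind> (\<lambda>e. \<rho> (e, \<pi> w) \<bind> (\<lambda>r. return (\<Xi> \<Otimes>\<^sub>M E \<Otimes>\<^sub>M R) (w, e, r))))"

lemma reward_return_measurable: "(\<lambda>x. \<rho> (snd x, \<pi> (fst x)) \<bind> (\<lambda>r. return (\<Xi> \<Otimes>\<^sub>M E \<Otimes>\<^sub>M R) (fst x, snd x, r)))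
   \<in> \<Xi> \<Otimes>\<^sub>M E \<rightarrow>\<^sub>M prob_algebra (\<Xi> \<Otimes>\<^sub>M E \<Otimes>\<^sub>M R)"
  by measurable

lemma joint_kernel_measurable: "(\<lambda>w. p (\<pi> w) \<bind> (\<lambda>e. \<rho> (e, \<pi> w) \<bind> (\<lambda>r. return (\<Xi> \<Otimes>\<^sub>M E \<Otimes>\<^sub>M R) (w, e, r))))
   \<in> \<Xi> \<rightarrow>\<^sub>M prob_algebra (\<Xi> \<Otimes>\<^sub>M E \<Otimes>\<^sub>M R)"
  using reward_return_measurable by measurable

lemma prob_joint: "prob_space joint" and sets_joint[measurable_cong, simp]: "sets joint = sets (\<Xi> \<Otimes>\<^sub>M E \<Otimes>\<^sub>M R)"
  using prob_space_bind'[OF _ joint_kernel_measurable, of \<Xi>] sets_bind'[OF _ joint_kernel_measurable, of \<Xi>] \<Xi>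
  by (auto simp: joint_def space_prob_algebra)

lemma nn_integral_joint:
  assumes f[measurable]: "f \<in> borel_measurable (\<Xi> \<Otimes>\<^sub>M E \<Otimes>\<^sub>M R)"
  shows "(\<integral>\<^sup>+x. f x \<partial>joint) = chain (\<lambda>w e r. f (w, e, r))"
  unfolding joint_def
  apply (subst nn_integral_bind_prob[OF f joint_kernel_measurable])
  apply (intro nn_integral_cong)
  subgoal for w
    apply (subst nn_integral_bind_prob[OF f, of _ "p (\<pi> w)"])
    subgoal
      using measurable_compose[OF measurable_Pair1' reward_return_measurable, of w] prob_algebraD[OF p, of "\<pi> w"] measurable_space[OF \<pi>]
      by (simp cong: measurable_cong_sets)
    apply (intro nn_integral_cong)
    subgoal for e
      apply (subst nn_integral_bind_prob[OF f, of _ "\<rho> (e, \<pi> w)"])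
      subgoal
        using prob_algebraD[OF \<rho>, of "(e, \<pi> w)"] measurable_space[OF \<pi>] prob_algebraD[OF p, of "\<pi> w"]
        by (auto simp: space_pair_measure cong: measurable_cong_sets)
      apply (intro nn_integral_cong)
      using prob_algebraD[OF \<rho>, of "(e, \<pi> w)"] measurable_space[OF \<pi>] prob_algebraD[OF p, of "\<pi> w"]
      by (auto simp: space_pair_measure intro!: nn_integral_return)
    done
  done

text \<open>Conditioning on \<open>\<pi> w\<close> is expressed by a Radon--Nikodym derivative, so the spaces may be arbitrary.\<close>

lemma lift_conditional_law:
  assumes U[measurable]: "U \<in> sets E"
    and hyp: "\<And>k. k \<in> borel_measurable (Q \<Otimes>\<^sub>M R) \<Longrightarrow>
      chain (\<lambda>w e r. indicator U e * k (\<pi> w, r)) =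
      chain (\<lambda>w e r. emeasure (p' (\<pi> w, r)) U * k (\<pi> w, r))"
    and g[measurable]: "g \<in> borel_measurable (\<Xi> \<Otimes>\<^sub>M R)"
  shows "chain (\<lambda>w e r. indicator U e * g (w, r)) =
      chain (\<lambda>w e r. emeasure (p' (\<pi> w, r)) U * g (w, r))"
proof -
  have [measurable]: "(\<lambda>x. emeasure (p' x) U) \<in> borel_measurable (Q \<Otimes>\<^sub>M R)"
    by (intro measurable_compose[OF measurable_prob_algebraD[OF p']] measurable_emeasure_subprob_algebra U)
  have [measurable]: "(\<lambda>x. emeasure (p' (\<pi> (fst x), snd (snd x))) U) \<in> borel_measurable (\<Xi> \<Otimes>\<^sub>M E \<Otimes>\<^sub>M R)"
    by measurable
  \<comment> \<open>Both sides are integrals of \<open>g\<close> against measures on the pairs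
    \<open>(w, r)\<close>, so it suffices to compare these on rectangles.\<close>
  define m1 where "m1 = distr (density joint (\<lambda>x. indicator U (fst (snd x)))) (\<Xi> \<Otimes>\<^sub>M R) (\<lambda>x. (fst x, snd (snd x)))"
  define m2 where "m2 = distr (density joint (\<lambda>x. emeasure (p' (\<pi> (fst x), snd (snd x))) U)) (\<Xi> \<Otimes>\<^sub>M R) (\<lambda>x. (fst x, snd (snd x)))"
  have m1: "(\<integral>\<^sup>+x. f x \<partial>m1) = chain (\<lambda>w e r. indicator U e * f (w, r))"
    if [measurable]: "f \<in> borel_measurable (\<Xi> \<Otimes>\<^sub>M R)" for f
    unfolding m1_def
    by (simp add: nn_integral_distr nn_integral_density nn_integral_joint)
  have m2: "(\<integral>\<^sup>+x. f x \<partial>m2) = chain (\<lambda>w e r. emeasure (p' (\<pi> w, r)) U * f (w, r))"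
    if [measurable]: "f \<in> borel_measurable (\<Xi> \<Otimes>\<^sub>M R)" for f
    unfolding m2_def
    by (simp add: nn_integral_distr nn_integral_density nn_integral_joint)
  have rect: "emeasure m1 (A \<times> C) = emeasure m2 (A \<times> C)"
    if A[measurable]: "A \<in> sets \<Xi>" and C[measurable]: "C \<in> sets R" for A C
  proof -
    interpret \<Xi>: prob_space \<Xi> by (rule \<Xi>)
    define D where "D = distr \<Xi> Q \<pi>"
    \<comment> \<open>\<open>N\<close> is the law of \<open>\<pi>\<close> on the event
      \<open>A\<close>. Its density \<open>Y\<close> with respect to \<open>D\<close> is the
      conditional probability of \<open>A\<close> given \<open>\<pi>\<close>.\<close>
    define N where "N = distr (density \<Xi> (indicator A)) Q \<pi>"
    interpret D: prob_space D unfolding D_def by (rule \<Xi>.prob_space_distr) simp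
    have ac: "absolutely_continuous D N"
      unfolding absolutely_continuous_def
    proof
      fix X assume "X \<in> null_sets D"
      then have X[measurable]: "X \<in> sets Q" and *: "emeasure \<Xi> (\<pi> -` X \<inter> space \<Xi>) = 0"
        by (auto simp: D_def null_sets_def emeasure_distr)
      have "emeasure N X = (\<integral>\<^sup>+x. indicator A x * indicator (\<pi> -` X \<inter> space \<Xi>) x \<partial>\<Xi>)"
        by (simp add: N_def emeasure_distr emeasure_density)
      also have "\<dots> \<le> (\<integral>\<^sup>+x. indicator (\<pi> -` X \<inter> space \<Xi>) x \<partial>\<Xi>)"
        by (intro nn_integral_mono) (auto simp: indicator_def)
      finally show "X \<in> null_sets N" using * by (simp add: null_sets_def N_def)
    qed
    define Y where "Y = RN_deriv D N"
    have [measurable]: "Y \<in> borel_measurable Q"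
      using borel_measurable_RN_deriv[of D N] by (simp add: Y_def D_def)
    have Y: "(\<integral>\<^sup>+w. indicator A w * f (\<pi> w) \<partial>\<Xi>) = (\<integral>\<^sup>+w. Y (\<pi> w) * f (\<pi> w) \<partial>\<Xi>)"
      if [measurable]: "f \<in> borel_measurable Q" for f
    proof -
      have "(\<integral>\<^sup>+w. indicator A w * f (\<pi> w) \<partial>\<Xi>) = (\<integral>\<^sup>+q. f q \<partial>N)"
        by (simp add: N_def nn_integral_distr nn_integral_density)
      also have "\<dots> = (\<integral>\<^sup>+q. Y q * f q \<partial>D)"
        unfolding Y_def by (rule D.RN_deriv_nn_integral[OF ac]) (auto simp: N_def D_def)
      also have "\<dots> = (\<integral>\<^sup>+w. Y (\<pi> w) * f (\<pi> w) \<partial>\<Xi>)"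
        by (simp add: D_def nn_integral_distr)
      finally show ?thesis .
    qed
    \<comment> \<open>Integrating out environment and reward leaves a function
      \<open>\<alpha>\<close> of \<open>\<pi> w\<close>, against which \<open>indicator A\<close>
      and its conditional probability \<open>Y\<close> have the same integral.\<close>
    have swap: "chain (\<lambda>w e r. b e (\<pi> w, r) * (indicator A w * indicator C r))
      = chain (\<lambda>w e r. b e (\<pi> w, r) * (Y (\<pi> w) * indicator C r))"
      if b[measurable]: "(\<lambda>(e, x). b e x) \<in> borel_measurable (E \<Otimes>\<^sub>M (Q \<Otimes>\<^sub>M R))" for b :: "'e \<Rightarrow> 'q \<times> 'r \<Rightarrow> ennreal"
    proof -
      define \<alpha> where "\<alpha> q = (\<integral>\<^sup>+e. \<integral>\<^sup>+r. b e (q, r) * indicator C r \<partial>\<rho> (e, q) \<partial>p q)" for q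
      have in1: "(\<lambda>x. \<integral>\<^sup>+r. b (snd x) (fst x, r) * indicator C r \<partial>\<rho> (snd x, fst x)) \<in> borel_measurable (Q \<Otimes>\<^sub>M E)"
        by (rule nn_integral_kernel_measurable[where N=R]) measurable
      have \<alpha>[measurable]: "\<alpha> \<in> borel_measurable Q"
        unfolding \<alpha>_def
        by (rule nn_integral_kernel_measurable[where N=E]) (use in1 in \<open>auto simp: split_beta\<close>)
      have pull: "(\<integral>\<^sup>+e. \<integral>\<^sup>+r. b e (\<pi> w, r) * (c * indicator C r) \<partial>\<rho> (e, \<pi> w) \<partial>p (\<pi> w)) = c * \<alpha> (\<pi> w)"
        if w: "w \<in> space \<Xi>" for w and c :: ennreal
      proof -
        have q: "\<pi> w \<in> space Q" using measurable_space[OF \<pi> w] .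
        have "(\<integral>\<^sup>+e. \<integral>\<^sup>+r. b e (\<pi> w, r) * (c * indicator C r) \<partial>\<rho> (e, \<pi> w) \<partial>p (\<pi> w))
          = (\<integral>\<^sup>+e. c * (\<integral>\<^sup>+r. b e (\<pi> w, r) * indicator C r \<partial>\<rho> (e, \<pi> w)) \<partial>p (\<pi> w))"
        proof (intro nn_integral_cong)
          fix e assume "e \<in> space (p (\<pi> w))"
          then have e: "e \<in> space E" using prob_algebraD[OF p q] by simp
          have [measurable_cong]: "sets (\<rho> (e, \<pi> w)) = sets R"
            using prob_algebraD[OF \<rho>, of "(e, \<pi> w)"] e q by (simp add: space_pair_measure)
          have [measurable]: "(\<lambda>r. b e (\<pi> w, r)) \<in> borel_measurable R"
            using measurable_compose[OF _ b, of "\<lambda>r. (e, \<pi> w, r)" R] e q by simp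
          show "(\<integral>\<^sup>+r. b e (\<pi> w, r) * (c * indicator C r) \<partial>\<rho> (e, \<pi> w)) = c * (\<integral>\<^sup>+r. b e (\<pi> w, r) * indicator C r \<partial>\<rho> (e, \<pi> w))"
            by (subst nn_integral_cmult[symmetric]) (auto simp: ac_simps)
        qed
        also have "\<dots> = c * \<alpha> (\<pi> w)"
          unfolding \<alpha>_def using measurable_compose[OF measurable_Pair1'[OF q] in1] prob_algebraD[OF p q]
          by (intro nn_integral_cmult) (simp cong: measurable_cong_sets)
        finally show ?thesis .
      qed
      have "chain (\<lambda>w e r. b e (\<pi> w, r) * (indicator A w * indicator C r))
        = (\<integral>\<^sup>+w. indicator A w * \<alpha> (\<pi> w) \<partial>\<Xi>)"
        by (intro nn_integral_cong) (simp add: pull)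
      also have "\<dots> = (\<integral>\<^sup>+w. Y (\<pi> w) * \<alpha> (\<pi> w) \<partial>\<Xi>)" by (rule Y) simp
      also have "\<dots> = chain (\<lambda>w e r. b e (\<pi> w, r) * (Y (\<pi> w) * indicator C r))"
        by (intro nn_integral_cong) (simp add: pull)
      finally show ?thesis .
    qed
    have ind: "indicator (A \<times> C) = (\<lambda>x. indicator A (fst x) * indicator C (snd x) :: ennreal)"
      by (auto split: split_indicator)
    have "emeasure m1 (A \<times> C) = (\<integral>\<^sup>+x. indicator A (fst x) * indicator C (snd x) \<partial>m1)"
      using nn_integral_indicator[of "A \<times> C" m1] by (simp add: ind m1_def)
    also have "\<dots> = chain (\<lambda>w e r. indicator U e * (indicator A w * indicator C r))"
      by (subst m1) auto
    also have "\<dots> = chain (\<lambda>w e r. indicator U e * (Y (\<pi> w) * indicator C r))"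
      using swap[of "\<lambda>e _. indicator U e"] by simp
    \<comment> \<open>After the swap the factor next to \<open>b\<close> depends on \<open>w\<close>
      through \<open>\<pi> w\<close> only, which is the case that \<open>hyp\<close> covers.\<close>
    also have "\<dots> = chain (\<lambda>w e r. emeasure (p' (\<pi> w, r)) U * (Y (\<pi> w) * indicator C r))"
      using hyp[of "\<lambda>x. Y (fst x) * indicator C (snd x)"] by simp
    also have "\<dots> = chain (\<lambda>w e r. emeasure (p' (\<pi> w, r)) U * (indicator A w * indicator C r))"
      using swap[of "\<lambda>e x. emeasure (p' x) U"] by simp
    also have "\<dots> = (\<integral>\<^sup>+x. indicator A (fst x) * indicator C (snd x) \<partial>m2)"
      by (subst m2) auto
    also have "\<dots> = emeasure m2 (A \<times> C)"
      using nn_integral_indicator[of "A \<times> C" m2] by (simp add: ind m2_def)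
    finally show ?thesis .
  qed
  have "m1 = m2"
  proof (rule measure_eqI_rectangles)
    show "sets m1 = sets (\<Xi> \<Otimes>\<^sub>M R)" "sets m2 = sets (\<Xi> \<Otimes>\<^sub>M R)" by (simp_all add: m1_def m2_def)
    have "emeasure m1 (space m1) = (\<integral>\<^sup>+x. 1 \<partial>m1)" by simp
    also have "\<dots> = (\<integral>\<^sup>+x. indicator U (fst (snd x)) \<partial>joint)"
      unfolding m1_def by (simp add: nn_integral_distr nn_integral_density del: nn_integral_const nn_integral_indicator)
    also have "\<dots> \<le> (\<integral>\<^sup>+x. 1 \<partial>joint)"
      by (intro nn_integral_mono) (simp split: split_indicator)
    also have "\<dots> = emeasure joint (space joint)" by simp
    also have "\<dots> = 1" by (rule prob_space.emeasure_space_1[OF prob_joint])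
    finally show "emeasure m1 (space \<Xi> \<times> space R) \<noteq> \<infinity>" 
      by (auto simp: m1_def space_pair_measure top_unique)
  qed (rule rect)
  then show ?thesis using m1[OF g] m2[OF g] by simp
qed

end

section \<open>Measurability of the run\<close>

text \<open>The posterior is any family that satisfies the disintegration in the rounds up to
  \<open>T\<close>. Second countability gives the support of the prior full mass
  (\<open>AE_supp\<close>).\<close>

locale bms =
  fixes Z :: "('e::second_countable_topology, 'a) bandit" and M :: nat
    and B :: "nat \<Rightarrow> ('a, 's) learner" and post :: "('e, 'a) posterior" and T :: nat
  assumes bandit: "bayesian_bandit Z"
    and unit: "rewards_in_unit_interval Z"
    and M: "1 \<le> M"
    and learners: "\<And>i. i \<in> {1..M} \<Longrightarrow> base_learner Z (B i)"
    and posterior: "\<And>t. t \<in> {1..T} \<Longrightarrow> is_posterior Z M B post t"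
begin

abbreviation "A \<equiv> actions Z"
abbreviation "Obs \<equiv> count_space {1..M} \<Otimes>\<^sub>M A \<Otimes>\<^sub>M (borel :: real measure)"
abbreviation "Tr n \<equiv> trace_space Z M n"
abbreviation "St \<equiv> PiM {1..M} (\<lambda>i. states (B i))"
abbreviation "Run n \<equiv> run_space Z M B n"
abbreviation "run \<equiv> bms_run Z M B post"
abbreviation "bayes \<equiv> bayes_run Z M B post"
abbreviation "select \<equiv> bms_select Z M post"
abbreviation "round_kernel \<equiv> bms_round Z M B post"

lemma reward_kernel[measurable]: "(\<lambda>x. reward Z (fst x) (snd x)) \<in> borel \<Otimes>\<^sub>M A \<rightarrow>\<^sub>M prob_algebra borel"
  using bandit by (simp add: bayesian_bandit_def case_prod_beta')

lemma prior_prob: "prob_space (prior Z)" and sets_prior[measurable_cong, simp]: "sets (prior Z) = sets borel"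
  using bandit by (auto simp: bayesian_bandit_def)

lemma space_prior[simp]: "space (prior Z) = UNIV"
  using sets_eq_imp_space_eq[OF sets_prior] by simp

lemma opt_mean_measurable[measurable]: "opt_mean Z \<in> borel_measurable borel"
  using bandit by (auto simp: bayesian_bandit_def)

lemma reward_prob: "a \<in> space A \<Longrightarrow> prob_space (reward Z \<nu> a)"
  and sets_reward: "a \<in> space A \<Longrightarrow> sets (reward Z \<nu> a) = sets borel"
  using prob_algebraD[OF reward_kernel, of "(\<nu>, a)"] by (auto simp: space_pair_measure)

lemma reward_unit: "a \<in> space A \<Longrightarrow> AE r in reward Z \<nu> a. 0 \<le> r \<and> r \<le> 1"
  using unit by (auto simp: rewards_in_unit_interval_def)

lemma reward_integrable: "a \<in> space A \<Longrightarrow> integrable (reward Z \<nu> a) (\<lambda>r. r)"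
  using reward_prob[of a \<nu>] reward_unit[of a \<nu>] sets_reward[of a \<nu>]
  by (intro finite_measure.integrable_const_bound[where B=1])
     (auto simp: prob_space_def cong: measurable_cong_sets)

lemma mean_eq_nn_integral:
  assumes "a \<in> space A"
  shows "(\<integral>\<^sup>+r. ennreal r \<partial>reward Z \<nu> a) = ennreal (mean_reward Z \<nu> a)"
  unfolding mean_reward_def using reward_unit[OF assms] reward_integrable[OF assms]
  by (intro nn_integral_eq_integral) auto

lemma mean_nonneg: "a \<in> space A \<Longrightarrow> 0 \<le> mean_reward Z \<nu> a"
  unfolding mean_reward_def using reward_unit by (intro integral_nonneg_AE) auto

lemma mean_le_1: "a \<in> space A \<Longrightarrow> mean_reward Z \<nu> a \<le> 1"
  unfolding mean_reward_def
  using reward_unit reward_integrable reward_prob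
  by (intro prob_space.integral_le_const) auto

lemma mean_compl_eq_nn_integral:
  assumes "a \<in> space A"
  shows "(\<integral>\<^sup>+r. ennreal (1 - r) \<partial>reward Z \<nu> a) = ennreal (1 - mean_reward Z \<nu> a)"
proof -
  interpret prob_space "reward Z \<nu> a" by (rule reward_prob[OF assms])
  have "(\<integral>r. 1 - r \<partial>reward Z \<nu> a) = 1 - mean_reward Z \<nu> a"
    using reward_integrable[OF assms] by (simp add: mean_reward_def prob_space)
  then show ?thesis
    using reward_unit[OF assms] reward_integrable[OF assms]
    by (subst nn_integral_eq_integral) auto
qed

lemma mean_reward_measurable[measurable]:
  "(\<lambda>x. mean_reward Z (fst x) (snd x)) \<in> borel_measurable (borel \<Otimes>\<^sub>M A)"
proof -
  have "(\<lambda>x. enn2real (\<integral>\<^sup>+r. ennreal r \<partial>reward Z (fst x) (snd x))) \<in> borel_measurable (borel \<Otimes>\<^sub>M A)"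
    by (intro measurable_compose[OF nn_integral_kernel_measurable[OF _ reward_kernel]]) measurable
  then show ?thesis
    by (rule measurable_cong[THEN iffD1, rotated])
       (auto simp: space_pair_measure mean_eq_nn_integral mean_nonneg)
qed

lemma learner_kernels:
  assumes "i \<in> {1..M}"
  shows "init_state (B i) \<in> space (prob_algebra (states (B i)))"
    and "policy (B i) t \<in> states (B i) \<rightarrow>\<^sub>M prob_algebra A"
    and "(\<lambda>x. update_state (B i) t (fst x) (fst (snd x)) (snd (snd x)))
        \<in> states (B i) \<Otimes>\<^sub>M A \<Otimes>\<^sub>M borel \<rightarrow>\<^sub>M prob_algebra (states (B i))"
  using learners[OF assms] by (auto simp: base_learner_def case_prod_beta')

text \<open>Learner 1 has a state, and its policy there is a probability measure on the actions.
  Without actions the supremum in \<open>opt_mean\<close> would be unspecified.\<close>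

lemma A_nonempty: "space A \<noteq> {}"
proof -
  have i: "1 \<in> {1..M}" using M by simp
  obtain s where s: "s \<in> space (states (B 1))"
    using learner_kernels(1)[OF i] prob_space.not_empty by (force simp: space_prob_algebra dest: sets_eq_imp_space_eq)
  have "policy (B 1) 0 s \<in> space (prob_algebra A)"
    using measurable_space[OF learner_kernels(2)[OF i] s] .
  then show ?thesis
    using prob_space.not_empty by (force simp: space_prob_algebra dest: sets_eq_imp_space_eq)
qed

lemma mean_le_opt: "a \<in> space A \<Longrightarrow> mean_reward Z \<nu> a \<le> opt_mean Z \<nu>"
  unfolding opt_mean_def using mean_le_1 by (intro cSUP_upper) (auto intro!: bdd_aboveI2[where M=1])

lemma opt_le_1: "opt_mean Z \<nu> \<le> 1"
  unfolding opt_mean_def using A_nonempty mean_le_1 by (intro cSUP_least) auto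

lemma opt_nonneg: "0 \<le> opt_mean Z \<nu>"
  using A_nonempty mean_nonneg mean_le_opt by (meson all_not_in_conv order_trans)

section \<open>Measurability of trace functionals and of the selection rule\<close>

lemma obs_component:
  assumes [measurable]: "H \<in> N \<rightarrow>\<^sub>M Tr n" and l: "l \<in> {1..n}"
  shows "(\<lambda>x. H x l) \<in> N \<rightarrow>\<^sub>M Obs"
  using assms measurable_component_singleton[OF l, of "\<lambda>_. Obs"] measurable_compose
  unfolding trace_space_def by blast

lemma obs_space:
  assumes "h \<in> space (Tr n)" "l \<in> {1..n}"
  shows "fst (h l) \<in> {1..M}" "action h l \<in> space A"
proof -
  have "h l \<in> space Obs"
    using PiE_mem[of h "{1..n}" "\<lambda>_. space Obs" l] assms unfolding trace_space_def space_PiM by blast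
  then show "fst (h l) \<in> {1..M}" "action h l \<in> space A"
    by (auto simp: space_pair_measure action_def)
qed

text \<open>The index set varies with the sample point, so the sum is rewritten over the fixed set
  \<open>{1..<t}\<close> with an indicator.\<close>

lemma sum_selected_measurable:
  fixes g :: "'x \<Rightarrow> nat \<times> 'a \<times> real \<Rightarrow> 'b::{second_countable_topology, topological_comm_monoid_add}"
  assumes g: "(\<lambda>x. g (fst x) (snd x)) \<in> borel_measurable (N \<Otimes>\<^sub>M Obs)"
    and H: "H \<in> N \<rightarrow>\<^sub>M Tr n" and t: "t \<le> Suc n"
  shows "(\<lambda>x. \<Sum>l\<in>selected i t (H x). g x (H x l)) \<in> borel_measurable N"
proof -
  have "(\<lambda>x. if fst (H x l) = i then g x (H x l) else 0) \<in> borel_measurable N" if "l \<in> {1..<t}" for l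
  proof -
    have Hl[measurable]: "(\<lambda>x. H x l) \<in> N \<rightarrow>\<^sub>M Obs"
      using that t by (intro obs_component[OF H]) auto
    have [measurable]: "(\<lambda>x. g x (H x l)) \<in> borel_measurable N"
      using measurable_compose[OF measurable_Pair[OF measurable_ident_sets[OF refl] Hl] g] by simp
    show ?thesis by measurable
  qed
  then have "(\<lambda>x. \<Sum>l\<in>{1..<t}. if fst (H x l) = i then g x (H x l) else 0) \<in> borel_measurable N"
    by (rule borel_measurable_sum)
  moreover have "(\<Sum>l\<in>selected i t h. f l) = (\<Sum>l\<in>{1..<t}. if fst (h l) = i then f l else 0)"
    for h :: "'a trace" and f :: "nat \<Rightarrow> 'b"
    unfolding selected_def by (rule sum.inter_filter) simp
  ultimately show ?thesis by simp
qed

lemma card_selected_measurable: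
  assumes "H \<in> N \<rightarrow>\<^sub>M Tr n" "t \<le> Suc n"
  shows "(\<lambda>x. real (card (selected i t (H x)))) \<in> borel_measurable N"
  using sum_selected_measurable[of "\<lambda>_ _. 1::real", OF _ assms] by simp

lemma mean_selected_measurable:
  assumes [measurable]: "H \<in> N \<rightarrow>\<^sub>M Tr n" "G \<in> N \<rightarrow>\<^sub>M borel" and t: "t \<le> Suc n"
  shows "(\<lambda>x. \<Sum>l\<in>selected i t (H x). mean_reward Z (G x) (action (H x) l)) \<in> borel_measurable N"
proof -
  have "(\<lambda>x. (G (fst x), fst (snd (snd x)))) \<in> N \<Otimes>\<^sub>M Obs \<rightarrow>\<^sub>M borel \<Otimes>\<^sub>M A"
    by measurable
  from measurable_compose[OF this mean_reward_measurable]
  show ?thesis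
    using sum_selected_measurable[of "\<lambda>x y. mean_reward Z (G x) (fst (snd y))", OF _ _ t]
    by (simp add: action_def)
qed

lemma potential_measurable:
  assumes [measurable]: "H \<in> N \<rightarrow>\<^sub>M Tr n" "G \<in> N \<rightarrow>\<^sub>M borel" and t: "t \<le> Suc n"
  shows "(\<lambda>x. bms_potential Z (G x) t (H x) i) \<in> borel_measurable N"
  unfolding bms_potential_def
  using card_selected_measurable[OF _ t, measurable] mean_selected_measurable[OF _ _ t, measurable]
  by measurable

lemma potential_eq_regret: "bms_potential Z \<nu> t h i = regret Z \<nu> i t h"
  by (simp add: bms_potential_def regret_def sum_subtractf)

lemma arg_min_on_in: "arg_min_on (f :: nat \<Rightarrow> real) {1..M} \<in> {1..M}"
  using M by (intro arg_min_if_finite) auto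

text \<open>\<open>arg_min_on\<close> breaks ties by an unspecified choice, but this choice depends
  only on the set \<open>S x\<close> of minimisers. That set takes finitely many values, each on a
  measurable set, so any function of it is measurable.\<close>

lemma arg_min_measurable:
  fixes F :: "'x \<Rightarrow> nat \<Rightarrow> real"
  assumes [measurable]: "\<And>i. i \<in> {1..M} \<Longrightarrow> (\<lambda>x. F x i) \<in> borel_measurable N"
  shows "(\<lambda>x. arg_min_on (F x) {1..M}) \<in> N \<rightarrow>\<^sub>M count_space {1..M}"
proof -
  define S where "S x = {i\<in>{1..M}. \<forall>j\<in>{1..M}. F x i \<le> F x j}" for x
  have eq: "arg_min_on (F x) {1..M} = (SOME i. i \<in> S x)" for x
    unfolding arg_min_on_def arg_min_def S_def is_arg_min_linorder by (rule arg_cong[where f=Eps]) auto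
  have S: "S \<in> N \<rightarrow>\<^sub>M count_space (Pow {1..M})"
  proof (subst measurable_count_space_eq2, simp, intro conjI ballI)
    show "S \<in> space N \<rightarrow> Pow {1..M}" by (auto simp: S_def)
    fix C :: "nat set" assume "C \<in> Pow {1..M}"
    then have "(S x = C) = (\<forall>i\<in>{1..M}. (i \<in> C) = (\<forall>j\<in>{1..M}. F x i \<le> F x j))" for x
      unfolding S_def set_eq_iff mem_Collect_eq by blast
    then have "S -` {C} \<inter> space N = {x \<in> space N. \<forall>i\<in>{1..M}. (i \<in> C) = (\<forall>j\<in>{1..M}. F x i \<le> F x j)}"
      by blast
    also have "\<dots> \<in> sets N" by measurable
    finally show "S -` {C} \<inter> space N \<in> sets N" .
  qed
  have "(\<lambda>x. SOME i. i \<in> S x) \<in> N \<rightarrow>\<^sub>M count_space UNIV"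
    by (rule measurable_compose[OF S]) simp
  then have *: "(\<lambda>x. arg_min_on (F x) {1..M}) \<in> N \<rightarrow>\<^sub>M count_space UNIV"
    unfolding eq .
  show ?thesis
    unfolding measurable_count_space_eq2[OF finite_atLeastAtMost]
  proof (intro conjI ballI)
    show "(\<lambda>x. arg_min_on (F x) {1..M}) \<in> space N \<rightarrow> {1..M}"
      by (intro Pi_I arg_min_on_in)
    show "(\<lambda>x. arg_min_on (F x) {1..M}) -` {a} \<inter> space N \<in> sets N" for a
      by (rule measurable_sets[OF *]) simp
  qed
qed

lemma select_map_measurable:
  assumes "H \<in> N \<rightarrow>\<^sub>M Tr n" "G \<in> N \<rightarrow>\<^sub>M borel" "t \<le> Suc n"
  shows "(\<lambda>x. arg_min_on (bms_potential Z (G x) t (H x)) {1..M}) \<in> N \<rightarrow>\<^sub>M count_space {1..M}"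
  by (intro arg_min_measurable potential_measurable[OF assms])

lemma history_measurable:
  assumes H: "H \<in> N \<rightarrow>\<^sub>M Tr n" and t: "t \<le> Suc n"
  shows "(\<lambda>x. history t (H x)) \<in> N \<rightarrow>\<^sub>M history_space Z t"
  unfolding history_def history_space_def
proof (intro measurable_restrict)
  fix l assume "l \<in> {1..<t}"
  then have "(\<lambda>x. H x l) \<in> N \<rightarrow>\<^sub>M Obs" using t by (intro obs_component[OF H]) auto
  then show "(\<lambda>x. snd (H x l)) \<in> N \<rightarrow>\<^sub>M A \<Otimes>\<^sub>M borel" by measurable
qed

lemma post_measurable[measurable]: "t \<in> {1..T} \<Longrightarrow> post t \<in> history_space Z t \<rightarrow>\<^sub>M prob_algebra borel"
  using posterior by (auto simp: is_posterior_def)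

lemma post_Suc: "Suc n \<le> T \<Longrightarrow> post (Suc n) \<in> history_space Z (Suc n) \<rightarrow>\<^sub>M prob_algebra borel"
  by (rule post_measurable) simp

lemma select_measurable:
  assumes n: "Suc n \<le> T"
  shows "select (Suc n) \<in> Tr n \<rightarrow>\<^sub>M prob_algebra (count_space {1..M})"
proof (cases "Suc n \<le> M")
  case True
  have "(if Suc n mod M = 0 then M else Suc n mod M) \<in> {1..M}"
    using M by (auto intro: less_imp_le simp: Suc_le_eq)
  then have "return (count_space {1..M}) (if Suc n mod M = 0 then M else Suc n mod M)
    \<in> space (prob_algebra (count_space {1..M}))"
    by (auto simp: space_prob_algebra intro: prob_space_return)
  then show ?thesis using True by (simp add: bms_select_def[abs_def])
next
  case False
  note post_Suc[OF n, measurable]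
  have [measurable]: "history (Suc n) \<in> Tr n \<rightarrow>\<^sub>M history_space Z (Suc n)"
    using history_measurable[OF measurable_ident, of "Suc n" n] by (simp add: id_def)
  have "(\<lambda>h. distr (post (Suc n) (history (Suc n) h)) (count_space {1..M})
      (\<lambda>e. arg_min_on (bms_potential Z e (Suc n) h) {1..M})) \<in> Tr n \<rightarrow>\<^sub>M prob_algebra (count_space {1..M})"
  proof (rule measurable_distr_prob_space2)
    show "(\<lambda>h. post (Suc n) (history (Suc n) h)) \<in> Tr n \<rightarrow>\<^sub>M prob_algebra borel" by measurable
    show "(\<lambda>(h, e). arg_min_on (bms_potential Z e (Suc n) h) {1..M}) \<in> Tr n \<Otimes>\<^sub>M borel \<rightarrow>\<^sub>M count_space {1..M}"
      unfolding case_prod_beta' by (rule select_map_measurable[where n=n]) auto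
  qed
  then show ?thesis using False by (simp add: bms_select_def[abs_def])
qed

lemma upd_measurable:
  assumes i: "i \<in> {1..M}"
  shows "(\<lambda>((h, \<sigma>), a, r, s). (h(Suc n := (i, a, r)), \<sigma>(i := s)))
    \<in> Run n \<Otimes>\<^sub>M A \<Otimes>\<^sub>M borel \<Otimes>\<^sub>M states (B i) \<rightarrow>\<^sub>M Run (Suc n)"
proof -
  \<comment> \<open>\<open>measurable_fun_upd\<close> wants the index set as old indices plus the
    updated one. A state is overwritten in place, so its index is already among the old
    ones.\<close>
  have e1: "{1..Suc n} = {1..n} \<union> {Suc n}" and e2: "{1..M} = {1..M} \<union> {i}" using i by auto
  have [measurable]: "i \<in> space (count_space {1..M})" using i by simp
  have 1: "(\<lambda>((h, \<sigma>), a, r, s). h(Suc n := (i, a, r))) \<in> Run n \<Otimes>\<^sub>M A \<Otimes>\<^sub>M borel \<Otimes>\<^sub>M states (B i) \<rightarrow>\<^sub>M Tr (Suc n)"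
    unfolding trace_space_def run_space_def split_beta
    by (rule measurable_fun_upd[OF e1]) measurable
  have 2: "(\<lambda>((h, \<sigma>), a, r, s). \<sigma>(i := s)) \<in> Run n \<Otimes>\<^sub>M A \<Otimes>\<^sub>M borel \<Otimes>\<^sub>M states (B i) \<rightarrow>\<^sub>M St"
    unfolding trace_space_def run_space_def split_beta
    by (rule measurable_fun_upd[OF e2]) measurable
  show ?thesis
    unfolding run_space_def[of _ _ _ "Suc n"] using measurable_Pair[OF 1 2] by (simp add: case_prod_beta')
qed

end

lemma nn_integral_bind_kernel:
  assumes K: "K \<in> P \<rightarrow>\<^sub>M prob_algebra N" and L: "(\<lambda>z. L (fst z) (snd z)) \<in> P \<Otimes>\<^sub>M N \<rightarrow>\<^sub>M prob_algebra R"
    and f: "f \<in> borel_measurable R" and x: "x \<in> space P"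
  shows "(\<integral>\<^sup>+z. f z \<partial>(K x \<bind> L x)) = (\<integral>\<^sup>+y. \<integral>\<^sup>+z. f z \<partial>L x y \<partial>K x)"
proof -
  have "L x \<in> N \<rightarrow>\<^sub>M prob_algebra R"
    using measurable_compose[OF measurable_Pair1'[OF x] L] by simp
  then have "L x \<in> K x \<rightarrow>\<^sub>M prob_algebra R"
    using prob_algebraD(2)[OF K x] by (simp cong: measurable_cong_sets)
  then show ?thesis by (rule nn_integral_bind_prob[OF f])
qed

lemma nn_integral_swap_prob:
  assumes "prob_space P" "prob_space N" "f \<in> borel_measurable (P \<Otimes>\<^sub>M N)"
  shows "(\<integral>\<^sup>+x. \<integral>\<^sup>+y. f (x, y) \<partial>N \<partial>P) = (\<integral>\<^sup>+y. \<integral>\<^sup>+x. f (x, y) \<partial>P \<partial>N)"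
proof -
  interpret P: prob_space P by fact
  interpret N: prob_space N by fact
  interpret pair_sigma_finite P N ..
  show ?thesis using Fubini'[of "\<lambda>x y. f (x, y)"] assms(3) by simp
qed

section \<open>A round as action kernel, reward and state update\<close>

context bms
begin

abbreviation "W n \<equiv> Run n \<Otimes>\<^sub>M count_space {1..M} \<Otimes>\<^sub>M A"

text \<open>The part of a round that does not involve the environment. It returns the old run along
  with index and action, so that its result holds everything the rest of the round depends on
  besides the environment.\<close>

definition act_kernel :: "nat \<Rightarrow> 'a trace \<times> (nat \<Rightarrow> 's) \<Rightarrow> (('a trace \<times> (nat \<Rightarrow> 's)) \<times> nat \<times> 'a) measure" where
  "act_kernel n \<omega> = select (Suc n) (fst \<omega>) \<bind>
     (\<lambda>i. policy (B i) (Suc n) (snd \<omega> i) \<bind> (\<lambda>a. return (W n) (\<omega>, i, a)))"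

abbreviation extend :: "nat \<Rightarrow> ('a trace \<times> (nat \<Rightarrow> 's)) \<times> nat \<times> 'a \<Rightarrow> real \<Rightarrow> 'a trace" where
  "extend n w r \<equiv> (fst (fst w))(Suc n := (fst (snd w), snd (snd w), r))"

definition upd_kernel :: "nat \<Rightarrow> (('a trace \<times> (nat \<Rightarrow> 's)) \<times> nat \<times> 'a) \<times> real \<Rightarrow> ('a trace \<times> (nat \<Rightarrow> 's)) measure" where
  "upd_kernel n = (\<lambda>(((h, \<sigma>), i, a), r). update_state (B i) (Suc n) (\<sigma> i) a r \<bind>
     (\<lambda>s. return (Run (Suc n)) (h(Suc n := (i, a, r)), \<sigma>(i := s))))"

lemma state_component: "i \<in> {1..M} \<Longrightarrow> (\<lambda>\<omega>. snd \<omega> i) \<in> Run n \<rightarrow>\<^sub>M states (B i)"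
  unfolding run_space_def by measurable

lemma fst_run[measurable]: "fst \<in> Run n \<rightarrow>\<^sub>M Tr n"
  unfolding run_space_def by measurable

lemma act_inner:
  assumes i: "i \<in> {1..M}"
  shows "(\<lambda>\<omega>. policy (B i) (Suc n) (snd \<omega> i) \<bind> (\<lambda>a. return (W n) (\<omega>, i, a))) \<in> Run n \<rightarrow>\<^sub>M prob_algebra (W n)"
proof -
  note [measurable] = state_component[OF i] learner_kernels(2)[OF i]
  have [measurable]: "i \<in> space (count_space {1..M})" using i by simp
  show ?thesis by measurable
qed

lemma act_kernel_measurable[measurable]:
  assumes n: "Suc n \<le> T"
  shows "act_kernel n \<in> Run n \<rightarrow>\<^sub>M prob_algebra (W n)"
  unfolding act_kernel_def
proof (rule measurable_bind_prob_space2[where N="count_space {1..M}"])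
  show "(\<lambda>\<omega>. select (Suc n) (fst \<omega>)) \<in> Run n \<rightarrow>\<^sub>M prob_algebra (count_space {1..M})"
    by (rule measurable_compose[OF fst_run select_measurable[OF n]])
  show "(\<lambda>(\<omega>, i). policy (B i) (Suc n) (snd \<omega> i) \<bind> (\<lambda>a. return (W n) (\<omega>, i, a)))
    \<in> Run n \<Otimes>\<^sub>M count_space {1..M} \<rightarrow>\<^sub>M prob_algebra (W n)"
    unfolding case_prod_beta'
    by (rule measurable_compose_countable'[where g=snd and I="{1..M}"])
       (rule measurable_compose[OF measurable_fst act_inner], auto)
qed

text \<open>The sigma-algebra \<open>states (B i)\<close> varies with the selected learner.
  Measurability is proved for each fixed \<open>i\<close> and then glued over the finite set
  \<open>{1..M}\<close>.\<close>

lemma upd_kernel_measurable[measurable]: "upd_kernel n \<in> W n \<Otimes>\<^sub>M borel \<rightarrow>\<^sub>M prob_algebra (Run (Suc n))"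
proof -
  have "(\<lambda>x. upd_kernel n ((fst (fst x), i, snd (snd (fst x))), snd x)) \<in> W n \<Otimes>\<^sub>M borel \<rightarrow>\<^sub>M prob_algebra (Run (Suc n))"
    if i: "i \<in> {1..M}" for i
  proof -
    note [measurable] = state_component[OF i]
    have 1: "(\<lambda>x. (snd (fst (fst x)) i, snd (snd (fst x)), snd x)) \<in> W n \<Otimes>\<^sub>M borel \<rightarrow>\<^sub>M states (B i) \<Otimes>\<^sub>M A \<Otimes>\<^sub>M borel"
      by measurable
    have 2: "(\<lambda>(x, s). ((fst (fst (fst x)))(Suc n := (i, snd (snd (fst x)), snd x)), (snd (fst (fst x)))(i := s)))
      \<in> (W n \<Otimes>\<^sub>M borel) \<Otimes>\<^sub>M states (B i) \<rightarrow>\<^sub>M Run (Suc n)"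
      unfolding case_prod_beta'
      using measurable_compose[OF _ upd_measurable[OF i, of n],
          of "\<lambda>z. (fst (fst (fst z)), snd (snd (fst (fst z))), snd (fst z), snd z)" "(W n \<Otimes>\<^sub>M borel) \<Otimes>\<^sub>M states (B i)"]
      by (simp add: case_prod_beta')
    show ?thesis
      unfolding upd_kernel_def case_prod_beta' fst_conv snd_conv
      by (rule measurable_bind_prob_space2[where N="states (B i)"])
         (use measurable_compose[OF 1 learner_kernels(3)[OF i]] measurable_compose[OF 2 measurable_return_prob_space]
           in \<open>simp_all add: case_prod_beta'\<close>)
  qed
  then have "(\<lambda>x. upd_kernel n ((fst (fst x), fst (snd (fst x)), snd (snd (fst x))), snd x))
      \<in> W n \<Otimes>\<^sub>M borel \<rightarrow>\<^sub>M prob_algebra (Run (Suc n))"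
    by (rule measurable_compose_countable'[where g="\<lambda>x. fst (snd (fst x))" and I="{1..M}"]) auto
  then show ?thesis by simp
qed

lemma reward_upd_measurable:
  "(\<lambda>x. reward Z (fst x) (snd (snd (snd x))) \<bind> (\<lambda>r. upd_kernel n (snd x, r)))
    \<in> borel \<Otimes>\<^sub>M W n \<rightarrow>\<^sub>M prob_algebra (Run (Suc n))"
proof -
  have "(\<lambda>x. (fst x, snd (snd (snd x)))) \<in> borel \<Otimes>\<^sub>M W n \<rightarrow>\<^sub>M borel \<Otimes>\<^sub>M A" by measurable
  note r = measurable_compose[OF this reward_kernel]
  have "(\<lambda>z. (snd (fst z), snd z)) \<in> (borel \<Otimes>\<^sub>M W n) \<Otimes>\<^sub>M borel \<rightarrow>\<^sub>M W n \<Otimes>\<^sub>M borel" by measurable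
  note u = measurable_compose[OF this upd_kernel_measurable]
  show ?thesis
    using r u by (intro measurable_bind_prob_space2[where N=borel]) (simp_all add: case_prod_beta')
qed

text \<open>The binds of index and action are reassociated into \<open>act_kernel\<close>.
  Afterwards \<open>\<nu>\<close> occurs in the reward alone, which is what makes the later change
  of the order of integration possible.\<close>

lemma round_kernel_eq:
  assumes n: "Suc n \<le> T" and \<omega>: "\<omega> \<in> space (Run n)"
  shows "round_kernel \<nu> (Suc n) \<omega> =
    act_kernel n \<omega> \<bind> (\<lambda>w. reward Z \<nu> (snd (snd w)) \<bind> (\<lambda>r. upd_kernel n (w, r)))"
proof -
  define L where "L w = reward Z \<nu> (snd (snd w)) \<bind> (\<lambda>r. upd_kernel n (w, r))" for w
  have L: "L \<in> W n \<rightarrow>\<^sub>M prob_algebra (Run (Suc n))"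
    using measurable_Pair2[OF reward_upd_measurable, of \<nu> n] by (simp add: L_def[abs_def])
  note cs = prob_algebraD(2,3)[OF measurable_compose[OF fst_run select_measurable[OF n]] \<omega>, unfolded space_count_space]
  note inner = measurable_space[OF act_inner \<omega>]
  have "act_kernel n \<omega> \<bind> L = select (Suc n) (fst \<omega>) \<bind>
    (\<lambda>i. (policy (B i) (Suc n) (snd \<omega> i) \<bind> (\<lambda>a. return (W n) (\<omega>, i, a))) \<bind> L)"
    unfolding act_kernel_def
  proof (rule bind_assoc[OF _ measurable_prob_algebraD[OF L]])
    show "(\<lambda>i. policy (B i) (Suc n) (snd \<omega> i) \<bind> (\<lambda>a. return (W n) (\<omega>, i, a)))
      \<in> select (Suc n) (fst \<omega>) \<rightarrow>\<^sub>M subprob_algebra (W n)"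
      by (intro measurable_prob_algebraD)
         (use inner in \<open>simp del: One_nat_def atLeastAtMost_iff add: measurable_cong_sets[OF cs(1) refl] Pi_iff\<close>)
  qed
  also have "\<dots> = select (Suc n) (fst \<omega>) \<bind>
    (\<lambda>i. policy (B i) (Suc n) (snd \<omega> i) \<bind> (\<lambda>a. L (\<omega>, i, a)))"
  proof (rule bind_cong[OF refl])
    fix i assume "i \<in> space (select (Suc n) (fst \<omega>))"
    then have i: "i \<in> {1..M}" using cs by simp
    have \<sigma>: "snd \<omega> i \<in> space (states (B i))" using measurable_space[OF state_component[OF i] \<omega>] .
    note p = prob_algebraD[OF learner_kernels(2)[OF i] \<sigma>]
    have ret: "(\<lambda>a. (\<omega>, i, a)) \<in> A \<rightarrow>\<^sub>M W n"
      using \<omega> i by simp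
    have "(policy (B i) (Suc n) (snd \<omega> i) \<bind> (\<lambda>a. return (W n) (\<omega>, i, a))) \<bind> L
      = policy (B i) (Suc n) (snd \<omega> i) \<bind> (\<lambda>a. return (W n) (\<omega>, i, a) \<bind> L)"
      using measurable_compose[OF ret return_measurable] p
      by (intro bind_assoc[OF _ measurable_prob_algebraD[OF L]]) (simp cong: measurable_cong_sets)
    also have "\<dots> = policy (B i) (Suc n) (snd \<omega> i) \<bind> (\<lambda>a. L (\<omega>, i, a))"
    proof (rule bind_cong[OF refl])
      fix a assume "a \<in> space (policy (B i) (Suc n) (snd \<omega> i))"
      then show "return (W n) (\<omega>, i, a) \<bind> L = L (\<omega>, i, a)"
        using measurable_space[OF ret] p by (intro bind_return[OF measurable_prob_algebraD[OF L]]) simp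
    qed
    finally show "(policy (B i) (Suc n) (snd \<omega> i) \<bind> (\<lambda>a. return (W n) (\<omega>, i, a))) \<bind> L
      = policy (B i) (Suc n) (snd \<omega> i) \<bind> (\<lambda>a. L (\<omega>, i, a))" .
  qed
  also have "\<dots> = round_kernel \<nu> (Suc n) \<omega>"
    by (cases \<omega>) (simp add: bms_round_def L_def upd_kernel_def)
  finally show ?thesis by (simp add: L_def[abs_def])
qed

lemma round_kernel_measurable:
  assumes n: "Suc n \<le> T"
  shows "(\<lambda>x. round_kernel (fst x) (Suc n) (snd x)) \<in> borel \<Otimes>\<^sub>M Run n \<rightarrow>\<^sub>M prob_algebra (Run (Suc n))"
proof -
  note [measurable] = act_kernel_measurable[OF n]
  have "(\<lambda>x. act_kernel n (snd x) \<bind> (\<lambda>w. reward Z (fst x) (snd (snd w)) \<bind> (\<lambda>r. upd_kernel n (w, r))))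
      \<in> borel \<Otimes>\<^sub>M Run n \<rightarrow>\<^sub>M prob_algebra (Run (Suc n))"
  proof (rule measurable_bind_prob_space2[where N="W n"])
    show "(\<lambda>(x, w). reward Z (fst x) (snd (snd w)) \<bind> (\<lambda>r. upd_kernel n (w, r)))
      \<in> (borel \<Otimes>\<^sub>M Run n) \<Otimes>\<^sub>M W n \<rightarrow>\<^sub>M prob_algebra (Run (Suc n))"
      unfolding case_prod_beta'
      using measurable_compose[OF _ reward_upd_measurable, of "\<lambda>z. (fst (fst z), snd z)" "(borel \<Otimes>\<^sub>M Run n) \<Otimes>\<^sub>M W n" n] by simp
  qed measurable
  then show ?thesis
    by (rule measurable_cong[THEN iffD1, rotated]) (auto simp: round_kernel_eq[OF n] space_pair_measure)
qed

lemma run_kernel: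
  "n \<le> T \<Longrightarrow> (\<lambda>\<nu>. run \<nu> n) \<in> borel \<rightarrow>\<^sub>M prob_algebra (Run n)"
proof (induction n)
  case 0
  have "return (Tr 0) (\<lambda>_. undefined) \<in> space (prob_algebra (Tr 0))"
    by (auto simp: space_prob_algebra trace_space_def space_PiM intro!: prob_space_return)
  moreover have "PiM {1..M} (\<lambda>i. init_state (B i)) \<in> space (prob_algebra St)"
    using learner_kernels(1) by (auto simp: space_prob_algebra intro!: prob_space_PiM sets_PiM_cong)
  ultimately have "return (Tr 0) (\<lambda>_. undefined) \<Otimes>\<^sub>M PiM {1..M} (\<lambda>i. init_state (B i)) \<in> space (prob_algebra (Run 0))"
    by (auto simp: space_prob_algebra run_space_def prob_space_pair cong: sets_pair_measure_cong)
  then show ?case by simp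
next
  case (Suc n)
  then have "(\<lambda>\<nu>. run \<nu> n) \<in> borel \<rightarrow>\<^sub>M prob_algebra (Run n)" by simp
  then show ?case
    unfolding bms_run.simps
    by (rule measurable_bind_prob_space2) (use round_kernel_measurable[OF Suc.prems] in \<open>simp add: case_prod_beta'\<close>)
qed

lemma run_prob: "n \<le> T \<Longrightarrow> prob_space (run \<nu> n)"
  and sets_run: "n \<le> T \<Longrightarrow> sets (run \<nu> n) = sets (Run n)"
  and space_run: "n \<le> T \<Longrightarrow> space (run \<nu> n) = space (Run n)"
  using prob_algebraD[OF run_kernel, of n \<nu>] by auto

lemma nn_integral_round:
  assumes n: "Suc n \<le> T" and f: "f \<in> borel_measurable (Run (Suc n))" and \<omega>: "\<omega> \<in> space (Run n)"
  shows "(\<integral>\<^sup>+x. f x \<partial>round_kernel \<nu> (Suc n) \<omega>) =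
    (\<integral>\<^sup>+w. \<integral>\<^sup>+r. \<integral>\<^sup>+x. f x \<partial>upd_kernel n (w, r) \<partial>reward Z \<nu> (snd (snd w)) \<partial>act_kernel n \<omega>)"
proof -
  have k: "(\<lambda>w. reward Z \<nu> (snd (snd w)) \<bind> (\<lambda>r. upd_kernel n (w, r))) \<in> W n \<rightarrow>\<^sub>M prob_algebra (Run (Suc n))"
    using measurable_Pair2[OF reward_upd_measurable, of \<nu> n] by simp
  note act = prob_algebraD[OF act_kernel_measurable[OF n] \<omega>]
  have r: "(\<lambda>w. reward Z \<nu> (snd (snd w))) \<in> W n \<rightarrow>\<^sub>M prob_algebra borel"
    using measurable_compose[OF _ reward_kernel, of "\<lambda>w. (\<nu>, snd (snd w))" "W n"] by simp
  show ?thesis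
    unfolding round_kernel_eq[OF n \<omega>]
    apply (subst nn_integral_bind_prob[OF f])
    subgoal using k act by (simp cong: measurable_cong_sets)
    apply (intro nn_integral_cong)
    using act upd_kernel_measurable nn_integral_bind_kernel[OF r, of "\<lambda>w r. upd_kernel n (w, r)", OF _ f]
    by (simp del: One_nat_def)
qed

lemma nn_integral_run_Suc:
  assumes n: "Suc n \<le> T" and f: "f \<in> borel_measurable (Run (Suc n))"
  shows "(\<integral>\<^sup>+x. f x \<partial>run \<nu> (Suc n)) =
    (\<integral>\<^sup>+\<omega>. \<integral>\<^sup>+w. \<integral>\<^sup>+r. \<integral>\<^sup>+x. f x \<partial>upd_kernel n (w, r) \<partial>reward Z \<nu> (snd (snd w)) \<partial>act_kernel n \<omega> \<partial>run \<nu> n)"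
proof -
  have "(\<lambda>\<omega>. round_kernel \<nu> (Suc n) \<omega>) \<in> Run n \<rightarrow>\<^sub>M prob_algebra (Run (Suc n))"
    using measurable_Pair2[OF round_kernel_measurable[OF n], of \<nu>] by simp
  then have "(\<integral>\<^sup>+x. f x \<partial>run \<nu> (Suc n)) =
      (\<integral>\<^sup>+\<omega>. \<integral>\<^sup>+x. f x \<partial>round_kernel \<nu> (Suc n) \<omega> \<partial>run \<nu> n)"
    using sets_run[of n \<nu>] n unfolding bms_run.simps
    by (intro nn_integral_bind_prob[OF f]) (simp cong: measurable_cong_sets)
  also have "\<dots> = (\<integral>\<^sup>+\<omega>. \<integral>\<^sup>+w. \<integral>\<^sup>+r. \<integral>\<^sup>+x. f x \<partial>upd_kernel n (w, r) \<partial>reward Z \<nu> (snd (snd w)) \<partial>act_kernel n \<omega> \<partial>run \<nu> n)"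
    using n space_run[of n \<nu>] by (intro nn_integral_cong nn_integral_round[OF n f]) simp
  finally show ?thesis .
qed

lemma bayes_kernel:
  assumes n: "n \<le> T"
  shows "(\<lambda>\<nu>. run \<nu> n \<bind> (\<lambda>\<omega>. return (borel \<Otimes>\<^sub>M Run n) (\<nu>, \<omega>))) \<in> borel \<rightarrow>\<^sub>M prob_algebra (borel \<Otimes>\<^sub>M Run n)"
  using run_kernel[OF n, measurable] by measurable

lemma bayes_prob: "n \<le> T \<Longrightarrow> prob_space (bayes n)"
  and sets_bayes: "n \<le> T \<Longrightarrow> sets (bayes n) = sets (borel \<Otimes>\<^sub>M Run n)"
  using prob_space_bind'[OF _ bayes_kernel, of "prior Z" n] sets_bind'[OF _ bayes_kernel, of "prior Z" n] prior_prob
  by (auto simp: bayes_run_def space_prob_algebra)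

lemma space_bayes: "n \<le> T \<Longrightarrow> space (bayes n) = UNIV \<times> space (Run n)"
  using sets_eq_imp_space_eq[OF sets_bayes] by (simp add: space_pair_measure)

lemma nn_integral_bayes:
  assumes n: "n \<le> T" and f: "f \<in> borel_measurable (borel \<Otimes>\<^sub>M Run n)"
  shows "(\<integral>\<^sup>+x. f x \<partial>bayes n) = (\<integral>\<^sup>+\<nu>. \<integral>\<^sup>+\<omega>. f (\<nu>, \<omega>) \<partial>run \<nu> n \<partial>prior Z)"
proof -
  have "(\<integral>\<^sup>+x. f x \<partial>bayes n) =
    (\<integral>\<^sup>+\<nu>. \<integral>\<^sup>+x. f x \<partial>(run \<nu> n \<bind> (\<lambda>\<omega>. return (borel \<Otimes>\<^sub>M Run n) (\<nu>, \<omega>))) \<partial>prior Z)"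
    unfolding bayes_run_def
    by (rule nn_integral_bind_prob[OF f]) (use bayes_kernel[OF n] in \<open>simp cong: measurable_cong_sets\<close>)
  also have "\<dots> = (\<integral>\<^sup>+\<nu>. \<integral>\<^sup>+\<omega>. f (\<nu>, \<omega>) \<partial>run \<nu> n \<partial>prior Z)"
  proof (intro nn_integral_cong)
    fix \<nu> :: 'e
    have "(\<lambda>\<omega>. return (borel \<Otimes>\<^sub>M Run n) (\<nu>, \<omega>)) \<in> run \<nu> n \<rightarrow>\<^sub>M prob_algebra (borel \<Otimes>\<^sub>M Run n)"
      using sets_run[OF n, of \<nu>] by (simp cong: measurable_cong_sets)
    then show "(\<integral>\<^sup>+x. f x \<partial>(run \<nu> n \<bind> (\<lambda>\<omega>. return (borel \<Otimes>\<^sub>M Run n) (\<nu>, \<omega>)))) =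
        (\<integral>\<^sup>+\<omega>. f (\<nu>, \<omega>) \<partial>run \<nu> n)"
      using f space_run[OF n, of \<nu>]
      by (subst nn_integral_bind_prob[OF f]) (auto intro!: nn_integral_cong nn_integral_return simp: space_pair_measure)
  qed
  finally show ?thesis .
qed

lemma nn_integral_bayes_Suc:
  assumes n: "Suc n \<le> T" and f[measurable]: "f \<in> borel_measurable (borel \<Otimes>\<^sub>M Run (Suc n))"
  shows "(\<integral>\<^sup>+x. f x \<partial>bayes (Suc n)) =
    (\<integral>\<^sup>+y. \<integral>\<^sup>+w. \<integral>\<^sup>+r. \<integral>\<^sup>+x. f (fst y, x) \<partial>upd_kernel n (w, r) \<partial>reward Z (fst y) (snd (snd w)) \<partial>act_kernel n (snd y)
      \<partial>bayes n)"
proof -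
  have n': "n \<le> T" using n by simp
  define G where "G y = (\<integral>\<^sup>+x. f (fst y, x) \<partial>round_kernel (fst y) (Suc n) (snd y))" for y
  have "(\<lambda>(y, x). f (fst y, x)) \<in> borel_measurable ((borel \<Otimes>\<^sub>M Run n) \<Otimes>\<^sub>M Run (Suc n))" by simp
  from nn_integral_kernel_measurable[OF this round_kernel_measurable[OF n]]
  have G: "G \<in> borel_measurable (borel \<Otimes>\<^sub>M Run n)" by (simp add: G_def[abs_def])
  have fs: "(\<lambda>x. f (\<nu>, x)) \<in> borel_measurable (Run (Suc n))" for \<nu>
    by (rule measurable_Pair2[OF f]) simp
  have "(\<integral>\<^sup>+x. f x \<partial>bayes (Suc n)) = (\<integral>\<^sup>+\<nu>. \<integral>\<^sup>+\<omega>. G (\<nu>, \<omega>) \<partial>run \<nu> n \<partial>prior Z)"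
    using space_run[OF n'] unfolding nn_integral_bayes[OF n f] nn_integral_run_Suc[OF n fs]
    by (intro nn_integral_cong) (simp add: G_def nn_integral_round[OF n fs])
  also have "\<dots> = (\<integral>\<^sup>+y. G y \<partial>bayes n)"
    by (rule nn_integral_bayes[OF n' G, symmetric])
  finally show ?thesis
    using space_bayes[OF n'] by (auto simp: G_def nn_integral_round[OF n fs] intro!: nn_integral_cong)
qed

end

section \<open>Exchanging the environment for a posterior sample\<close>

declare One_nat_def [simp del]

context bms
begin

lemma snd_space_bayes: "n \<le> T \<Longrightarrow> y \<in> space (bayes n) \<Longrightarrow> snd y \<in> space (Run n)"
  by (simp add: space_bayes mem_Times_iff)

lemma space_act_run:
  assumes "Suc n \<le> T" "\<omega> \<in> space (run \<nu> n)" "w \<in> space (act_kernel n \<omega>)"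
  shows "w \<in> space (W n)" and "snd (snd w) \<in> space A"
  using prob_algebraD(3)[OF act_kernel_measurable[OF assms(1)], of \<omega>] space_run[of n \<nu>] assms
  by (auto simp: space_pair_measure)

lemma space_act_bayes:
  assumes "Suc n \<le> T" "y \<in> space (bayes n)" "w \<in> space (act_kernel n (snd y))"
  shows "w \<in> space (W n)" and "snd (snd w) \<in> space A"
  using prob_algebraD(3)[OF act_kernel_measurable[OF assms(1)] snd_space_bayes] assms
  by (auto simp: space_pair_measure)

lemma nn_integral_act:
  assumes n: "Suc n \<le> T" and f: "f \<in> borel_measurable (W n)" and \<omega>: "\<omega> \<in> space (Run n)"
  shows "(\<integral>\<^sup>+w. f w \<partial>act_kernel n \<omega>) =
    (\<integral>\<^sup>+i. \<integral>\<^sup>+a. f (\<omega>, i, a) \<partial>policy (B i) (Suc n) (snd \<omega> i) \<partial>select (Suc n) (fst \<omega>))"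
proof -
  note cs = prob_algebraD(2,3)[OF measurable_compose[OF fst_run select_measurable[OF n]] \<omega>, unfolded space_count_space]
  note inner = measurable_space[OF act_inner \<omega>]
  have "(\<integral>\<^sup>+w. f w \<partial>act_kernel n \<omega>) = (\<integral>\<^sup>+i. \<integral>\<^sup>+w. f w \<partial>(policy (B i) (Suc n) (snd \<omega> i) \<bind> (\<lambda>a. return (W n) (\<omega>, i, a))) \<partial>select (Suc n) (fst \<omega>))"
    unfolding act_kernel_def
    by (intro nn_integral_bind_prob[OF f])
       (use inner in \<open>simp del: atLeastAtMost_iff add: measurable_cong_sets[OF cs(1) refl] Pi_iff\<close>)
  also have "\<dots> = (\<integral>\<^sup>+i. \<integral>\<^sup>+a. f (\<omega>, i, a) \<partial>policy (B i) (Suc n) (snd \<omega> i) \<partial>select (Suc n) (fst \<omega>))"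
  proof (intro nn_integral_cong)
    fix i assume "i \<in> space (select (Suc n) (fst \<omega>))"
    then have i: "i \<in> {1..M}" using cs by simp
    have \<sigma>: "snd \<omega> i \<in> space (states (B i))" using measurable_space[OF state_component[OF i] \<omega>] .
    note p = prob_algebraD[OF learner_kernels(2)[OF i] \<sigma>]
    have ret: "(\<lambda>a. (\<omega>, i, a)) \<in> A \<rightarrow>\<^sub>M W n"
      using \<omega> i by simp
    have "(\<lambda>a. return (W n) (\<omega>, i, a)) \<in> policy (B i) (Suc n) (snd \<omega> i) \<rightarrow>\<^sub>M prob_algebra (W n)"
      using measurable_compose[OF ret measurable_return_prob_space] p by (simp cong: measurable_cong_sets)
    then show "(\<integral>\<^sup>+w. f w \<partial>(policy (B i) (Suc n) (snd \<omega> i) \<bind> (\<lambda>a. return (W n) (\<omega>, i, a)))) =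
        (\<integral>\<^sup>+a. f (\<omega>, i, a) \<partial>policy (B i) (Suc n) (snd \<omega> i))"
      using measurable_space[OF ret] p
      by (subst nn_integral_bind_prob[OF f]) (auto intro!: nn_integral_cong nn_integral_return f)
  qed
  finally show ?thesis .
qed

text \<open>\<open>act_kernel n \<omega>\<close> returns \<open>\<omega>\<close> unchanged as first
  component. Rewriting an integrand in terms of \<open>w\<close> alone allows integration against
  \<open>act_law\<close>.\<close>

lemma act_kernel_fst:
  assumes n: "Suc n \<le> T" and f: "f \<in> borel_measurable (Run n \<Otimes>\<^sub>M W n)" and \<omega>: "\<omega> \<in> space (Run n)"
  shows "(\<integral>\<^sup>+w. f (\<omega>, w) \<partial>act_kernel n \<omega>) = (\<integral>\<^sup>+w. f (fst w, w) \<partial>act_kernel n \<omega>)"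
proof -
  have 1: "(\<lambda>w. f (\<omega>, w)) \<in> borel_measurable (W n)" using measurable_Pair2[OF f \<omega>] .
  have 2: "(\<lambda>w. f (fst w, w)) \<in> borel_measurable (W n)"
    by (rule measurable_compose[OF _ f]) simp
  show ?thesis by (simp add: nn_integral_act[OF n 1 \<omega>] nn_integral_act[OF n 2 \<omega>])
qed

lemma upd_kernel_facts:
  assumes w: "((h, \<sigma>), i, a) \<in> space (W n)"
  shows "sets (update_state (B i) (Suc n) (\<sigma> i) a r) = sets (states (B i))"
    and "(\<lambda>s. (h(Suc n := (i, a, r)), \<sigma>(i := s))) \<in> states (B i) \<rightarrow>\<^sub>M Run (Suc n)"
proof -
  have i: "i \<in> {1..M}" and a: "a \<in> space A" and \<omega>: "(h, \<sigma>) \<in> space (Run n)"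
    using w by (auto simp: space_pair_measure)
  have \<sigma>: "\<sigma> i \<in> space (states (B i))" using measurable_space[OF state_component[OF i] \<omega>] by simp
  show "sets (update_state (B i) (Suc n) (\<sigma> i) a r) = sets (states (B i))"
    using prob_algebraD[OF learner_kernels(3)[OF i], of "(\<sigma> i, a, r)" "Suc n"] \<sigma> a by (auto simp: space_pair_measure)
  have "(\<lambda>s. ((h, \<sigma>), a, r, s)) \<in> states (B i) \<rightarrow>\<^sub>M Run n \<Otimes>\<^sub>M A \<Otimes>\<^sub>M borel \<Otimes>\<^sub>M states (B i)"
    using \<omega> a by simp
  from measurable_compose[OF this upd_measurable[OF i]]
  show "(\<lambda>s. (h(Suc n := (i, a, r)), \<sigma>(i := s))) \<in> states (B i) \<rightarrow>\<^sub>M Run (Suc n)" by simp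
qed

lemma nn_integral_upd:
  assumes f: "f \<in> borel_measurable (Run (Suc n))" and w: "((h, \<sigma>), i, a) \<in> space (W n)"
  shows "(\<integral>\<^sup>+x. f x \<partial>upd_kernel n (((h, \<sigma>), i, a), r)) =
    (\<integral>\<^sup>+s. f (h(Suc n := (i, a, r)), \<sigma>(i := s)) \<partial>update_state (B i) (Suc n) (\<sigma> i) a r)"
proof -
  note u = upd_kernel_facts(1)[OF w, of r]
  note ret = upd_kernel_facts(2)[OF w, of r]
  have "(\<lambda>s. return (Run (Suc n)) (h(Suc n := (i, a, r)), \<sigma>(i := s)))
      \<in> update_state (B i) (Suc n) (\<sigma> i) a r \<rightarrow>\<^sub>M prob_algebra (Run (Suc n))"
    using measurable_compose[OF ret measurable_return_prob_space] u by (simp cong: measurable_cong_sets)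
  then show ?thesis
    unfolding upd_kernel_def using measurable_space[OF ret] sets_eq_imp_space_eq[OF u]
    by (simp, subst nn_integral_bind_prob[OF f]) (auto intro!: nn_integral_cong nn_integral_return f)
qed

text \<open>Only the new internal state is random in the update; the extended trace is determined by
  \<open>w\<close> and \<open>r\<close>, so functions of it leave the integral.\<close>

lemma nn_integral_upd_trace:
  assumes f: "f \<in> borel_measurable (Tr (Suc n))" and g: "g \<in> borel_measurable (Run (Suc n))" and w: "w \<in> space (W n)"
  shows "(\<integral>\<^sup>+x. f (fst x) * g x \<partial>upd_kernel n (w, r)) =
    f (extend n w r) * (\<integral>\<^sup>+x. g x \<partial>upd_kernel n (w, r))"
proof -
  obtain h \<sigma> i a where [simp]: "w = ((h, \<sigma>), i, a)" by (metis surj_pair)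
  have w': "((h, \<sigma>), i, a) \<in> space (W n)" using w by simp
  from measurable_compose[OF upd_kernel_facts(2)[OF w', of r] g]
  have gs: "(\<lambda>s. g (h(Suc n := (i, a, r)), \<sigma>(i := s))) \<in> borel_measurable (update_state (B i) (Suc n) (\<sigma> i) a r)"
    using upd_kernel_facts(1)[OF w', of r] by (simp cong: measurable_cong_sets)
  have "(\<lambda>x. f (fst x) * g x) \<in> borel_measurable (Run (Suc n))"
    using measurable_compose[OF fst_run f] g by simp
  from nn_integral_upd[OF this w'] nn_integral_upd[OF g w'] show ?thesis
    by (simp add: nn_integral_cmult[OF gs])
qed

lemma upd_prob: "w \<in> space (W n) \<Longrightarrow> prob_space (upd_kernel n (w, r))"
  by (rule prob_algebraD(1)[OF upd_kernel_measurable]) (simp add: space_pair_measure)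

text \<open>The integral form of \<open>is_posterior\<close>. It resamples the environment in
  functions of the history; \<open>exchange\<close> extends this to functions of the whole
  run.\<close>

lemma posterior_nn_integral:
  assumes n: "Suc n \<le> T" and f[measurable]: "f \<in> borel_measurable (history_space Z (Suc n) \<Otimes>\<^sub>M borel)"
  shows "(\<integral>\<^sup>+y. f (history (Suc n) (fst (snd y)), fst y) \<partial>bayes n) =
    (\<integral>\<^sup>+y. \<integral>\<^sup>+e. f (history (Suc n) (fst (snd y)), e) \<partial>post (Suc n) (history (Suc n) (fst (snd y))) \<partial>bayes n)"
proof -
  have n': "n \<le> T" using n by simp
  let ?J = "bayes n" and ?H = "history_space Z (Suc n)"
  note [measurable_cong] = sets_bayes[OF n']
  note post_Suc[OF n, measurable]
  have [measurable]: "(\<lambda>y. history (Suc n) (fst (snd y))) \<in> borel \<Otimes>\<^sub>M Run n \<rightarrow>\<^sub>M ?H"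
    by (rule history_measurable[where n=n]) auto
  have post: "distr ?J (?H \<Otimes>\<^sub>M borel) (\<lambda>y. (history (Suc n) (fst (snd y)), fst y)) =
       distr ?J ?H (\<lambda>y. history (Suc n) (fst (snd y))) \<bind> (\<lambda>H. post (Suc n) H \<bind> (\<lambda>\<nu>. return (?H \<Otimes>\<^sub>M borel) (H, \<nu>)))"
    using posterior[of "Suc n"] n by (simp add: is_posterior_def case_prod_beta')
  have k: "(\<lambda>H. post (Suc n) H \<bind> (\<lambda>\<nu>. return (?H \<Otimes>\<^sub>M borel) (H, \<nu>))) \<in> ?H \<rightarrow>\<^sub>M prob_algebra (?H \<Otimes>\<^sub>M borel)"
    by measurable
  have inner: "(\<integral>\<^sup>+x. f x \<partial>(post (Suc n) H \<bind> (\<lambda>\<nu>. return (?H \<Otimes>\<^sub>M borel) (H, \<nu>)))) = (\<integral>\<^sup>+e. f (H, e) \<partial>post (Suc n) H)"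
    if H: "H \<in> space ?H" for H
  proof -
    have p: "sets (post (Suc n) H) = sets borel" using n H by (intro prob_algebraD(2)[OF post_measurable]) auto
    have "(\<lambda>\<nu>. return (?H \<Otimes>\<^sub>M borel) (H, \<nu>)) \<in> post (Suc n) H \<rightarrow>\<^sub>M prob_algebra (?H \<Otimes>\<^sub>M borel)"
      using H by (simp add: measurable_cong_sets[OF p refl])
    then show ?thesis
      using H sets_eq_imp_space_eq[OF p]
      by (subst nn_integral_bind_prob[OF f]) (auto intro!: nn_integral_cong nn_integral_return f simp: space_pair_measure)
  qed
  have mi: "(\<lambda>H. \<integral>\<^sup>+x. f x \<partial>(post (Suc n) H \<bind> (\<lambda>\<nu>. return (?H \<Otimes>\<^sub>M borel) (H, \<nu>)))) \<in> borel_measurable ?H"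
    by (rule measurable_compose[OF measurable_prob_algebraD[OF k] nn_integral_measurable_subprob_algebra[OF f]])
  have "(\<integral>\<^sup>+y. f (history (Suc n) (fst (snd y)), fst y) \<partial>?J) =
     (\<integral>\<^sup>+x. f x \<partial>distr ?J (?H \<Otimes>\<^sub>M borel) (\<lambda>y. (history (Suc n) (fst (snd y)), fst y)))"
    by (subst nn_integral_distr) auto
  also have "\<dots> = (\<integral>\<^sup>+H. \<integral>\<^sup>+x. f x \<partial>(post (Suc n) H \<bind> (\<lambda>\<nu>. return (?H \<Otimes>\<^sub>M borel) (H, \<nu>))) \<partial>distr ?J ?H (\<lambda>y. history (Suc n) (fst (snd y))))"
    unfolding post by (rule nn_integral_bind_prob[OF f]) (use k in simp)
  also have "\<dots> = (\<integral>\<^sup>+y. \<integral>\<^sup>+x. f x \<partial>(post (Suc n) (history (Suc n) (fst (snd y))) \<bind> (\<lambda>\<nu>. return (?H \<Otimes>\<^sub>M borel) (history (Suc n) (fst (snd y)), \<nu>))) \<partial>?J)"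
    by (rule nn_integral_distr) (use mi in auto)
  also have "\<dots> = (\<integral>\<^sup>+y. \<integral>\<^sup>+e. f (history (Suc n) (fst (snd y)), e) \<partial>post (Suc n) (history (Suc n) (fst (snd y))) \<partial>?J)"
    by (intro nn_integral_cong inner measurable_space[of "\<lambda>y. history (Suc n) (fst (snd y))" ?J ?H]) auto
  finally show ?thesis .
qed

definition hist :: "nat \<Rightarrow> 'a trace \<times> (nat \<Rightarrow> 's) \<Rightarrow> nat \<Rightarrow> 'a \<times> real" where
  "hist n \<omega> = history (Suc n) (fst \<omega>)"

lemma hist_measurable[measurable]: "hist n \<in> Run n \<rightarrow>\<^sub>M history_space Z (Suc n)"
  unfolding hist_def[abs_def] by (rule history_measurable[where n=n]) auto

text \<open>Let \<open>J'\<close> be the law in which the environment is discarded and drawn again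
  from the posterior. The claim says that \<open>J'\<close> equals the original law, and two such
  laws agree once they agree on rectangles.\<close>

lemma exchange_indicator_imp_exchange:
  assumes n: "Suc n \<le> T"
    and ind: "\<And>U C. U \<in> sets borel \<Longrightarrow> C \<in> sets (Run n) \<Longrightarrow>
      (\<integral>\<^sup>+y. indicator U (fst y) * indicator C (snd y) \<partial>bayes n) =
      (\<integral>\<^sup>+y. emeasure (post (Suc n) (hist n (snd y))) U * indicator C (snd y) \<partial>bayes n)"
    and f[measurable]: "f \<in> borel_measurable (borel \<Otimes>\<^sub>M Run n)"
  shows "(\<integral>\<^sup>+y. f y \<partial>bayes n) =
    (\<integral>\<^sup>+y. \<integral>\<^sup>+e. f (e, snd y) \<partial>post (Suc n) (hist n (snd y)) \<partial>bayes n)"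
proof -
  have n': "n \<le> T" using n by simp
  let ?J = "bayes n"
  interpret J: prob_space ?J by (rule bayes_prob[OF n'])
  note [measurable_cong] = sets_bayes[OF n']
  note post_Suc[OF n, measurable]
  define k where "k y = post (Suc n) (hist n (snd y)) \<bind> (\<lambda>e. return (borel \<Otimes>\<^sub>M Run n) (e, snd y))" for y :: "'e \<times> 'a trace \<times> (nat \<Rightarrow> 's)"
  have k: "k \<in> borel \<Otimes>\<^sub>M Run n \<rightarrow>\<^sub>M prob_algebra (borel \<Otimes>\<^sub>M Run n)"
    unfolding k_def by measurable
  then have kJ[measurable]: "k \<in> ?J \<rightarrow>\<^sub>M prob_algebra (borel \<Otimes>\<^sub>M Run n)" by (simp cong: measurable_cong_sets)
  define J' where "J' = ?J \<bind> k"
  have int: "(\<integral>\<^sup>+y. g y \<partial>J') = (\<integral>\<^sup>+y. \<integral>\<^sup>+e. g (e, snd y) \<partial>post (Suc n) (hist n (snd y)) \<partial>?J)"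
    if g[measurable]: "g \<in> borel_measurable (borel \<Otimes>\<^sub>M Run n)" for g
    unfolding J'_def
  proof (subst nn_integral_bind_prob[OF g kJ], intro nn_integral_cong)
    fix y assume "y \<in> space ?J"
    then have y: "snd y \<in> space (Run n)" by (rule snd_space_bayes[OF n'])
    have p: "sets (post (Suc n) (hist n (snd y))) = sets borel"
      using n measurable_space[OF hist_measurable y] by (intro prob_algebraD(2)[OF post_measurable]) auto
    have "(\<lambda>e. return (borel \<Otimes>\<^sub>M Run n) (e, snd y)) \<in> post (Suc n) (hist n (snd y)) \<rightarrow>\<^sub>M prob_algebra (borel \<Otimes>\<^sub>M Run n)"
      using y by (simp add: measurable_cong_sets[OF p refl])
    then show "integral\<^sup>N (k y) g = (\<integral>\<^sup>+e. g (e, snd y) \<partial>post (Suc n) (hist n (snd y)))"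
      unfolding k_def using y
      by (subst nn_integral_bind_prob[OF g]) (auto intro!: nn_integral_cong nn_integral_return simp: space_pair_measure)
  qed
  have sJ': "sets J' = sets (borel \<Otimes>\<^sub>M Run n)"
    unfolding J'_def by (rule sets_bind'[OF _ kJ]) (auto simp: space_prob_algebra J.prob_space_axioms)
  have "?J = J'"
  proof (rule measure_eqI_rectangles[OF sets_bayes[OF n'] sJ'])
    show "emeasure ?J (space borel \<times> space (Run n)) \<noteq> \<infinity>" by simp
    fix U :: "'e set" and C assume U[measurable]: "U \<in> sets borel" and C[measurable]: "C \<in> sets (Run n)"
    let ?X = "U \<times> C"
    have i: "indicator ?X = (\<lambda>y. indicator U (fst y) * indicator C (snd y) :: ennreal)"
      by (auto split: split_indicator)
    have "emeasure ?J ?X = (\<integral>\<^sup>+y. indicator U (fst y) * indicator C (snd y) \<partial>?J)"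
      using nn_integral_indicator[of ?X ?J] by (simp add: i)
    also have "\<dots> = (\<integral>\<^sup>+y. emeasure (post (Suc n) (hist n (snd y))) U * indicator C (snd y) \<partial>?J)"
      by (rule ind[OF U C])
    also have "\<dots> = (\<integral>\<^sup>+y. \<integral>\<^sup>+e. indicator U e * indicator C (snd y) \<partial>post (Suc n) (hist n (snd y)) \<partial>?J)"
    proof (intro nn_integral_cong)
      fix y assume "y \<in> space ?J"
      then have y: "snd y \<in> space (Run n)" by (rule snd_space_bayes[OF n'])
      have [measurable_cong]: "sets (post (Suc n) (hist n (snd y))) = sets borel"
        using n measurable_space[OF hist_measurable y] by (intro prob_algebraD(2)[OF post_measurable]) auto
      show "emeasure (post (Suc n) (hist n (snd y))) U * indicator C (snd y) =
        (\<integral>\<^sup>+e. indicator U e * indicator C (snd y) \<partial>post (Suc n) (hist n (snd y)))"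
        by (simp add: nn_integral_multc)
    qed
    also have "\<dots> = (\<integral>\<^sup>+y. indicator U (fst y) * indicator C (snd y) \<partial>J')"
      by (subst int) auto
    also have "\<dots> = emeasure J' ?X"
      using nn_integral_indicator[of ?X J'] by (simp add: i sJ')
    finally show "emeasure ?J ?X = emeasure J' ?X" .
  qed
  then show ?thesis using int[OF f] by simp
qed

text \<open>The law of run, index and action with the environment integrated out.\<close>

definition act_law :: "nat \<Rightarrow> (('a trace \<times> (nat \<Rightarrow> 's)) \<times> nat \<times> 'a) measure" where
  "act_law n = bayes n \<bind> (\<lambda>y. act_kernel n (snd y))"

lemma act_kernel_bayes:
  assumes n: "Suc n \<le> T"
  shows "(\<lambda>y. act_kernel n (snd y)) \<in> bayes n \<rightarrow>\<^sub>M prob_algebra (W n)"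
  using measurable_compose[OF measurable_snd act_kernel_measurable[OF n]] sets_bayes[of n] n
  by (simp cong: measurable_cong_sets)

lemma act_law_prob: "Suc n \<le> T \<Longrightarrow> prob_space (act_law n)"
  and sets_act_law: "Suc n \<le> T \<Longrightarrow> sets (act_law n) = sets (W n)"
  using bayes_prob[of n] prob_space_bind'[OF _ act_kernel_bayes, of "bayes n" n]
    sets_bind'[OF _ act_kernel_bayes, of "bayes n" n]
  by (auto simp: act_law_def space_prob_algebra)

text \<open>By the exchange for \<open>n\<close> rounds the environment may be drawn from the
  posterior at the start of the round. As \<open>act_kernel\<close> does not see it, Fubini moves
  the draw behind index and action. The result has the shape of \<open>chain\<close> in
  \<open>disintegration_step\<close>.\<close>

lemma nn_integral_bayes_Suc_exchange:
  assumes n: "Suc n \<le> T"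
    and ex: "\<And>f. f \<in> borel_measurable (borel \<Otimes>\<^sub>M Run n) \<Longrightarrow> (\<integral>\<^sup>+y. f y \<partial>bayes n) =
      (\<integral>\<^sup>+y. \<integral>\<^sup>+e. f (e, snd y) \<partial>post (Suc n) (hist n (snd y)) \<partial>bayes n)"
    and F[measurable]: "F \<in> borel_measurable (borel \<Otimes>\<^sub>M Run (Suc n))"
  shows "(\<integral>\<^sup>+x. F x \<partial>bayes (Suc n)) =
    (\<integral>\<^sup>+w. \<integral>\<^sup>+e. \<integral>\<^sup>+r. \<integral>\<^sup>+x. F (e, x) \<partial>upd_kernel n (w, r) \<partial>reward Z e (snd (snd w)) \<partial>post (Suc n) (hist n (fst w)) \<partial>act_law n)"
proof -
  have n': "n \<le> T" using n by simp
  let ?J = "bayes n"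
  note [measurable_cong] = sets_bayes[OF n']
  note post_Suc[OF n, measurable]
  note [measurable] = act_kernel_measurable[OF n]
  define g where "g z = (\<integral>\<^sup>+x. F (fst z, x) \<partial>(reward Z (fst z) (snd (snd (snd z))) \<bind> (\<lambda>r. upd_kernel n (snd z, r))))" for z
  have "(\<lambda>(z, x). F (fst z, x)) \<in> borel_measurable ((borel \<Otimes>\<^sub>M W n) \<Otimes>\<^sub>M Run (Suc n))" by simp
  from nn_integral_kernel_measurable[OF this reward_upd_measurable]
  have g[measurable]: "g \<in> borel_measurable (borel \<Otimes>\<^sub>M W n)" by (simp add: g_def[abs_def])
  have gr: "g (e, w) = (\<integral>\<^sup>+r. \<integral>\<^sup>+x. F (e, x) \<partial>upd_kernel n (w, r) \<partial>reward Z e (snd (snd w)))" if w: "w \<in> space (W n)" for e w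
  proof -
    have r: "(\<lambda>w. reward Z e (snd (snd w))) \<in> W n \<rightarrow>\<^sub>M prob_algebra borel"
      using measurable_compose[OF _ reward_kernel, of "\<lambda>w. (e, snd (snd w))" "W n"] by simp
    have Fe: "(\<lambda>x. F (e, x)) \<in> borel_measurable (Run (Suc n))" by (rule measurable_Pair2[OF F]) simp
    show ?thesis
      using nn_integral_bind_kernel[OF r, of "\<lambda>w r. upd_kernel n (w, r)", OF _ Fe w] upd_kernel_measurable
      by (simp add: g_def)
  qed
  have gs: "(\<lambda>w. g (e, w)) \<in> borel_measurable (W n)" for e by (rule measurable_Pair2[OF g]) simp
  define f where "f y = (\<integral>\<^sup>+w. g (fst y, w) \<partial>act_kernel n (snd y))" for y
  have f: "f \<in> borel_measurable (borel \<Otimes>\<^sub>M Run n)"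
    unfolding f_def by (rule nn_integral_kernel_measurable[where N="W n"]) (simp_all add: case_prod_beta')
  define q where "q z = (\<integral>\<^sup>+e. g (e, snd z) \<partial>post (Suc n) (hist n (fst z)))" for z
  have q: "q \<in> borel_measurable (Run n \<Otimes>\<^sub>M W n)"
    unfolding q_def by (rule nn_integral_kernel_measurable[where N=borel]) (simp_all add: case_prod_beta')
  have act: "prob_space (act_kernel n \<omega>)" "sets (act_kernel n \<omega>) = sets (W n)" "space (act_kernel n \<omega>) = space (W n)"
    if "\<omega> \<in> space (Run n)" for \<omega>
    using prob_algebraD[OF act_kernel_measurable[OF n] that] by auto
  have pst: "prob_space (post (Suc n) (hist n \<omega>))" "sets (post (Suc n) (hist n \<omega>)) = sets borel"
    if "\<omega> \<in> space (Run n)" for \<omega>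
    using n measurable_space[OF hist_measurable that] prob_algebraD[OF post_measurable, of "Suc n" "hist n \<omega>"] by auto
  have "(\<integral>\<^sup>+x. F x \<partial>bayes (Suc n)) = (\<integral>\<^sup>+y. f y \<partial>?J)"
    unfolding nn_integral_bayes_Suc[OF n F] f_def
    by (intro nn_integral_cong) (simp add: gr act snd_space_bayes[OF n'])
  also have "\<dots> = (\<integral>\<^sup>+y. \<integral>\<^sup>+e. \<integral>\<^sup>+w. g (e, w) \<partial>act_kernel n (snd y) \<partial>post (Suc n) (hist n (snd y)) \<partial>?J)"
    unfolding ex[OF f] by (simp add: f_def)
  also have "\<dots> = (\<integral>\<^sup>+y. \<integral>\<^sup>+w. q (snd y, w) \<partial>act_kernel n (snd y) \<partial>?J)"
  proof (intro nn_integral_cong)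
    fix y assume "y \<in> space ?J"
    then have y: "snd y \<in> space (Run n)" by (rule snd_space_bayes[OF n'])
    have "sets (post (Suc n) (hist n (snd y)) \<Otimes>\<^sub>M act_kernel n (snd y)) = sets (borel \<Otimes>\<^sub>M W n)"
      using act[OF y] pst[OF y] by (intro sets_pair_measure_cong) auto
    then have "g \<in> borel_measurable (post (Suc n) (hist n (snd y)) \<Otimes>\<^sub>M act_kernel n (snd y))"
      using g by (simp cong: measurable_cong_sets)
    from nn_integral_swap_prob[OF pst(1)[OF y] act(1)[OF y] this]
    show "(\<integral>\<^sup>+e. \<integral>\<^sup>+w. g (e, w) \<partial>act_kernel n (snd y) \<partial>post (Suc n) (hist n (snd y))) = (\<integral>\<^sup>+w. q (snd y, w) \<partial>act_kernel n (snd y))"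
      by (simp add: q_def)
  qed
  also have "\<dots> = (\<integral>\<^sup>+y. \<integral>\<^sup>+w. q (fst w, w) \<partial>act_kernel n (snd y) \<partial>?J)"
    by (intro nn_integral_cong act_kernel_fst[OF n q] snd_space_bayes[OF n'])
  also have "\<dots> = (\<integral>\<^sup>+w. q (fst w, w) \<partial>act_law n)"
    unfolding act_law_def
    by (rule nn_integral_bind_prob[OF measurable_compose[OF _ q] act_kernel_bayes[OF n], symmetric]) simp
  also have "\<dots> = (\<integral>\<^sup>+w. \<integral>\<^sup>+e. \<integral>\<^sup>+r. \<integral>\<^sup>+x. F (e, x) \<partial>upd_kernel n (w, r) \<partial>reward Z e (snd (snd w)) \<partial>post (Suc n) (hist n (fst w)) \<partial>act_law n)"
    using sets_eq_imp_space_eq[OF sets_act_law[OF n]] by (intro nn_integral_cong) (simp add: q_def gr)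
  finally show ?thesis .
qed

text \<open>In the induction step \<open>posterior_nn_integral\<close> identifies the next posterior
  only against functions of the extended history. \<open>lift_conditional_law\<close> admits
  functions of the full run, index, action and reward, and the new internal state is drawn from
  these without a further look at the environment.\<close>

lemma exchange:
  "Suc n \<le> T \<Longrightarrow> f \<in> borel_measurable (borel \<Otimes>\<^sub>M Run n) \<Longrightarrow> (\<integral>\<^sup>+y. f y \<partial>bayes n) =
    (\<integral>\<^sup>+y. \<integral>\<^sup>+e. f (e, snd y) \<partial>post (Suc n) (hist n (snd y)) \<partial>bayes n)"
proof (induction n arbitrary: f)
  case 0
  let ?J = "bayes 0"
  interpret J: prob_space ?J by (rule bayes_prob) simp
  have hist: "hist 0 \<omega> = (\<lambda>_. undefined)" for \<omega>
    by (simp add: hist_def history_def restrict_def)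
  note [measurable_cong] = sets_bayes[of 0, simplified]
  define R where "R = run undefined 0"
  have run: "run \<nu> 0 = R" for \<nu> by (simp add: R_def)
  have sets_R[measurable_cong]: "sets R = sets (Run 0)" and spR: "space R = space (Run 0)"
    using sets_run[of 0 undefined] space_run[of 0 undefined] by (simp_all only: R_def)
  interpret R: prob_space R unfolding R_def by (rule run_prob) simp
  \<comment> \<open>Before the first round the environment is independent of the initial states and
    the history is constant. So the posterior must equal the prior, and both sides of the claim
    factor.\<close>
  have split: "(\<integral>\<^sup>+y. indicator U (fst y) * indicator C (snd y) \<partial>?J) = emeasure (prior Z) U * (\<integral>\<^sup>+y. indicator C (snd y) \<partial>?J)"
    if [measurable]: "U \<in> sets borel" "C \<in> sets (Run 0)" for U C
  proof -
    have "(\<integral>\<^sup>+y. indicator V (fst y) * indicator C (snd y) \<partial>?J) = emeasure (prior Z) V * (\<integral>\<^sup>+\<omega>. indicator C \<omega> \<partial>R)"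
      if [measurable]: "V \<in> sets borel" for V
      by (subst nn_integral_bayes) (auto simp only: run fst_conv snd_conv le0,
          measurable, simp add: nn_integral_cmult nn_integral_multc)
    from this[of U] this[of UNIV] show ?thesis
      using prob_space.emeasure_space_1[OF prior_prob] by simp
  qed
  show ?case
  proof (rule exchange_indicator_imp_exchange[OF 0(1) _ 0(2)])
    fix U :: "'e set" and C assume [measurable]: "U \<in> sets borel" "C \<in> sets (Run 0)"
    have [measurable]: "hist 0 \<in> Run 0 \<rightarrow>\<^sub>M history_space Z (Suc 0)" by (rule hist_measurable)
    have U: "(\<lambda>x. indicator U (snd x) :: ennreal) \<in> borel_measurable (history_space Z (Suc 0) \<Otimes>\<^sub>M borel)" by measurable
    define c where "c = emeasure (post (Suc 0) (\<lambda>_. undefined)) U"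
    obtain \<omega> where "\<omega> \<in> space (Run 0)" using R.not_empty spR by auto
    then have sp: "sets (post (Suc 0) (\<lambda>_. undefined)) = sets borel"
      using 0 measurable_space[OF hist_measurable, of \<omega> 0] prob_algebraD(2)[OF post_measurable, of "Suc 0" "hist 0 \<omega>"]
      by (simp add: hist)
    have "emeasure (prior Z) U = (\<integral>\<^sup>+y. indicator U (fst y) \<partial>?J)"
      using split[of U "space (Run 0)"] J.emeasure_space_1 snd_space_bayes[of 0]
      by (simp cong: nn_integral_cong_simp)
    also have "\<dots> = c"
      using posterior_nn_integral[OF 0(1) U] J.emeasure_space_1 sp hist
      by (simp add: c_def hist_def)
    finally have c: "emeasure (prior Z) U = c" .
    show "(\<integral>\<^sup>+y. indicator U (fst y) * indicator C (snd y) \<partial>?J) =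
      (\<integral>\<^sup>+y. emeasure (post (Suc 0) (hist 0 (snd y))) U * indicator C (snd y) \<partial>?J)"
      unfolding hist c_def[symmetric] by (subst split) (auto simp: c nn_integral_cmult simp del: nn_integral_indicator)
  qed
next
  case (Suc n)
  note n = Suc.prems(1)
  have n1: "Suc n \<le> T" using n by simp
  have IH: "(\<integral>\<^sup>+y. f y \<partial>bayes n) =
      (\<integral>\<^sup>+y. \<integral>\<^sup>+e. f (e, snd y) \<partial>post (Suc n) (hist n (snd y)) \<partial>bayes n)"
    if "f \<in> borel_measurable (borel \<Otimes>\<^sub>M Run n)" for f
    by (rule Suc.IH[OF n1 that])
  note step = nn_integral_bayes_Suc_exchange[OF n1 IH]
  let ?H = "history_space Z (Suc n)" and ?H' = "history_space Z (Suc (Suc n))"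
  let ?Q = "?H \<Otimes>\<^sub>M A"
  let ?J' = "bayes (Suc n)"
  \<comment> \<open>Index and states are dropped from the conditioning; the action stays because the
    reward law depends on it. \<open>p'\<close> is the posterior at the history extended by action
    and reward.\<close>
  define \<pi> where "\<pi> w = (hist n (fst w), snd (snd w))" for w :: "('a trace \<times> (nat \<Rightarrow> 's)) \<times> nat \<times> 'a"
  define p' where "p' x = post (Suc (Suc n)) ((fst (fst x))(Suc n := (snd (fst x), snd x)))" for x :: "((nat \<Rightarrow> 'a \<times> real) \<times> 'a) \<times> real"
  note [measurable_cong] = sets_act_law[OF n1]
  have [measurable]: "post (Suc n) \<in> ?H \<rightarrow>\<^sub>M prob_algebra borel" "post (Suc (Suc n)) \<in> ?H' \<rightarrow>\<^sub>M prob_algebra borel"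
    using n by (auto intro: post_measurable)
  have I: "{1..<Suc (Suc n)} = {1..<Suc n} \<union> {Suc n}" by auto
  have ext: "(\<lambda>x. (fst (fst x))(Suc n := (snd (fst x), snd x))) \<in> ?Q \<Otimes>\<^sub>M borel \<rightarrow>\<^sub>M ?H'"
    unfolding history_space_def by (rule measurable_fun_upd[OF I]) measurable
  interpret disintegration_step "act_law n" ?Q borel borel \<pi> "\<lambda>q. post (Suc n) (fst q)" "\<lambda>x. reward Z (fst x) (snd (snd x))" p'
  proof (rule disintegration_step.intro)
    show "prob_space (act_law n)" by (rule act_law_prob[OF n1])
    show "\<pi> \<in> act_law n \<rightarrow>\<^sub>M ?Q" unfolding \<pi>_def[abs_def] by measurable
    show "(\<lambda>q. post (Suc n) (fst q)) \<in> ?Q \<rightarrow>\<^sub>M prob_algebra borel" by measurable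
    show "(\<lambda>x. reward Z (fst x) (snd (snd x))) \<in> borel \<Otimes>\<^sub>M ?Q \<rightarrow>\<^sub>M prob_algebra borel"
      using measurable_compose[OF _ reward_kernel, of "\<lambda>x. (fst x, snd (snd x))" "borel \<Otimes>\<^sub>M ?Q"] by simp
    show "p' \<in> ?Q \<Otimes>\<^sub>M borel \<rightarrow>\<^sub>M prob_algebra borel"
      unfolding p'_def by (rule measurable_compose[OF ext]) measurable
  qed
  have hist_upd: "hist (Suc n) (h(Suc n := (i, a, r)), \<sigma>) = (hist n (h, \<sigma>'))(Suc n := (a, r))" for h i a r \<sigma> \<sigma>'
    by (auto simp: hist_def history_def fun_eq_iff restrict_def)
  have sl: "space (act_law n) = space (W n)" using sets_eq_imp_space_eq[OF sets_act_law[OF n1]] .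
  show ?case
  proof (rule exchange_indicator_imp_exchange[OF n _ Suc.prems(2)])
    fix U :: "'e set" and C assume U[measurable]: "U \<in> sets borel" and C[measurable]: "C \<in> sets (Run (Suc n))"
    have pU[measurable]: "(\<lambda>H. emeasure (post (Suc (Suc n)) H) U) \<in> borel_measurable ?H'"
      by (intro measurable_compose[OF measurable_prob_algebraD measurable_emeasure_subprob_algebra[OF U]]) measurable
    have fromH: "(\<integral>\<^sup>+x. k (hist (Suc n) x) * g x \<partial>upd_kernel n (w, r))
      = k ((fst (\<pi> w))(Suc n := (snd (\<pi> w), r))) * (\<integral>\<^sup>+x. g x \<partial>upd_kernel n (w, r))"
      if k: "k \<in> borel_measurable ?H'" and g: "g \<in> borel_measurable (Run (Suc n))" and w: "w \<in> space (W n)" for k g w r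
    proof -
      have h: "history (Suc (Suc n)) \<in> Tr (Suc n) \<rightarrow>\<^sub>M ?H'"
        using history_measurable[OF measurable_ident, of "Suc (Suc n)" "Suc n"] by (simp add: id_def)
      show ?thesis
        using nn_integral_upd_trace[OF measurable_compose[OF h k] g w, of r]
          hist_upd[of "fst (fst w)" "fst (snd w)" "snd (snd w)" r undefined "snd (fst w)"]
        by (simp add: \<pi>_def hist_def)
    qed
    have stepH: "(\<integral>\<^sup>+y. b (fst y, hist (Suc n) (snd y)) * c (snd y) \<partial>?J') =
      (\<integral>\<^sup>+w. \<integral>\<^sup>+e. \<integral>\<^sup>+r. b (e, (fst (\<pi> w))(Suc n := (snd (\<pi> w), r))) * (\<integral>\<^sup>+x. c x \<partial>upd_kernel n (w, r))
        \<partial>reward Z e (snd (\<pi> w)) \<partial>post (Suc n) (fst (\<pi> w)) \<partial>act_law n)"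
      if b: "b \<in> borel_measurable (borel \<Otimes>\<^sub>M ?H')" and c: "c \<in> borel_measurable (Run (Suc n))" for b c
    proof -
      have [measurable]: "(\<lambda>y. b (fst y, hist (Suc n) (snd y))) \<in> borel_measurable (borel \<Otimes>\<^sub>M Run (Suc n))"
        by (rule measurable_compose[OF _ b]) measurable
      have "(\<lambda>y. b (fst y, hist (Suc n) (snd y)) * c (snd y)) \<in> borel_measurable (borel \<Otimes>\<^sub>M Run (Suc n))"
        using c by measurable
      from step[OF _ this] show ?thesis
        unfolding \<pi>_def fst_conv snd_conv
        using sl fromH[OF measurable_Pair2[OF b] c, unfolded \<pi>_def fst_conv snd_conv] by (simp cong: nn_integral_cong_simp)
    qed
    have hyp: "(\<integral>\<^sup>+w. \<integral>\<^sup>+e. \<integral>\<^sup>+r. indicator U e * k (\<pi> w, r) \<partial>reward Z e (snd (\<pi> w)) \<partial>post (Suc n) (fst (\<pi> w)) \<partial>act_law n) =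
      (\<integral>\<^sup>+w. \<integral>\<^sup>+e. \<integral>\<^sup>+r. emeasure (p' (\<pi> w, r)) U * k (\<pi> w, r) \<partial>reward Z e (snd (\<pi> w)) \<partial>post (Suc n) (fst (\<pi> w)) \<partial>act_law n)"
      if k: "k \<in> borel_measurable (?Q \<Otimes>\<^sub>M borel)" for k
    proof -
      \<comment> \<open>A function of \<open>\<pi> w\<close> and \<open>r\<close> is a function of
        the extended history: its first \<open>n\<close> entries give the old history, the entry at
        \<open>Suc n\<close> the action and the reward. The posterior of the next round therefore
        applies to it.\<close>
      define k' where "k' H = k ((restrict H {1..<Suc n}, fst (H (Suc n))), snd (H (Suc n)))" for H
      have [measurable]: "(\<lambda>H. restrict H {1..<Suc n}) \<in> ?H' \<rightarrow>\<^sub>M ?H"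
        unfolding history_space_def by (rule measurable_restrict_subset) auto
      have [measurable]: "(\<lambda>H. H (Suc n)) \<in> ?H' \<rightarrow>\<^sub>M A \<Otimes>\<^sub>M borel"
        unfolding history_space_def by (rule measurable_component_singleton) simp
      have k'[measurable]: "k' \<in> borel_measurable ?H'"
        unfolding k'_def by (rule measurable_compose[OF _ k]) measurable
      have k'\<pi>: "k' ((fst (\<pi> w))(Suc n := (snd (\<pi> w), r))) = k (\<pi> w, r)" for w r
        by (simp add: k'_def \<pi>_def hist_def history_def fun_upd_def restrict_def cong: if_cong)
      have one: "(\<integral>\<^sup>+x. 1 \<partial>upd_kernel n (w, r)) = 1" if "w \<in> space (W n)" for w r
        using prob_space.emeasure_space_1[OF upd_prob[OF that]] by simp
      have [measurable]: "U \<in> sets borel" by (rule U)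
      have "(\<integral>\<^sup>+w. \<integral>\<^sup>+e. \<integral>\<^sup>+r. indicator U e * k (\<pi> w, r) \<partial>reward Z e (snd (\<pi> w)) \<partial>post (Suc n) (fst (\<pi> w)) \<partial>act_law n)
        = (\<integral>\<^sup>+y. indicator U (fst y) * k' (hist (Suc n) (snd y)) \<partial>?J')"
        using stepH[of "\<lambda>y. indicator U (fst y) * k' (snd y)" "\<lambda>_. 1"] sl
        by (simp add: one k'\<pi> del: nn_integral_const cong: nn_integral_cong_simp)
      also have "\<dots> = (\<integral>\<^sup>+y. \<integral>\<^sup>+e. indicator U e * k' (hist (Suc n) (snd y)) \<partial>post (Suc (Suc n)) (hist (Suc n) (snd y)) \<partial>?J')"
        using posterior_nn_integral[OF n, of "\<lambda>x. indicator U (snd x) * k' (fst x)"] by (simp add: hist_def)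
      also have "\<dots> = (\<integral>\<^sup>+y. emeasure (post (Suc (Suc n)) (hist (Suc n) (snd y))) U * k' (hist (Suc n) (snd y)) \<partial>?J')"
      proof (intro nn_integral_cong)
        fix y assume "y \<in> space ?J'"
        then have y: "snd y \<in> space (Run (Suc n))" by (rule snd_space_bayes[OF n1])
        have [measurable_cong]: "sets (post (Suc (Suc n)) (hist (Suc n) (snd y))) = sets borel"
          using n measurable_space[OF hist_measurable y] by (intro prob_algebraD(2)[OF post_measurable]) auto
        show "(\<integral>\<^sup>+e. indicator U e * k' (hist (Suc n) (snd y)) \<partial>post (Suc (Suc n)) (hist (Suc n) (snd y))) =
          emeasure (post (Suc (Suc n)) (hist (Suc n) (snd y))) U * k' (hist (Suc n) (snd y))"
          by (simp add: nn_integral_multc)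
      qed
      also have "\<dots> = (\<integral>\<^sup>+w. \<integral>\<^sup>+e. \<integral>\<^sup>+r. emeasure (p' (\<pi> w, r)) U * k (\<pi> w, r) \<partial>reward Z e (snd (\<pi> w)) \<partial>post (Suc n) (fst (\<pi> w)) \<partial>act_law n)"
        using stepH[of "\<lambda>y. emeasure (post (Suc (Suc n)) (snd y)) U * k' (snd y)" "\<lambda>_. 1"] sl
        by (simp add: one k'\<pi> p'_def del: nn_integral_const cong: nn_integral_cong_simp)
      finally show ?thesis .
    qed
    \<comment> \<open>The probability that the updated run lies in \<open>C\<close>. Integrating out
      the fresh internal state leaves a function of \<open>(w, r)\<close>, to which the lifted
      conditional law applies.\<close>
    define g where "g x = (\<integral>\<^sup>+z. indicator C z \<partial>upd_kernel n x)" for x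
    have g: "g \<in> borel_measurable (act_law n \<Otimes>\<^sub>M borel)"
      unfolding g_def
      using measurable_compose[OF measurable_prob_algebraD[OF upd_kernel_measurable] nn_integral_measurable_subprob_algebra[of "indicator C" "Run (Suc n)"]]
      by simp
    have "(\<integral>\<^sup>+y. indicator U (fst y) * indicator C (snd y) \<partial>?J') =
      (\<integral>\<^sup>+w. \<integral>\<^sup>+e. \<integral>\<^sup>+r. indicator U e * g (w, r) \<partial>reward Z e (snd (\<pi> w)) \<partial>post (Suc n) (fst (\<pi> w)) \<partial>act_law n)"
      using stepH[of "\<lambda>y. indicator U (fst y)" "indicator C"] by (simp add: g_def del: nn_integral_indicator)
    also have "\<dots> = (\<integral>\<^sup>+w. \<integral>\<^sup>+e. \<integral>\<^sup>+r. emeasure (p' (\<pi> w, r)) U * g (w, r) \<partial>reward Z e (snd (\<pi> w)) \<partial>post (Suc n) (fst (\<pi> w)) \<partial>act_law n)"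
      using lift_conditional_law[OF U _ g] hyp by simp
    also have "\<dots> = (\<integral>\<^sup>+y. emeasure (post (Suc (Suc n)) (hist (Suc n) (snd y))) U * indicator C (snd y) \<partial>?J')"
      using stepH[of "\<lambda>y. emeasure (post (Suc (Suc n)) (snd y)) U" "indicator C"] by (simp add: g_def p'_def del: nn_integral_indicator)
    finally show "(\<integral>\<^sup>+y. indicator U (fst y) * indicator C (snd y) \<partial>?J') =
      (\<integral>\<^sup>+y. emeasure (post (Suc (Suc n)) (hist (Suc n) (snd y))) U * indicator C (snd y) \<partial>?J')" .
  qed
qed

section \<open>Law of the selected index and of trace prefixes\<close>

abbreviation best :: "nat \<Rightarrow> 'e \<times> 'a trace \<times> (nat \<Rightarrow> 's) \<Rightarrow> nat" where
  "best n y \<equiv> arg_min_on (bms_potential Z (fst y) (Suc n) (fst (snd y))) {1..M}"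

text \<open>Past the round-robin phase the index is \<open>best\<close> evaluated at a posterior
  sample and the current trace. \<open>g\<close> sees the environment through this index only, so
  exchanging the sample for the true environment yields \<open>best n y\<close>.\<close>

lemma select_nn_integral_exchange:
  assumes n: "Suc n \<le> T" "M \<le> n" and g[measurable]: "g \<in> borel_measurable (Run n \<Otimes>\<^sub>M count_space {1..M})"
  shows "(\<integral>\<^sup>+y. \<integral>\<^sup>+i. g (snd y, i) \<partial>select (Suc n) (fst (snd y)) \<partial>bayes n) =
    (\<integral>\<^sup>+y. g (snd y, best n y) \<partial>bayes n)"
proof -
  have n': "n \<le> T" using n by simp
  define f where "f y = g (snd y, best n y)" for y
  have sel: "(\<lambda>y. best n y) \<in> borel \<Otimes>\<^sub>M Run n \<rightarrow>\<^sub>M count_space {1..M}"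
    by (rule select_map_measurable[where n=n]) auto
  have f: "f \<in> borel_measurable (borel \<Otimes>\<^sub>M Run n)"
    unfolding f_def using sel by measurable
  have "(\<integral>\<^sup>+y. \<integral>\<^sup>+i. g (snd y, i) \<partial>select (Suc n) (fst (snd y)) \<partial>bayes n)
    = (\<integral>\<^sup>+y. \<integral>\<^sup>+e. f (e, snd y) \<partial>post (Suc n) (hist n (snd y)) \<partial>bayes n)"
  proof (intro nn_integral_cong)
    fix y assume "y \<in> space (bayes n)"
    then have y: "snd y \<in> space (Run n)" by (rule snd_space_bayes[OF n'])
    have p: "sets (post (Suc n) (hist n (snd y))) = sets borel"
      using n measurable_space[OF hist_measurable y] by (intro prob_algebraD(2)[OF post_measurable]) auto
    have "(\<lambda>e. (e, snd y)) \<in> borel \<rightarrow>\<^sub>M borel \<Otimes>\<^sub>M Run n" using y by simp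
    from measurable_compose[OF this sel]
    have "(\<lambda>e. arg_min_on (bms_potential Z e (Suc n) (fst (snd y))) {1..M}) \<in> post (Suc n) (hist n (snd y)) \<rightarrow>\<^sub>M count_space {1..M}"
      by (simp add: measurable_cong_sets[OF p refl])
    moreover have "(\<lambda>i. g (snd y, i)) \<in> borel_measurable (count_space {1..M})" by simp
    ultimately show "(\<integral>\<^sup>+i. g (snd y, i) \<partial>select (Suc n) (fst (snd y))) = (\<integral>\<^sup>+e. f (e, snd y) \<partial>post (Suc n) (hist n (snd y)))"
      using n by (simp add: bms_select_def hist_def nn_integral_distr f_def)
  qed
  also have "\<dots> = (\<integral>\<^sup>+y. f y \<partial>bayes n)" by (rule exchange[OF n(1) f, symmetric])
  finally show ?thesis by (simp add: f_def)
qed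

lemma nn_integral_run_Suc_trace:
  assumes n: "Suc n \<le> T" and f: "f \<in> borel_measurable (Tr (Suc n))"
  shows "(\<integral>\<^sup>+x. f (fst x) \<partial>run \<nu> (Suc n)) =
    (\<integral>\<^sup>+\<omega>. \<integral>\<^sup>+w. \<integral>\<^sup>+r. f (extend n w r)
      \<partial>reward Z \<nu> (snd (snd w)) \<partial>act_kernel n \<omega> \<partial>run \<nu> n)"
proof -
  have n': "n \<le> T" using n by simp
  have "(\<lambda>x. f (fst x)) \<in> borel_measurable (Run (Suc n))" by (rule measurable_compose[OF fst_run f])
  note nn_integral_run_Suc[OF n this, of \<nu>]
  also have "(\<integral>\<^sup>+\<omega>. \<integral>\<^sup>+w. \<integral>\<^sup>+r. \<integral>\<^sup>+x. f (fst x) \<partial>upd_kernel n (w, r) \<partial>reward Z \<nu> (snd (snd w)) \<partial>act_kernel n \<omega> \<partial>run \<nu> n)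
    = (\<integral>\<^sup>+\<omega>. \<integral>\<^sup>+w. \<integral>\<^sup>+r. f (extend n w r)
      \<partial>reward Z \<nu> (snd (snd w)) \<partial>act_kernel n \<omega> \<partial>run \<nu> n)"
  proof (intro nn_integral_cong)
    fix \<omega> w r assume "\<omega> \<in> space (run \<nu> n)" and w: "w \<in> space (act_kernel n \<omega>)"
    then have w: "w \<in> space (W n)" by (rule space_act_run(1)[OF n])
    show "(\<integral>\<^sup>+x. f (fst x) \<partial>upd_kernel n (w, r)) = f (extend n w r)"
      using nn_integral_upd_trace[OF f _ w, of "\<lambda>_. 1" r] prob_space.emeasure_space_1[OF upd_prob[OF w]] by simp
  qed
  finally show ?thesis .
qed

text \<open>Later rounds keep the earlier entries and their kernels have mass 1. This links
  quantities of a single round, computed after \<open>n\<close> rounds, with the regret coefficients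
  and the total regret, which refer to horizon \<open>T\<close>.\<close>

lemma run_marginal:
  assumes "n \<le> m" "m \<le> T" and f: "f \<in> borel_measurable (Tr n)"
  shows "(\<integral>\<^sup>+x. f (restrict (fst x) {1..n}) \<partial>run \<nu> m) = (\<integral>\<^sup>+x. f (fst x) \<partial>run \<nu> n)"
  using assms(1,2)
proof (induction m rule: dec_induct)
  case base
  have "restrict (fst x) {1..n} = fst x" if "x \<in> space (run \<nu> n)" for x
    using that measurable_space[OF fst_run, of x n] space_run[OF base, of \<nu>]
    by (auto simp: trace_space_def space_PiM intro: PiE_restrict)
  then show ?case by (simp cong: nn_integral_cong_simp)
next
  case (step m)
  have m: "m \<le> T" using step by simp
  have r: "(\<lambda>h. restrict h {1..n}) \<in> Tr (Suc m) \<rightarrow>\<^sub>M Tr n"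
    unfolding trace_space_def using step by (intro measurable_restrict_subset) auto
  have up: "restrict (h(Suc m := x)) {1..n} = restrict h {1..n}" for h :: "'a trace" and x
    using step by (auto simp: restrict_def fun_eq_iff)
  have "(\<integral>\<^sup>+x. f (restrict (fst x) {1..n}) \<partial>run \<nu> (Suc m)) =
     (\<integral>\<^sup>+\<omega>. \<integral>\<^sup>+w. \<integral>\<^sup>+r. f (restrict (fst (fst w)) {1..n}) \<partial>reward Z \<nu> (snd (snd w)) \<partial>act_kernel m \<omega> \<partial>run \<nu> m)"
    using nn_integral_run_Suc_trace[OF step.prems measurable_compose[OF r f]] by (simp add: up)
  also have "\<dots> = (\<integral>\<^sup>+\<omega>. \<integral>\<^sup>+w. f (restrict (fst (fst w)) {1..n}) \<partial>act_kernel m \<omega> \<partial>run \<nu> m)"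
  proof (intro nn_integral_cong)
    fix \<omega> w assume "\<omega> \<in> space (run \<nu> m)" "w \<in> space (act_kernel m \<omega>)"
    then have "snd (snd w) \<in> space A" by (rule space_act_run(2)[OF step.prems])
    from prob_space.emeasure_space_1[OF reward_prob[OF this]]
    show "(\<integral>\<^sup>+r. f (restrict (fst (fst w)) {1..n}) \<partial>reward Z \<nu> (snd (snd w))) = f (restrict (fst (fst w)) {1..n})"
      by simp
  qed
  also have "\<dots> = (\<integral>\<^sup>+\<omega>. \<integral>\<^sup>+w. f (restrict (fst \<omega>) {1..n}) \<partial>act_kernel m \<omega> \<partial>run \<nu> m)"
  proof (rule nn_integral_cong)
    fix \<omega> assume "\<omega> \<in> space (run \<nu> m)"
    then have \<omega>: "\<omega> \<in> space (Run m)" using space_run[OF m] by simp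
    have "(\<lambda>h. restrict h {1..n}) \<in> Tr m \<rightarrow>\<^sub>M Tr n"
      unfolding trace_space_def using step by (intro measurable_restrict_subset) auto
    moreover have "(\<lambda>x. fst (fst x)) \<in> Run m \<Otimes>\<^sub>M W m \<rightarrow>\<^sub>M Tr m" by measurable
    ultimately have "(\<lambda>x. f (restrict (fst (fst x)) {1..n})) \<in> borel_measurable (Run m \<Otimes>\<^sub>M W m)"
      using measurable_compose[OF measurable_compose f] by blast
    from act_kernel_fst[OF step.prems this \<omega>]
    show "(\<integral>\<^sup>+w. f (restrict (fst (fst w)) {1..n}) \<partial>act_kernel m \<omega>) = (\<integral>\<^sup>+w. f (restrict (fst \<omega>) {1..n}) \<partial>act_kernel m \<omega>)"
      by simp
  qed
  also have "\<dots> = (\<integral>\<^sup>+\<omega>. f (restrict (fst \<omega>) {1..n}) \<partial>run \<nu> m)"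
  proof (intro nn_integral_cong)
    fix \<omega> assume "\<omega> \<in> space (run \<nu> m)"
    then have \<omega>: "\<omega> \<in> space (Run m)" using space_run[OF m] by simp
    from prob_space.emeasure_space_1[OF prob_algebraD(1)[OF act_kernel_measurable[OF step.prems] \<omega>]]
    show "(\<integral>\<^sup>+w. f (restrict (fst \<omega>) {1..n}) \<partial>act_kernel m \<omega>) = f (restrict (fst \<omega>) {1..n})" by simp
  qed
  also have "\<dots> = (\<integral>\<^sup>+x. f (fst x) \<partial>run \<nu> n)" by (rule step.IH[OF m])
  finally show ?case .
qed

lemma bayes_marginal:
  assumes n: "n \<le> m" "m \<le> T" and f: "f \<in> borel_measurable (borel \<Otimes>\<^sub>M Tr n)"
  shows "(\<integral>\<^sup>+y. f (fst y, restrict (fst (snd y)) {1..n}) \<partial>bayes m) =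
    (\<integral>\<^sup>+y. f (fst y, fst (snd y)) \<partial>bayes n)"
proof -
  have r: "(\<lambda>h. restrict h {1..n}) \<in> Tr m \<rightarrow>\<^sub>M Tr n"
    unfolding trace_space_def using n by (intro measurable_restrict_subset) auto
  have 1: "(\<lambda>y. f (fst y, restrict (fst (snd y)) {1..n})) \<in> borel_measurable (borel \<Otimes>\<^sub>M Run m)"
    by (rule measurable_compose[OF _ f]) (use r in measurable)
  have 2: "(\<lambda>y. f (fst y, fst (snd y))) \<in> borel_measurable (borel \<Otimes>\<^sub>M Run n)"
    by (rule measurable_compose[OF _ f]) measurable
  have "(\<lambda>h. f (\<nu>, h)) \<in> borel_measurable (Tr n)" for \<nu> by (rule measurable_Pair2[OF f]) simp
  from run_marginal[OF n this] show ?thesis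
    using n by (simp add: nn_integral_bayes[OF _ 1] nn_integral_bayes[OF _ 2])
qed

abbreviation next_round :: "nat \<Rightarrow> ('e \<times> 'a trace \<times> (nat \<Rightarrow> 's) \<Rightarrow> ('a trace \<times> (nat \<Rightarrow> 's)) \<times> nat \<times> 'a \<Rightarrow> real \<Rightarrow> ennreal) \<Rightarrow> ennreal" where
  "next_round n F \<equiv> (\<integral>\<^sup>+y. \<integral>\<^sup>+w. \<integral>\<^sup>+r. F y w r \<partial>reward Z (fst y) (snd (snd w)) \<partial>act_kernel n (snd y) \<partial>bayes n)"

lemma nn_integral_bayes_Suc_trace:
  assumes n: "Suc n \<le> T" and f: "f \<in> borel_measurable (borel \<Otimes>\<^sub>M Tr (Suc n))"
  shows "(\<integral>\<^sup>+y. f (fst y, fst (snd y)) \<partial>bayes (Suc n)) =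
    next_round n (\<lambda>y w r. f (fst y, extend n w r))"
proof -
  have n': "n \<le> T" using n by simp
  have m: "(\<lambda>y. f (fst y, fst (snd y))) \<in> borel_measurable (borel \<Otimes>\<^sub>M Run (Suc n))"
    by (rule measurable_compose[OF _ f]) measurable
  show ?thesis
    unfolding nn_integral_bayes_Suc[OF n m]
  proof (intro nn_integral_cong)
    fix y w r assume "y \<in> space (bayes n)" "w \<in> space (act_kernel n (snd y))"
    then have w: "w \<in> space (W n)" by (rule space_act_bayes(1)[OF n])
    have "(\<lambda>h. f (fst y, h)) \<in> borel_measurable (Tr (Suc n))" by (rule measurable_Pair2[OF f]) simp
    from nn_integral_upd_trace[OF this _ w, of "\<lambda>_. 1" r]
    show "(\<integral>\<^sup>+x. f (fst (fst y, x), fst (snd (fst y, x))) \<partial>upd_kernel n (w, r))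
      = f (fst y, extend n w r)"
      using prob_space.emeasure_space_1[OF upd_prob[OF w]] by simp
  qed
qed

end

section \<open>Concentration and regret coefficients\<close>

definition rew :: "'a trace \<Rightarrow> nat \<Rightarrow> real" where
  "rew h l = snd (snd (h l))"

definition cnt :: "nat \<Rightarrow> nat \<Rightarrow> 'a trace \<Rightarrow> nat" where
  "cnt i t h = card (selected i t h)"

lemma selected_one[simp]: "selected i 1 h = {}"
  by (auto simp: selected_def)

lemma finite_selected[simp]: "finite (selected i t h)"
  by (simp add: selected_def)

lemma cnt_le: "cnt i t h \<le> t - 1"
proof -
  have "card (selected i t h) \<le> card {1..<t}"
    by (rule card_mono) (auto simp: selected_def)
  then show ?thesis by (simp add: cnt_def)
qed

lemma selected_Suc:
  "selected i (Suc t) h = (if 1 \<le> t \<and> fst (h t) = i then insert t (selected i t h) else selected i t h)"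
  by (auto simp: selected_def less_Suc_eq)

lemma notin_selected[simp]: "t \<notin> selected i t h"
  by (simp add: selected_def)

lemma selected_upd: "t \<le> l \<Longrightarrow> selected i t (h(l := x)) = selected i t h"
  by (auto simp: selected_def)

lemma selected_restrict: "t \<le> Suc n \<Longrightarrow> selected i t (restrict h {1..n}) = selected i t h"
  by (auto simp: selected_def)

lemma in_selected_less: "l \<in> selected i t h \<Longrightarrow> 1 \<le> l \<and> l < t \<and> fst (h l) = i"
  by (auto simp: selected_def)

context bms
begin

text \<open>For a fixed environment this is a martingale in \<open>t\<close>: given the action, the
  reward has mean \<open>mean_reward\<close>, however the index was selected.\<close>

definition dev :: "'e \<Rightarrow> nat \<Rightarrow> nat \<Rightarrow> 'a trace \<Rightarrow> real" where
  "dev \<nu> i t h = (\<Sum>l\<in>selected i t h. mean_reward Z \<nu> (action h l) - rew h l)"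

lemma dev_upd:
  "dev \<nu> i (Suc (Suc n)) (h(Suc n := (j, a, r))) = dev \<nu> i (Suc n) h + (if j = i then mean_reward Z \<nu> a - r else 0)"
proof -
  have "(\<Sum>l\<in>selected i (Suc n) h. mean_reward Z \<nu> (action (h(Suc n := (j, a, r))) l) - rew (h(Suc n := (j, a, r))) l)
    = dev \<nu> i (Suc n) h"
    unfolding dev_def by (intro sum.cong) (auto simp: action_def rew_def dest: in_selected_less)
  then show ?thesis
    by (simp add: dev_def selected_Suc[of i "Suc n"] selected_upd action_def rew_def)
qed

lemma cnt_upd:
  "cnt i (Suc (Suc n)) (h(Suc n := (j, a, r))) = cnt i (Suc n) h + (if j = i then 1 else 0)"
  by (simp add: cnt_def selected_Suc[of i "Suc n"] selected_upd)

lemma dev_restrict: "t \<le> Suc n \<Longrightarrow> dev \<nu> i t (restrict h {1..n}) = dev \<nu> i t h"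
  unfolding dev_def
  by (intro sum.cong) (auto simp: selected_restrict action_def rew_def dest: in_selected_less)

lemma cnt_restrict: "t \<le> Suc n \<Longrightarrow> cnt i t (restrict h {1..n}) = cnt i t h"
  by (simp add: cnt_def selected_restrict)

lemma rew_sum_measurable:
  assumes "H \<in> N \<rightarrow>\<^sub>M Tr n" "t \<le> Suc n"
  shows "(\<lambda>x. \<Sum>l\<in>selected i t (H x). rew (H x) l) \<in> borel_measurable N"
  using sum_selected_measurable[of "\<lambda>_ y. snd (snd y)", OF _ assms] by (simp add: rew_def)

lemma dev_measurable:
  assumes [measurable]: "H \<in> N \<rightarrow>\<^sub>M Tr n" "G \<in> N \<rightarrow>\<^sub>M borel" and t: "t \<le> Suc n"
  shows "(\<lambda>x. dev (G x) i t (H x)) \<in> borel_measurable N"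
  unfolding dev_def sum_subtractf
  using mean_selected_measurable[OF _ _ t, measurable] rew_sum_measurable[OF _ t, measurable] by measurable

lemma cnt_measurable:
  assumes "H \<in> N \<rightarrow>\<^sub>M Tr n" and t: "t \<le> Suc n"
  shows "(\<lambda>x. real (cnt i t (H x))) \<in> borel_measurable N"
  unfolding cnt_def by (rule card_selected_measurable[OF assms])

text \<open>Hoeffding's lemma for a range of length 1 gives the factor
  \<open>exp (\<theta>\<^sup>2 / 8)\<close>. It is stated for a positive parameter, so the sign of
  \<open>\<theta>\<close> decides whether it is applied to \<open>- r\<close> or to
  \<open>r\<close>. Both signs occur in the two-sided tail.\<close>

lemma reward_mgf:
  assumes a: "a \<in> space A"
  shows "(\<integral>\<^sup>+r. ennreal (exp (\<theta> * (mean_reward Z \<nu> a - r) - \<theta>\<^sup>2 / 8)) \<partial>reward Z \<nu> a) \<le> 1"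
proof -
  interpret prob_space "reward Z \<nu> a" by (rule reward_prob[OF a])
  have b: "(\<lambda>r. r) \<in> borel_measurable (reward Z \<nu> a)"
    using sets_reward[OF a, of \<nu>] by (simp cong: measurable_cong_sets)
  have "(\<integral>\<^sup>+r. ennreal (exp (\<theta> * (mean_reward Z \<nu> a - r))) \<partial>reward Z \<nu> a) \<le> ennreal (exp (\<theta>\<^sup>2 / 8))"
  proof (cases \<theta> "0::real" rule: linorder_cases)
    case greater
    interpret interval_bounded_random_variable "reward Z \<nu> a" "\<lambda>r. - r" "-1" 0
      using reward_unit[OF a, of \<nu>] b by unfold_locales auto
    show ?thesis
      using Hoeffdings_lemma_nn_integral[OF greater] by (simp add: mean_reward_def)
  next
    case less
    interpret interval_bounded_random_variable "reward Z \<nu> a" "\<lambda>r. r" 0 1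
      using reward_unit[OF a, of \<nu>] b by unfold_locales auto
    have "0 < - \<theta>" using less by simp
    from Hoeffdings_lemma_nn_integral[OF this] show ?thesis
      by (simp add: mean_reward_def right_diff_distrib)
  next
    case equal
    then show ?thesis using emeasure_space_1 by simp
  qed
  then have "ennreal (exp (- (\<theta>\<^sup>2 / 8))) * (\<integral>\<^sup>+r. ennreal (exp (\<theta> * (mean_reward Z \<nu> a - r))) \<partial>reward Z \<nu> a)
    \<le> ennreal (exp (- (\<theta>\<^sup>2 / 8))) * ennreal (exp (\<theta>\<^sup>2 / 8))"
    by (intro mult_left_mono) auto
  also have "\<dots> = 1" by (simp add: ennreal_mult[symmetric] exp_minus)
  also have "ennreal (exp (- (\<theta>\<^sup>2 / 8))) * (\<integral>\<^sup>+r. ennreal (exp (\<theta> * (mean_reward Z \<nu> a - r))) \<partial>reward Z \<nu> a)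
    = (\<integral>\<^sup>+r. ennreal (exp (\<theta> * (mean_reward Z \<nu> a - r) - \<theta>\<^sup>2 / 8)) \<partial>reward Z \<nu> a)"
    using b by (subst nn_integral_cmult[symmetric]) (auto simp: ennreal_mult[symmetric] mult_exp_exp)
  finally show ?thesis .
qed

text \<open>The exponential supermartingale of \<open>dev\<close>. Its compensator grows only in
  rounds of learner \<open>i\<close>: such a round contributes a factor of conditional mean at most
  1, any other round the factor 1.\<close>

definition mgf :: "real \<Rightarrow> 'e \<Rightarrow> nat \<Rightarrow> nat \<Rightarrow> 'a trace \<Rightarrow> real" where
  "mgf \<theta> \<nu> i t h = exp (\<theta> * dev \<nu> i t h - \<theta>\<^sup>2 / 8 * cnt i t h)"

lemma mgf_measurable:
  assumes [measurable]: "H \<in> N \<rightarrow>\<^sub>M Tr n" "G \<in> N \<rightarrow>\<^sub>M borel" and t: "t \<le> Suc n"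
  shows "(\<lambda>x. mgf \<theta> (G x) i t (H x)) \<in> borel_measurable N"
  unfolding mgf_def using dev_measurable[OF _ _ t, measurable] cnt_measurable[OF _ t, measurable] by measurable

lemma mgf_le_1:
  "n \<le> T \<Longrightarrow> (\<integral>\<^sup>+x. ennreal (mgf \<theta> \<nu> i (Suc n) (fst x)) \<partial>run \<nu> n) \<le> 1"
proof (induction n)
  case 0
  have "mgf \<theta> \<nu> i (Suc 0) h = 1" for h
    by (simp add: mgf_def dev_def cnt_def selected_def)
  then show ?case
    using prob_space.emeasure_space_1[OF run_prob[of 0 \<nu>]] by (simp del: bms_run.simps)
next
  case (Suc n)
  have n: "n \<le> T" using Suc.prems by simp
  have m[measurable]: "(\<lambda>h. ennreal (mgf \<theta> \<nu> i (Suc m) h)) \<in> borel_measurable (Tr m)" for m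
    using mgf_measurable[where H="\<lambda>h. h" and G="\<lambda>_. \<nu>" and N="Tr m" and n=m and t="Suc m"] by simp
  have upd: "mgf \<theta> \<nu> i (Suc (Suc n)) (h(Suc n := (j, a, r))) =
      mgf \<theta> \<nu> i (Suc n) h * (if j = i then exp (\<theta> * (mean_reward Z \<nu> a - r) - \<theta>\<^sup>2 / 8) else 1)" for h j a r
    by (simp add: mgf_def dev_upd cnt_upd algebra_simps flip: exp_add)
  have "(\<integral>\<^sup>+x. ennreal (mgf \<theta> \<nu> i (Suc (Suc n)) (fst x)) \<partial>run \<nu> (Suc n)) =
    (\<integral>\<^sup>+\<omega>. \<integral>\<^sup>+w. \<integral>\<^sup>+r. ennreal (mgf \<theta> \<nu> i (Suc (Suc n)) (extend n w r))
      \<partial>reward Z \<nu> (snd (snd w)) \<partial>act_kernel n \<omega> \<partial>run \<nu> n)"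
    by (rule nn_integral_run_Suc_trace[OF Suc.prems m])
  also have "\<dots> \<le> (\<integral>\<^sup>+\<omega>. \<integral>\<^sup>+w. ennreal (mgf \<theta> \<nu> i (Suc n) (fst (fst w))) \<partial>act_kernel n \<omega> \<partial>run \<nu> n)"
  proof (intro nn_integral_mono)
    fix \<omega> w assume "\<omega> \<in> space (run \<nu> n)" "w \<in> space (act_kernel n \<omega>)"
    then have a: "snd (snd w) \<in> space A" by (rule space_act_run(2)[OF Suc.prems])
    have [measurable_cong]: "sets (reward Z \<nu> (snd (snd w))) = sets borel" by (rule sets_reward[OF a])
    let ?m = "ennreal (mgf \<theta> \<nu> i (Suc n) (fst (fst w)))"
    have "(\<integral>\<^sup>+r. ennreal (mgf \<theta> \<nu> i (Suc (Suc n)) (extend n w r)) \<partial>reward Z \<nu> (snd (snd w)))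
      = ?m * (\<integral>\<^sup>+r. ennreal (if fst (snd w) = i then exp (\<theta> * (mean_reward Z \<nu> (snd (snd w)) - r) - \<theta>\<^sup>2 / 8) else 1) \<partial>reward Z \<nu> (snd (snd w)))"
      unfolding upd by (subst nn_integral_cmult[symmetric]) (auto simp: ennreal_mult mgf_def simp flip: exp_add)
    also have "\<dots> \<le> ?m * 1"
      using reward_mgf[OF a, where \<theta>=\<theta> and \<nu>=\<nu>] prob_space.emeasure_space_1[OF reward_prob[OF a, of \<nu>]]
      by (intro mult_left_mono) (cases "fst (snd w) = i", auto)
    finally show "(\<integral>\<^sup>+r. ennreal (mgf \<theta> \<nu> i (Suc (Suc n)) (extend n w r)) \<partial>reward Z \<nu> (snd (snd w))) \<le> ?m"
      by simp
  qed
  also have "\<dots> = (\<integral>\<^sup>+\<omega>. ennreal (mgf \<theta> \<nu> i (Suc n) (fst \<omega>)) \<partial>run \<nu> n)"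
  proof (rule nn_integral_cong)
    fix \<omega> assume "\<omega> \<in> space (run \<nu> n)"
    then have \<omega>: "\<omega> \<in> space (Run n)" using space_run[OF n] by simp
    have "(\<lambda>x. ennreal (mgf \<theta> \<nu> i (Suc n) (fst (fst x)))) \<in> borel_measurable (Run n \<Otimes>\<^sub>M W n)"
      by (rule measurable_compose[OF _ m]) measurable
    from act_kernel_fst[OF Suc.prems this \<omega>]
    have "(\<integral>\<^sup>+w. ennreal (mgf \<theta> \<nu> i (Suc n) (fst (fst w))) \<partial>act_kernel n \<omega>) = (\<integral>\<^sup>+w. ennreal (mgf \<theta> \<nu> i (Suc n) (fst \<omega>)) \<partial>act_kernel n \<omega>)"
      by simp
    then show "(\<integral>\<^sup>+w. ennreal (mgf \<theta> \<nu> i (Suc n) (fst (fst w))) \<partial>act_kernel n \<omega>) = ennreal (mgf \<theta> \<nu> i (Suc n) (fst \<omega>))"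
      using prob_space.emeasure_space_1[OF prob_algebraD(1)[OF act_kernel_measurable[OF Suc.prems] \<omega>]] by simp
  qed
  also have "\<dots> \<le> 1" by (rule Suc.IH[OF n])
  finally show ?case .
qed

lemma mgf_prefix_le_1:
  assumes "n \<le> T" "t \<in> {1..Suc n}"
  shows "(\<integral>\<^sup>+x. ennreal (mgf \<theta> \<nu> i t (fst x)) \<partial>run \<nu> n) \<le> 1"
proof -
  obtain m where m: "t = Suc m" using assms by (cases t) auto
  have mn: "m \<le> n" "m \<le> T" using m assms by auto
  have meas: "(\<lambda>h. ennreal (mgf \<theta> \<nu> i t h)) \<in> borel_measurable (Tr m)"
    using mgf_measurable[where H="\<lambda>h. h" and G="\<lambda>_. \<nu>" and N="Tr m" and n=m and t="Suc m"] by (simp add: m)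
  show ?thesis
    using run_marginal[OF mn(1) assms(1) meas, of \<nu>] mgf_le_1[OF mn(2), where \<theta>=\<theta> and \<nu>=\<nu> and i=i]
    by (simp add: m mgf_def dev_restrict cnt_restrict)
qed

lemma dev_tail:
  assumes n: "n \<le> T" "t \<in> {1..Suc n}" and k: "1 \<le> k" and c: "0 \<le> c"
  shows "(\<integral>\<^sup>+x. (if c * sqrt (real k) < \<bar>dev \<nu> i t (fst x)\<bar> \<and> cnt i t (fst x) = k then 1 else 0) \<partial>run \<nu> n)
    \<le> ennreal (2 * exp (- 2 * c\<^sup>2))"
proof -
  \<comment> \<open>The maximiser of
    \<open>\<theta> * c * sqrt k - \<theta>\<^sup>2 * k / 8\<close>, with value
    \<open>2 * c\<^sup>2\<close>. It depends on the number of observations, which is why the event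
    fixes \<open>cnt i t h = k\<close>.\<close>
  define \<theta> where "\<theta> = 4 * c / sqrt k"
  have [measurable]: "(\<lambda>x. ennreal (mgf \<theta> \<nu> i t (fst x))) \<in> borel_measurable (run \<nu> n)" for \<theta>
    using mgf_measurable[where H=fst and G="\<lambda>_. \<nu>" and N="Run n" and n=n and t=t and i=i and \<theta>=\<theta>] n
    by (simp add: measurable_cong_sets[OF sets_run[OF n(1)] refl])
  have pw: "(if c * sqrt (real k) < \<bar>dev \<nu> i t h\<bar> \<and> cnt i t h = k then 1 else 0)
    \<le> exp (- 2 * c\<^sup>2) * (mgf \<theta> \<nu> i t h + mgf (- \<theta>) \<nu> i t h)" for h
  proof (cases "c * sqrt (real k) < \<bar>dev \<nu> i t h\<bar> \<and> cnt i t h = k")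
    case True
    have sq: "\<theta>\<^sup>2 / 8 * real k = 2 * c\<^sup>2" "\<theta> * (c * sqrt k) = 4 * c\<^sup>2"
      using k by (auto simp: \<theta>_def power2_eq_square field_simps)
    have l0: "0 \<le> \<theta>" using c by (simp add: \<theta>_def)
    have "\<theta> * (c * sqrt k) \<le> \<theta> * \<bar>dev \<nu> i t h\<bar>"
      using True l0 by (intro mult_left_mono) auto
    then have *: "2 * c\<^sup>2 \<le> \<theta> * \<bar>dev \<nu> i t h\<bar> - \<theta>\<^sup>2 / 8 * real k" using sq by simp
    have "exp (2 * c\<^sup>2) \<le> mgf \<theta> \<nu> i t h + mgf (- \<theta>) \<nu> i t h"
    proof (cases "0 \<le> dev \<nu> i t h")
      case True
      then have "exp (2 * c\<^sup>2) \<le> mgf \<theta> \<nu> i t h" using * \<open>_ \<and> cnt i t h = k\<close> by (simp add: mgf_def)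
      then show ?thesis by (simp add: mgf_def add_increasing2)
    next
      case False
      then have "exp (2 * c\<^sup>2) \<le> mgf (- \<theta>) \<nu> i t h" using * \<open>_ \<and> cnt i t h = k\<close> by (simp add: mgf_def)
      then show ?thesis by (simp add: mgf_def add_increasing)
    qed
    then have "exp (- 2 * c\<^sup>2) * exp (2 * c\<^sup>2) \<le> exp (- 2 * c\<^sup>2) * (mgf \<theta> \<nu> i t h + mgf (- \<theta>) \<nu> i t h)"
      by (intro mult_left_mono) auto
    then show ?thesis using True by (simp add: mult_exp_exp)
  next
    case False
    then have "(if c * sqrt (real k) < \<bar>dev \<nu> i t h\<bar> \<and> cnt i t h = k then 1 else 0) = (0 :: real)" by (rule if_not_P)
    then show ?thesis by (simp add: mgf_def)
  qed
  have "(\<integral>\<^sup>+x. (if c * sqrt (real k) < \<bar>dev \<nu> i t (fst x)\<bar> \<and> cnt i t (fst x) = k then 1 else 0) \<partial>run \<nu> n)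
    \<le> (\<integral>\<^sup>+x. ennreal (exp (- 2 * c\<^sup>2)) * (ennreal (mgf \<theta> \<nu> i t (fst x)) + ennreal (mgf (- \<theta>) \<nu> i t (fst x))) \<partial>run \<nu> n)"
  proof (rule nn_integral_mono)
    fix x
    have "ennreal (if c * sqrt (real k) < \<bar>dev \<nu> i t (fst x)\<bar> \<and> cnt i t (fst x) = k then 1 else 0)
      \<le> ennreal (exp (- 2 * c\<^sup>2) * (mgf \<theta> \<nu> i t (fst x) + mgf (- \<theta>) \<nu> i t (fst x)))"
      by (rule ennreal_leI[OF pw])
    then show "(if c * sqrt (real k) < \<bar>dev \<nu> i t (fst x)\<bar> \<and> cnt i t (fst x) = k then 1 else 0)
      \<le> ennreal (exp (- 2 * c\<^sup>2)) * (ennreal (mgf \<theta> \<nu> i t (fst x)) + ennreal (mgf (- \<theta>) \<nu> i t (fst x)))"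
      by (cases "c * sqrt (real k) < \<bar>dev \<nu> i t (fst x)\<bar> \<and> cnt i t (fst x) = k")
         (simp_all only: if_True if_False ennreal_1 zero_le, simp_all add: ennreal_mult mgf_def)
  qed
  also have "\<dots> = ennreal (exp (- 2 * c\<^sup>2)) * ((\<integral>\<^sup>+x. ennreal (mgf \<theta> \<nu> i t (fst x)) \<partial>run \<nu> n)
      + (\<integral>\<^sup>+x. ennreal (mgf (- \<theta>) \<nu> i t (fst x)) \<partial>run \<nu> n))"
    by (subst nn_integral_cmult) (auto simp: nn_integral_add)
  also have "\<dots> \<le> ennreal (exp (- 2 * c\<^sup>2)) * (1 + 1)"
    by (intro mult_left_mono add_mono mgf_prefix_le_1 n) auto
  also have "\<dots> = ennreal (2 * exp (- 2 * c\<^sup>2))"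
    by (simp add: ennreal_mult mult.commute)
  finally show ?thesis .
qed

text \<open>All prefixes \<open>s\<close> are included because \<open>settled\<close> compares the
  present average with every earlier one.\<close>

definition concentrated :: "real \<Rightarrow> nat \<Rightarrow> 'e \<Rightarrow> 'a trace \<Rightarrow> bool" where
  "concentrated c t \<nu> h \<longleftrightarrow> (\<forall>i\<in>{1..M}. \<forall>s\<in>{1..t}. \<bar>dev \<nu> i s h\<bar> \<le> c * sqrt (cnt i s h))"

lemma concentrated_measurable:
  assumes H: "H \<in> N \<rightarrow>\<^sub>M Tr n" and G: "G \<in> N \<rightarrow>\<^sub>M borel"
  shows "Measurable.pred N (\<lambda>x. concentrated c (Suc n) (G x) (H x))"
proof -
  have [measurable]: "(\<lambda>x. dev (G x) i s (H x)) \<in> borel_measurable N" "(\<lambda>x. real (cnt i s (H x))) \<in> borel_measurable N"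
    if "s \<in> {1..Suc n}" for i s
    using that dev_measurable[OF H G] cnt_measurable[OF H] by auto
  show ?thesis unfolding concentrated_def by measurable
qed

text \<open>As \<open>cnt i s h\<close> is random, the union bound also runs over its possible values.\<close>

lemma concentrated_prob:
  assumes n: "Suc n \<le> T" and c: "0 \<le> c"
  shows "(\<integral>\<^sup>+x. (if concentrated c (Suc n) \<nu> (fst x) then 0 else 1) \<partial>run \<nu> n)
    \<le> ennreal (real M * real T * real T * (2 * exp (- 2 * c\<^sup>2)))"
proof -
  have n': "n \<le> T" using n by simp
  let ?f = "\<lambda>i s k h. (if c * sqrt (real k) < \<bar>dev \<nu> i s h\<bar> \<and> cnt i s h = k then 1 else 0) :: ennreal"
  have fm: "(\<lambda>x. ?f i s k (fst x)) \<in> borel_measurable (run \<nu> n)" if "s \<in> {1..Suc n}" for i s k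
  proof -
    have s: "s \<le> Suc n" using that by simp
    have [measurable]: "(\<lambda>x. dev \<nu> i s (fst x)) \<in> borel_measurable (Run n)"
      using dev_measurable[OF fst_run _ s, of "\<lambda>_. \<nu>"] by simp
    have [measurable]: "(\<lambda>x. real (cnt i s (fst x))) \<in> borel_measurable (Run n)"
      by (rule cnt_measurable[OF fst_run s])
    have "(\<lambda>x. if c * sqrt (real k) < \<bar>dev \<nu> i s (fst x)\<bar> \<and> real (cnt i s (fst x)) = real k then 1 else 0 :: ennreal) \<in> borel_measurable (Run n)"
      by measurable
    then show ?thesis using sets_run[OF n', of \<nu>] by (simp cong: measurable_cong_sets)
  qed
  have pw: "(if concentrated c (Suc n) \<nu> h then 0 else 1) \<le> (\<Sum>i\<in>{1..M}. \<Sum>s\<in>{1..Suc n}. \<Sum>k\<in>{1..T}. ?f i s k h)" for h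
  proof (cases "concentrated c (Suc n) \<nu> h")
    case False
    then obtain i s where i: "i \<in> {1..M}" and s: "s \<in> {1..Suc n}" and d: "c * sqrt (cnt i s h) < \<bar>dev \<nu> i s h\<bar>"
      by (auto simp: concentrated_def not_le)
    \<comment> \<open>Without observations both sides of the bound are 0, so a violation needs a
      positive count and the union may start at \<open>k = 1\<close>.\<close>
    have "cnt i s h \<noteq> 0"
    proof
      assume "cnt i s h = 0"
      then have "selected i s h = {}" by (simp add: cnt_def)
      then show False using d c by (simp add: dev_def cnt_def)
    qed
    moreover have "cnt i s h \<le> T" using cnt_le[of i s h] s n unfolding atLeastAtMost_iff by linarith
    ultimately have k: "cnt i s h \<in> {1..T}" by simp
    have "1 = ?f i s (cnt i s h) h" using d by simp
    also have "\<dots> \<le> (\<Sum>k\<in>{1..T}. ?f i s k h)" by (rule member_le_sum[OF k]) auto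
    also have "\<dots> \<le> (\<Sum>s\<in>{1..Suc n}. \<Sum>k\<in>{1..T}. ?f i s k h)"
      by (rule member_le_sum[OF s]) auto
    also have "\<dots> \<le> (\<Sum>i\<in>{1..M}. \<Sum>s\<in>{1..Suc n}. \<Sum>k\<in>{1..T}. ?f i s k h)"
      by (rule member_le_sum[OF i, of "\<lambda>i. \<Sum>s\<in>{1..Suc n}. \<Sum>k\<in>{1..T}. ?f i s k h"]) auto
    finally show ?thesis using False by simp
  qed simp
  have "(\<integral>\<^sup>+x. (if concentrated c (Suc n) \<nu> (fst x) then 0 else 1) \<partial>run \<nu> n)
    \<le> (\<integral>\<^sup>+x. (\<Sum>i\<in>{1..M}. \<Sum>s\<in>{1..Suc n}. \<Sum>k\<in>{1..T}. ?f i s k (fst x)) \<partial>run \<nu> n)"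
    by (intro nn_integral_mono pw)
  also have "\<dots> = (\<Sum>i\<in>{1..M}. \<Sum>s\<in>{1..Suc n}. \<Sum>k\<in>{1..T}. \<integral>\<^sup>+x. ?f i s k (fst x) \<partial>run \<nu> n)"
    by (rule trans[OF nn_integral_sum sum.cong[OF refl trans[OF nn_integral_sum sum.cong[OF refl nn_integral_sum]]]])
       (intro borel_measurable_sum fm; assumption)+
  also have "\<dots> \<le> (\<Sum>i\<in>{1..M}. \<Sum>s\<in>{1..Suc n}. \<Sum>k\<in>{1..T}. ennreal (2 * exp (- 2 * c\<^sup>2)))"
    by (intro sum_mono dev_tail n' c) auto
  also have "\<dots> = ennreal (real M * real (Suc n) * real T * (2 * exp (- 2 * c\<^sup>2)))"
    by (simp add: ennreal_mult ennreal_of_nat_eq_real_of_nat mult.assoc del: of_nat_Suc)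
  also have "\<dots> \<le> ennreal (real M * real T * real T * (2 * exp (- 2 * c\<^sup>2)))"
    using n by (intro ennreal_leI mult_right_mono mult_left_mono) auto
  finally show ?thesis .
qed

section \<open>Regret coefficients, the support of the prior and the failure event\<close>

lemma regret_le:
  assumes "h \<in> space (Tr n)" "t \<le> Suc n"
  shows "regret Z \<nu> i t h \<le> real (t - 1)"
proof -
  have "regret Z \<nu> i t h \<le> (\<Sum>l\<in>selected i t h. 1)"
    unfolding regret_def
  proof (rule sum_mono)
    fix l assume "l \<in> selected i t h"
    then have "action h l \<in> space A" using obs_space(2)[OF assms(1)] assms(2) by (auto dest!: in_selected_less)
    from mean_nonneg[OF this, of \<nu>] opt_le_1[of \<nu>] show "opt_mean Z \<nu> - mean_reward Z \<nu> (action h l) \<le> 1" by simp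
  qed
  also have "\<dots> = real (cnt i t h)" by (simp add: cnt_def)
  finally show ?thesis using cnt_le[of i t h] by linarith
qed

lemma regret_measurable:
  assumes [measurable]: "H \<in> N \<rightarrow>\<^sub>M Tr n" "G \<in> N \<rightarrow>\<^sub>M borel" and t: "t \<le> Suc n"
  shows "(\<lambda>x. regret Z (G x) i t (H x)) \<in> borel_measurable N"
  using potential_measurable[OF assms] by (simp add: potential_eq_regret)

definition coeff_set :: "nat \<Rightarrow> 'e \<Rightarrow> real \<Rightarrow> real set" where
  "coeff_set i \<nu> \<delta> = {d. measure (run \<nu> T)
     {\<omega> \<in> space (run \<nu> T). \<forall>l\<in>{1..T}. regret Z \<nu> i l (fst \<omega>) \<le> d * sqrt (real l)} \<ge> 1 - \<delta>}"

lemma regret_coeff_eq: "regret_coeff Z M B post i T \<nu> \<delta> = Inf (coeff_set i \<nu> \<delta>)"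
  by (simp add: regret_coeff_def coeff_set_def)

text \<open>At \<open>l = 1\<close> the regret is an empty sum, so a negative \<open>d\<close> makes
  the event empty.\<close>

lemma coeff_set_nonneg:
  assumes "\<delta> < 1" "1 \<le> T" "d \<in> coeff_set i \<nu> \<delta>"
  shows "0 \<le> d"
proof (rule ccontr)
  assume "\<not> 0 \<le> d"
  then have *: "{\<omega> \<in> space (run \<nu> T). \<forall>l\<in>{1..T}. regret Z \<nu> i l (fst \<omega>) \<le> d * sqrt (real l)} = {}"
    using assms(2) by (auto simp: regret_def intro!: bexI[of _ 1])
  have "1 - \<delta> \<le> 0" using assms(3) unfolding coeff_set_def mem_Collect_eq * by simp
  then show False using assms by simp
qed

text \<open>The regret before round \<open>l\<close> is at most \<open>l = sqrt l * sqrt l\<close>,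
  on every path. The resulting bound on the coefficients is uniform in environment and learner,
  which bounds the supremum in \<open>d_star\<close>.\<close>

lemma coeff_set_sqrt:
  assumes "0 < \<delta>"
  shows "sqrt (real T) \<in> coeff_set i \<nu> \<delta>"
proof -
  have "regret Z \<nu> i l (fst \<omega>) \<le> sqrt (real T) * sqrt (real l)"
    if "\<omega> \<in> space (run \<nu> T)" "l \<in> {1..T}" for \<omega> l
  proof -
    have "fst \<omega> \<in> space (Tr T)" using that space_run[of T \<nu>] measurable_space[OF fst_run] by auto
    from regret_le[OF this, of l \<nu> i] that have "regret Z \<nu> i l (fst \<omega>) \<le> real l" by auto
    also have "real l = sqrt (real l) * sqrt (real l)" by simp
    also have "\<dots> \<le> sqrt (real T) * sqrt (real l)" using that by (intro mult_right_mono) auto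
    finally show ?thesis .
  qed
  then have "{\<omega> \<in> space (run \<nu> T). \<forall>l\<in>{1..T}. regret Z \<nu> i l (fst \<omega>) \<le> sqrt (real T) * sqrt (real l)}
    = space (run \<nu> T)" by auto
  then show ?thesis
    using prob_space.prob_space[OF run_prob[of T \<nu>]] assms by (simp add: coeff_set_def)
qed

lemma regret_coeff_bounds:
  assumes "0 < \<delta>" "\<delta> < 1" "1 \<le> T"
  shows "0 \<le> regret_coeff Z M B post i T \<nu> \<delta>" "regret_coeff Z M B post i T \<nu> \<delta> \<le> sqrt (real T)"
  unfolding regret_coeff_eq
  using coeff_set_sqrt[OF assms(1), of i \<nu>] coeff_set_nonneg[OF assms(2,3)]
  by (auto intro!: cInf_greatest cInf_lower bdd_belowI[where m=0])

text \<open>A \<open>d\<close> strictly above the infimum has an element \<open>d'\<close> of the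
  set below it. The event of \<open>d'\<close> concerns horizon \<open>T\<close>; it is read at the
  prefix \<open>Suc n\<close>, whose law is already that of \<open>run \<nu> n\<close>.\<close>

lemma regret_prob:
  assumes \<delta>: "0 < \<delta>" "\<delta> < 1" "1 \<le> T" and n: "Suc n \<le> T"
    and d: "regret_coeff Z M B post i T \<nu> \<delta> < d"
  shows "(\<integral>\<^sup>+x. (if regret Z \<nu> i (Suc n) (fst x) \<le> d * sqrt (real T) then 0 else 1) \<partial>run \<nu> n) \<le> ennreal \<delta>"
proof -
  obtain d' where d': "d' \<in> coeff_set i \<nu> \<delta>" "d' < d"
    using d coeff_set_sqrt[OF \<delta>(1), of i \<nu>] coeff_set_nonneg[OF \<delta>(2,3)]
    unfolding regret_coeff_eq by (subst (asm) cInf_less_iff) (auto intro!: bdd_belowI[where m=0])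
  define G where "G = {\<omega> \<in> space (run \<nu> T). \<forall>l\<in>{1..T}. regret Z \<nu> i l (fst \<omega>) \<le> d' * sqrt (real l)}"
  interpret P: prob_space "run \<nu> T" by (rule run_prob) simp
  have "G = {\<omega> \<in> space (Run T). \<forall>l\<in>{1..T}. regret Z \<nu> i l (fst \<omega>) \<le> d' * sqrt (real l)}"
    using space_run[of T \<nu>] by (simp add: G_def)
  also have "\<dots> \<in> sets (Run T)"
    by (intro sets.sets_Collect_finite_All borel_measurable_le regret_measurable[OF fst_run]) auto
  finally have G: "G \<in> P.events" using sets_run[of T \<nu>] by simp
  have PG: "1 - \<delta> \<le> P.prob G" using d' by (simp add: coeff_set_def G_def)
  have meas: "(\<lambda>h. if regret Z \<nu> i (Suc n) h \<le> d * sqrt (real T) then 0 else 1 :: ennreal) \<in> borel_measurable (Tr n)"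
    using regret_measurable[of "\<lambda>h. h" "Tr n" n "\<lambda>_. \<nu>" "Suc n" i] by measurable
  have rr: "regret Z \<nu> i (Suc n) (restrict h {1..n}) = regret Z \<nu> i (Suc n) h" for h :: "'a trace"
    unfolding regret_def by (intro sum.cong) (auto simp: selected_restrict action_def dest: in_selected_less)
  have "(\<integral>\<^sup>+x. (if regret Z \<nu> i (Suc n) (fst x) \<le> d * sqrt (real T) then 0 else 1) \<partial>run \<nu> n)
    = (\<integral>\<^sup>+x. (if regret Z \<nu> i (Suc n) (fst x) \<le> d * sqrt (real T) then 0 else 1) \<partial>run \<nu> T)"
    using run_marginal[OF _ order_refl meas, of \<nu>] n by (simp add: rr)
  also have "\<dots> \<le> (\<integral>\<^sup>+x. indicator (space (run \<nu> T) - G) x \<partial>run \<nu> T)"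
  proof (rule nn_integral_mono)
    fix x assume x: "x \<in> space (run \<nu> T)"
    have "regret Z \<nu> i (Suc n) (fst x) \<le> d * sqrt (real T)" if "x \<in> G"
    proof -
      have "regret Z \<nu> i (Suc n) (fst x) \<le> d' * sqrt (real (Suc n))" using that n unfolding G_def by fastforce
      also have "\<dots> \<le> d * sqrt (real T)"
        using d' coeff_set_nonneg[OF \<delta>(2,3) d'(1)] n by (intro mult_mono) auto
      finally show ?thesis .
    qed
    then show "(if regret Z \<nu> i (Suc n) (fst x) \<le> d * sqrt (real T) then 0 else 1) \<le> (indicator (space (run \<nu> T) - G) x :: ennreal)"
      using x by (auto split: split_indicator)
  qed
  also have "\<dots> = ennreal (1 - P.prob G)"
    using G P.prob_compl[OF G] by (simp add: P.emeasure_eq_measure)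
  also have "\<dots> \<le> ennreal \<delta>" using PG by (intro ennreal_leI) simp
  finally show ?thesis .
qed

text \<open>A point outside the support has a null neighbourhood, hence a null basic one. The basis
  is countable, so these have a null union.\<close>

lemma AE_supp: "AE \<nu> in prior Z. \<nu> \<in> supp (prior Z)"
proof -
  obtain \<B> :: "'e set set" where \<B>: "countable \<B>" "topological_basis \<B>"
    using ex_countable_basis by blast
  interpret prob_space "prior Z" by (rule prior_prob)
  have op: "open U \<Longrightarrow> U \<in> sets (prior Z)" for U by simp
  define N where "N = (\<Union>U\<in>{U\<in>\<B>. measure (prior Z) U = 0}. U)"
  have "N \<in> null_sets (prior Z)"
    unfolding N_def
    using \<B> op topological_basis_open[OF \<B>(2)]
    by (intro null_sets_UN') (auto simp: null_sets_def emeasure_eq_measure intro: countable_subset[OF _ \<B>(1)])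
  moreover have "{\<nu> \<in> space (prior Z). \<nu> \<notin> supp (prior Z)} \<subseteq> N"
  proof
    fix \<nu> assume "\<nu> \<in> {\<nu> \<in> space (prior Z). \<nu> \<notin> supp (prior Z)}"
    then obtain U where U: "open U" "\<nu> \<in> U" "measure (prior Z) U = 0"
      by (auto simp: supp_def not_less measure_le_0_iff)
    obtain V where V: "V \<in> \<B>" "\<nu> \<in> V" "V \<subseteq> U"
      using topological_basisE[OF \<B>(2) U(1,2)] by blast
    have "measure (prior Z) V \<le> measure (prior Z) U"
      using V U op by (intro finite_measure_mono) auto
    then show "\<nu> \<in> N" using V U by (auto simp: N_def measure_le_0_iff)
  qed
  ultimately show ?thesis by (rule AE_I')
qed

lemma d_star_ge:
  assumes \<delta>: "0 < \<delta>" "\<delta> < 1" "1 \<le> T" and \<nu>: "\<nu> \<in> supp (prior Z)"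
  shows "\<exists>i\<in>{1..M}. regret_coeff Z M B post i T \<nu> \<delta> \<le> d_star Z M B post T \<delta>"
proof -
  have ne: "(\<lambda>i. regret_coeff Z M B post i T \<nu> \<delta>) ` {1..M} \<noteq> {}" for \<nu> using M by simp
  have "(MIN i\<in>{1..M}. regret_coeff Z M B post i T \<nu> \<delta>) \<le> sqrt (real T)" for \<nu>
  proof -
    have "(MIN i\<in>{1..M}. regret_coeff Z M B post i T \<nu> \<delta>) \<le> regret_coeff Z M B post 1 T \<nu> \<delta>"
      using M by (intro Min_le) auto
    also have "\<dots> \<le> sqrt (real T)" by (rule regret_coeff_bounds[OF \<delta>])
    finally show ?thesis .
  qed
  then have "(MIN i\<in>{1..M}. regret_coeff Z M B post i T \<nu> \<delta>) \<le> d_star Z M B post T \<delta>"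
    unfolding d_star_def by (intro cSUP_upper[OF \<nu>] bdd_aboveI2[where M="sqrt (real T)"])
  moreover have "(MIN i\<in>{1..M}. regret_coeff Z M B post i T \<nu> \<delta>) \<in> (\<lambda>i. regret_coeff Z M B post i T \<nu> \<delta>) ` {1..M}"
    using ne by (intro Min_in) auto
  ultimately show ?thesis by auto
qed

text \<open>The support has prior mass 1, so the supremum runs over a nonempty set of nonnegative
  minima.\<close>

lemma d_star_nonneg:
  assumes \<delta>: "0 < \<delta>" "\<delta> < 1" "1 \<le> T"
  shows "0 \<le> d_star Z M B post T \<delta>"
proof -
  interpret prob_space "prior Z" by (rule prior_prob)
  obtain \<nu> where "\<nu> \<in> supp (prior Z)"
    using AE_supp AE_False by (metis eventually_mono)
  from d_star_ge[OF \<delta> this] show ?thesis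
    using regret_coeff_bounds(1)[OF \<delta>] by (meson order_trans)
qed

text \<open>The learner is existential and may depend on the environment: a regret bound for any one
  learner passes to the minimiser.\<close>

definition good :: "real \<Rightarrow> real \<Rightarrow> nat \<Rightarrow> 'e \<Rightarrow> 'a trace \<Rightarrow> bool" where
  "good D c t \<nu> h \<longleftrightarrow> concentrated c t \<nu> h \<and> (\<exists>i\<in>{1..M}. regret Z \<nu> i t h \<le> D)"

lemma good_measurable:
  fixes n :: nat and D c :: real
  shows "Measurable.pred (borel \<Otimes>\<^sub>M Run n) (\<lambda>y. good D c (Suc n) (fst y) (fst (snd y)))"
proof -
  note concentrated_measurable[of "\<lambda>y. fst (snd y)" "borel \<Otimes>\<^sub>M Run n" n fst, measurable]
  have [measurable]: "(\<lambda>y. regret Z (fst y) i (Suc n) (fst (snd y))) \<in> borel_measurable (borel \<Otimes>\<^sub>M Run n)" for i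
    using regret_measurable[of "\<lambda>y. fst (snd y)" "borel \<Otimes>\<^sub>M Run n" n fst "Suc n" i] by auto
  show ?thesis unfolding good_def by measurable
qed

lemma bad_prob:
  assumes \<delta>: "0 < \<delta>" "\<delta> < 1" "1 \<le> T" and n: "Suc n \<le> T" and c: "0 \<le> c"
    and d: "d_star Z M B post T \<delta> < d"
  shows "(\<integral>\<^sup>+y. (if good (d * sqrt (real T)) c (Suc n) (fst y) (fst (snd y)) then 0 else 1) \<partial>bayes n)
    \<le> ennreal (\<delta> + real M * real T * real T * (2 * exp (- 2 * c\<^sup>2)))" (is "?L \<le> ennreal ?R")
proof -
  have n': "n \<le> T" using n by simp
  let ?D = "d * sqrt (real T)"
  note good_measurable[where n=n and D="?D" and c=c, measurable]
  have "?L = (\<integral>\<^sup>+\<nu>. \<integral>\<^sup>+x. (if good ?D c (Suc n) \<nu> (fst x) then 0 else 1) \<partial>run \<nu> n \<partial>prior Z)"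
    by (subst nn_integral_bayes[OF n']) auto
  also have "\<dots> \<le> (\<integral>\<^sup>+\<nu>. ennreal ?R \<partial>prior Z)"
  \<comment> \<open>The bound holds for each environment of the support, with a learner chosen for
    that environment, and is then averaged over the prior.\<close>
  proof (rule nn_integral_mono_AE, rule eventually_mono[OF AE_supp])
    fix \<nu> assume "\<nu> \<in> supp (prior Z)"
    from d_star_ge[OF \<delta> this] obtain i where i: "i \<in> {1..M}" "regret_coeff Z M B post i T \<nu> \<delta> < d"
      using d by fastforce
    have "Measurable.pred (Run n) (\<lambda>x. concentrated c (Suc n) \<nu> (fst x))"
      by (rule concentrated_measurable[OF fst_run]) simp
    moreover have "(\<lambda>x. regret Z \<nu> i (Suc n) (fst x)) \<in> borel_measurable (Run n)"
      by (rule regret_measurable[OF fst_run]) simp_all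
    ultimately have [measurable]: "Measurable.pred (run \<nu> n) (\<lambda>x. concentrated c (Suc n) \<nu> (fst x))"
      "(\<lambda>x. regret Z \<nu> i (Suc n) (fst x)) \<in> borel_measurable (run \<nu> n)"
      by (simp_all add: measurable_cong_sets[OF sets_run[OF n'] refl])
    have "(\<integral>\<^sup>+x. (if good ?D c (Suc n) \<nu> (fst x) then 0 else 1) \<partial>run \<nu> n)
      \<le> (\<integral>\<^sup>+x. (if regret Z \<nu> i (Suc n) (fst x) \<le> ?D then 0 else 1) + (if concentrated c (Suc n) \<nu> (fst x) then 0 else 1) \<partial>run \<nu> n)"
      using i by (intro nn_integral_mono) (auto simp: good_def)
    also have "\<dots> = (\<integral>\<^sup>+x. (if regret Z \<nu> i (Suc n) (fst x) \<le> ?D then 0 else 1) \<partial>run \<nu> n)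
      + (\<integral>\<^sup>+x. (if concentrated c (Suc n) \<nu> (fst x) then 0 else 1) \<partial>run \<nu> n)"
      by (rule nn_integral_add) auto
    also have "\<dots> \<le> ennreal \<delta> + ennreal (real M * real T * real T * (2 * exp (- 2 * c\<^sup>2)))"
      by (intro add_mono regret_prob[OF \<delta> n i(2)] concentrated_prob[OF n c])
    also have "\<dots> = ennreal ?R" using \<delta> by (intro ennreal_plus[symmetric]) auto
    finally show "(\<integral>\<^sup>+x. (if good ?D c (Suc n) \<nu> (fst x) then 0 else 1) \<partial>run \<nu> n) \<le> ennreal ?R" .
  qed
  also have "\<dots> = ennreal ?R" using prob_space.emeasure_space_1[OF prior_prob] by simp
  finally show ?thesis .
qed

end

section \<open>Pathwise regret of the index\<close>

definition avg :: "nat \<Rightarrow> nat \<Rightarrow> 'a trace \<Rightarrow> real" where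
  "avg i t h = (\<Sum>l\<in>selected i t h. rew h l) / cnt i t h"

text \<open>The value at \<open>k = 0\<close> is the trivial bound on the optimal mean; there \<open>avg\<close> is the junk value \<open>0/0 = 0\<close>.\<close>

definition bonus :: "real \<Rightarrow> real \<Rightarrow> nat \<Rightarrow> real" where
  "bonus D c k = (if k = 0 then 1 else (D + c * sqrt k) / k)"

text \<open>What remains of \<open>good\<close> once the environment is removed. On
  \<open>good\<close>, \<open>opt_mean\<close> lies between the lower confidence bounds of all
  earlier averages and the present value of \<open>avg\<close> plus \<open>bonus\<close>; only the
  comparison of the two ends is kept.\<close>

definition settled :: "real \<Rightarrow> real \<Rightarrow> nat \<Rightarrow> nat \<Rightarrow> 'a trace \<Rightarrow> bool" where
  "settled D c i t h \<longleftrightarrow> cnt i t h = 0 \<or>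
     (\<forall>s\<in>{1..t}. cnt i s h = 0 \<or> avg i s h - c / sqrt (cnt i s h) \<le> avg i t h + bonus D c (cnt i t h))"

section \<open>Sums along the rounds of one learner\<close>

lemma cnt_Suc: "cnt i (Suc t) h = (if 1 \<le> t \<and> fst (h t) = i then Suc (cnt i t h) else cnt i t h)"
  by (simp add: cnt_def selected_Suc)

text \<open>The count before each selection of \<open>i\<close> takes the values 0, 1, 2, ... in
  turn.\<close>

lemma sum_selected_cnt:
  fixes f :: "nat \<Rightarrow> real"
  shows "(\<Sum>l\<in>selected i t h. f (cnt i l h)) = (\<Sum>j<cnt i t h. f j)"
proof (induction t)
  case 0
  then show ?case by (simp add: cnt_def selected_def)
next
  case (Suc t)
  then show ?case by (simp add: cnt_Suc selected_Suc add.commute)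
qed

text \<open>The term at \<open>j = 0\<close> is \<open>1 / 0 = 0\<close>. For
  \<open>n \<ge> 1\<close> the estimate \<open>sqrt (n + 1) \<le> 2 * sqrt n\<close> bounds
  \<open>1 / sqrt n\<close> by three times the increment of \<open>sqrt\<close>, and this
  telescopes.\<close>

lemma sum_inverse_sqrt_le: "(\<Sum>j<n. 1 / sqrt (real j)) \<le> 3 * sqrt (real n)"
proof (induction n)
  case (Suc n)
  show ?case
  proof (cases "n = 0")
    case False
    have "sqrt (real (Suc n)) \<le> sqrt (4 * real n)" using False by (intro real_sqrt_le_mono) simp
    then have le: "sqrt (real (Suc n)) + sqrt (real n) \<le> 3 * sqrt (real n)"
      by (simp add: real_sqrt_mult)
    have "1 = (sqrt (real (Suc n)) - sqrt (real n)) * (sqrt (real (Suc n)) + sqrt (real n))"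
      by (simp add: algebra_simps)
    also have "\<dots> \<le> (sqrt (real (Suc n)) - sqrt (real n)) * (3 * sqrt (real n))"
      using le by (intro mult_left_mono) auto
    finally have "1 / sqrt (real n) \<le> 3 * (sqrt (real (Suc n)) - sqrt (real n))"
      using False by (simp add: field_simps)
    then show ?thesis using Suc.IH by simp
  qed simp
qed simp

lemma sum_inverse_le:
  assumes "n \<le> N" "1 \<le> N"
  shows "(\<Sum>j<n. 1 / real j) \<le> 1 + ln (real N)"
proof -
  have "(\<Sum>j<n. 1 / real j) \<le> (\<Sum>j<Suc N. 1 / real j)"
    using assms by (intro sum_mono2) auto
  also have "\<dots> = (\<Sum>j=1..N. 1 / real j)"
    by (rule sum.mono_neutral_right) auto
  also have "\<dots> \<le> 1 + ln (real N)"
    using assms(2)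
  proof (induction N rule: dec_induct)
    case (step k)
    have "ln (real k / real (Suc k)) \<le> real k / real (Suc k) - 1"
      using step by (intro ln_le_minus_one) auto
    also have "\<dots> = - (1 / real (Suc k))" by (simp add: field_simps)
    finally have "1 / real (Suc k) \<le> ln (real (Suc k)) - ln (real k)"
      using step by (simp add: ln_div)
    then show ?case using step by simp
  qed simp
  finally show ?thesis .
qed

lemma sum_bonus_le:
  assumes "n \<le> N" "1 \<le> N" "0 \<le> D" "0 \<le> c"
  shows "(\<Sum>j<n. bonus D c j) \<le> 1 + D * (1 + ln (real N)) + 3 * c * sqrt (real n)"
proof -
  \<comment> \<open>This also holds at \<open>j = 0\<close>, where division by zero removes the last
    two summands and leaves the value 1.\<close>
  have b: "bonus D c j = (if j = 0 then 1 else 0) + D * (1 / real j) + c * (1 / sqrt (real j))" for j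
  proof -
    have "c * sqrt (real j) / real j = c * (1 / sqrt (real j))"
      using sqrt_divide_self_eq[of "real j"] by (metis inverse_eq_divide of_nat_0_le_iff times_divide_eq_right)
    then show ?thesis by (auto simp: bonus_def add_divide_distrib)
  qed
  have "(\<Sum>j<n. bonus D c j) = (\<Sum>j<n. if j = 0 then 1 else 0) + D * (\<Sum>j<n. 1 / real j) + c * (\<Sum>j<n. 1 / sqrt (real j))"
    unfolding b by (simp add: sum.distrib sum_distrib_left)
  also have "\<dots> \<le> 1 + D * (1 + ln (real N)) + c * (3 * sqrt (real n))"
    using assms sum_inverse_le[OF assms(1,2)] sum_inverse_sqrt_le[of n]
    by (intro add_mono mult_left_mono) (auto simp: sum.delta)
  finally show ?thesis by simp
qed

text \<open>The rewards lie in the unit interval only almost surely, so for a fixed trace this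
  becomes an assumption.\<close>

context
  fixes h :: "'a trace" and N :: nat
  assumes rew01: "\<And>l. l \<in> {1..N} \<Longrightarrow> 0 \<le> rew h l \<and> rew h l \<le> 1"
begin

lemma avg_bounds:
  assumes "t \<le> Suc N"
  shows "0 \<le> avg i t h" "avg i t h \<le> 1"
proof -
  have r: "0 \<le> rew h l \<and> rew h l \<le> 1" if "l \<in> selected i t h" for l
    using in_selected_less[OF that] assms by (intro rew01) auto
  then show "0 \<le> avg i t h" unfolding avg_def by (intro divide_nonneg_nonneg sum_nonneg) auto
  have "(\<Sum>l\<in>selected i t h. rew h l) \<le> (\<Sum>l\<in>selected i t h. 1)" using r by (intro sum_mono) auto
  then show "avg i t h \<le> 1" unfolding avg_def cnt_def by (auto simp: divide_le_eq)
qed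

text \<open>Replacing each reward by the final average leaves the sum unchanged.
  \<open>settled\<close> bounds each difference of averages by \<open>c / sqrt (cnt i l h)\<close>
  plus the final bonus. With \<open>n\<close> the final count, the first parts sum to at most
  \<open>3 * c * sqrt n\<close>, and \<open>n\<close> times the bonus is
  \<open>D + c * sqrt n\<close>.\<close>

lemma settled_sum_le:
  assumes D: "0 \<le> D" "0 \<le> c" and t: "t \<le> Suc N" and ok: "settled D c i t h"
  shows "(\<Sum>l\<in>selected i t h. avg i l h - rew h l) \<le> D + 4 * c * sqrt (cnt i t h)"
proof (cases "cnt i t h = 0")
  case True
  then have "selected i t h = {}" by (simp add: cnt_def)
  then show ?thesis using D by simp
next
  case False
  let ?n = "cnt i t h"
  have "(\<Sum>l\<in>selected i t h. rew h l) = (\<Sum>l\<in>selected i t h. avg i t h)"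
    using False by (simp add: avg_def cnt_def)
  then have "(\<Sum>l\<in>selected i t h. avg i l h - rew h l) = (\<Sum>l\<in>selected i t h. avg i l h - avg i t h)"
    by (simp add: sum_subtractf)
  also have "\<dots> \<le> (\<Sum>l\<in>selected i t h. c * (1 / sqrt (cnt i l h)) + bonus D c ?n)"
  proof (rule sum_mono)
    fix l assume "l \<in> selected i t h"
    then have l: "l \<in> {1..t}" using in_selected_less by fastforce
    have b: "0 \<le> bonus D c ?n" using D by (simp add: bonus_def)
    show "avg i l h - avg i t h \<le> c * (1 / sqrt (cnt i l h)) + bonus D c ?n"
    proof (cases "cnt i l h = 0")
      \<comment> \<open>Before the first observation the average is \<open>0 / 0 = 0\<close>, so the
        left side is at most 0.\<close>
      case True
      then show ?thesis using avg_bounds(1)[OF t, of i] b by (simp add: avg_def)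
    next
      case False
      have "\<forall>s\<in>{1..t}. cnt i s h = 0 \<or> avg i s h - c / sqrt (cnt i s h) \<le> avg i t h + bonus D c ?n"
        using ok unfolding settled_def by (rule disjE) (use \<open>?n \<noteq> 0\<close> in simp_all)
      from bspec[OF this l] False show ?thesis by simp
    qed
  qed
  also have "\<dots> = c * (\<Sum>j<?n. 1 / sqrt (real j)) + ?n * bonus D c ?n"
    using sum_selected_cnt[of "\<lambda>j. c * (1 / sqrt (real j))" i h t]
    by (simp add: sum.distrib sum_distrib_left cnt_def)
  also have "\<dots> \<le> c * (3 * sqrt ?n) + (D + c * sqrt ?n)"
    using False D sum_inverse_sqrt_le[of ?n] by (intro add_mono mult_left_mono) (auto simp: bonus_def)
  finally show ?thesis by simp
qed

text \<open>The final round need not be settled. Going back to the last settled round,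
  \<open>settled_sum_le\<close> covers what precedes it, the constant 1 pays for that round itself,
  and each later round of \<open>i\<close> costs at most 1 and is counted by the last sum.\<close>

lemma avg_excess_le:
  assumes D: "0 \<le> D" "0 \<le> c" and t: "t \<le> Suc N"
  shows "(\<Sum>l\<in>selected i t h. avg i l h - rew h l)
    \<le> 1 + D + 4 * c * sqrt (cnt i t h) + (\<Sum>l\<in>selected i t h. if settled D c i l h then 0 else 1)"
  using t
proof (induction t)
  case 0
  then show ?case using D by (simp add: selected_def)
next
  case (Suc t)
  show ?case
  proof (cases "1 \<le> t \<and> fst (h t) = i")
    case True
    have step: "avg i t h - rew h t \<le> 1" using avg_bounds(2)[of t i] rew01[of t] True Suc.prems by fastforce
    have mono: "4 * c * sqrt (cnt i t h) \<le> 4 * c * sqrt (real (Suc (cnt i t h)))"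
      using D by (intro mult_left_mono) auto
    show ?thesis
    proof (cases "settled D c i t h")
      case st: True
      have "0 \<le> (\<Sum>l\<in>selected i t h. if settled D c i l h then 0 else 1 :: real)" by (intro sum_nonneg) auto
      then show ?thesis
        using settled_sum_le[OF D _ st] Suc.prems True st step mono by (simp add: selected_Suc cnt_Suc)
    next
      case False
      then show ?thesis
        using Suc True step mono by (simp add: selected_Suc cnt_Suc)
    qed
  next
    case False
    then have "selected i (Suc t) h = selected i t h" "cnt i (Suc t) h = cnt i t h"
      by (auto simp: selected_Suc cnt_Suc)
    then show ?thesis using Suc by simp
  qed
qed

lemma sum_by_learner:
  fixes f :: "nat \<Rightarrow> nat \<Rightarrow> real"
  assumes "\<And>l. l \<in> {1..N} \<Longrightarrow> fst (h l) \<in> {1..M}"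
  shows "(\<Sum>t=1..N. f (fst (h t)) t) = (\<Sum>i=1..M. \<Sum>l\<in>selected i (Suc N) h. f i l)"
proof -
  have "(\<Sum>t=1..N. f (fst (h t)) t) = (\<Sum>i\<in>{1..M}. \<Sum>t\<in>{t\<in>{1..N}. fst (h t) = i}. f (fst (h t)) t)"
    using assms by (intro sum.group[symmetric]) auto
  also have "\<dots> = (\<Sum>i=1..M. \<Sum>l\<in>selected i (Suc N) h. f i l)"
    by (intro sum.cong) (auto simp: selected_def)
  finally show ?thesis .
qed

text \<open>Writing \<open>1 - rew\<close> instead of \<open>- rew\<close> keeps the summands
  nonnegative, as the integrals in \<open>ennreal\<close> require. The price is the summand
  \<open>N - M\<close>.\<close>

lemma pathwise_regret_bound:
  assumes D: "0 \<le> D" "0 \<le> c" and MN: "1 \<le> M" "M \<le> N"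
    and idx: "\<And>l. l \<in> {1..N} \<Longrightarrow> fst (h l) \<in> {1..M}"
  shows "(\<Sum>t\<in>{M<..N}. avg (fst (h t)) t h + bonus D c (cnt (fst (h t)) t h) + (1 - rew h t))
    \<le> real (N - M) + (4 * real M + real M * D * (2 + ln (real N)) + 7 * c * sqrt (real M * real N))
      + (\<Sum>t\<in>{M<..N}. if settled D c (fst (h t)) t h then 0 else 1)"
proof -
  let ?x = "\<lambda>t. avg (fst (h t)) t h + bonus D c (cnt (fst (h t)) t h) - rew h t"
  let ?s = "\<lambda>t. if settled D c (fst (h t)) t h then 0 else 1 :: real"
  have split: "{1..N} = {1..M} \<union> {M<..N}" "{1..M} \<inter> {M<..N} = {}" using MN by auto
  have all: "(\<Sum>t=1..N. ?x t) = (\<Sum>i=1..M. \<Sum>l\<in>selected i (Suc N) h. avg i l h + bonus D c (cnt i l h) - rew h l)"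
    by (rule sum_by_learner[OF idx])
  also have "\<dots> = (\<Sum>i=1..M. (\<Sum>l\<in>selected i (Suc N) h. avg i l h - rew h l) + (\<Sum>j<cnt i (Suc N) h. bonus D c j))"
    by (simp add: sum.distrib sum_subtractf sum_selected_cnt algebra_simps)
  also have "\<dots> \<le> (\<Sum>i=1..M. (1 + D + 4 * c * sqrt (cnt i (Suc N) h) + (\<Sum>l\<in>selected i (Suc N) h. if settled D c i l h then 0 else 1))
      + (1 + D * (1 + ln (real N)) + 3 * c * sqrt (cnt i (Suc N) h)))"
    using MN D cnt_le[of _ "Suc N" h] by (intro sum_mono add_mono avg_excess_le sum_bonus_le) auto
  also have "\<dots> = 2 * real M + real M * D * (2 + ln (real N)) + 7 * c * (\<Sum>i=1..M. sqrt (cnt i (Suc N) h))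
      + (\<Sum>i=1..M. \<Sum>l\<in>selected i (Suc N) h. if settled D c i l h then 0 else 1)"
    by (simp add: sum.distrib sum_distrib_left[symmetric] algebra_simps)
  also have "(\<Sum>i=1..M. \<Sum>l\<in>selected i (Suc N) h. if settled D c i l h then 0 else 1) = (\<Sum>t=1..N. ?s t)"
    by (rule sum_by_learner[OF idx, symmetric])
  also have "(\<Sum>t=1..N. ?s t) = (\<Sum>t=1..M. ?s t) + (\<Sum>t\<in>{M<..N}. ?s t)"
    unfolding split(1) by (rule sum.union_disjoint) (use split in auto)
  also have "(\<Sum>t=1..M. ?s t) \<le> real M"
    using sum_bounded_above[of "{1..M}" ?s 1] by auto
  also have "(\<Sum>i=1..M. sqrt (cnt i (Suc N) h)) \<le> sqrt (real M * real N)"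
  proof (rule real_le_rsqrt)
    have "(\<Sum>i=1..M. sqrt (cnt i (Suc N) h))\<^sup>2 \<le> (\<Sum>i=1..M. (sqrt (cnt i (Suc N) h))\<^sup>2) * real (card {1..M})"
      by (rule sum_squared_le_sum_of_squares)
    also have "(\<Sum>i=1..M. (sqrt (cnt i (Suc N) h))\<^sup>2) = (\<Sum>t=1..N. 1)"
      using sum_by_learner[OF idx, where f="\<lambda>_ _. 1"] by (simp add: cnt_def)
    also have "\<dots> = real N" by simp
    finally show "(\<Sum>i=1..M. sqrt (cnt i (Suc N) h))\<^sup>2 \<le> real M * real N" by (simp add: mult.commute)
  qed
  \<comment> \<open>Each learner contributes 2 from the two initial constants, and the unsettled
    rounds among the first \<open>M\<close> add up to \<open>M\<close> more. The 7 is 4 from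
    \<open>avg_excess_le\<close> plus 3 from \<open>sum_bonus_le\<close>; Cauchy--Schwarz bounds the
    sum of the roots of the counts.\<close>
  finally have total: "(\<Sum>t=1..N. ?x t) \<le> 3 * real M + real M * D * (2 + ln (real N)) + 7 * c * sqrt (real M * real N) + (\<Sum>t\<in>{M<..N}. ?s t)"
    using D by (simp add: mult_left_mono)
  \<comment> \<open>The sums by learner start at round 1, the claim at round \<open>M + 1\<close>.
    Each summand left out is at least -1, which raises \<open>3 * M\<close> to
    \<open>4 * M\<close>.\<close>
  have "- real M = (\<Sum>t=1..M. -1)" by simp
  also have "\<dots> \<le> (\<Sum>t=1..M. ?x t)"
  proof (rule sum_mono)
    fix t assume t: "t \<in> {1..M}"
    have "0 \<le> bonus D c (cnt (fst (h t)) t h)" using D by (simp add: bonus_def)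
    then show "-1 \<le> ?x t" using avg_bounds(1)[of t "fst (h t)"] rew01[of t] t MN by fastforce
  qed
  finally have init: "- real M \<le> (\<Sum>t=1..M. ?x t)" .
  have "(\<Sum>t=1..N. ?x t) = (\<Sum>t=1..M. ?x t) + (\<Sum>t\<in>{M<..N}. ?x t)"
    unfolding split(1) by (rule sum.union_disjoint) (use split in auto)
  moreover have "(\<Sum>t\<in>{M<..N}. avg (fst (h t)) t h + bonus D c (cnt (fst (h t)) t h) + (1 - rew h t)) = real (N - M) + (\<Sum>t\<in>{M<..N}. ?x t)"
    by (simp add: sum.distrib sum_subtractf algebra_simps)
  ultimately show ?thesis using total init by linarith
qed

end

section \<open>The index of the selected learner\<close>

lemma avg_restrict: "t \<le> Suc n \<Longrightarrow> avg i t (restrict h {1..n}) = avg i t h"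
  unfolding avg_def cnt_def selected_restrict
  by (intro arg_cong2[where f="(/)"] sum.cong refl) (auto simp: rew_def dest: in_selected_less)

definition ucb :: "real \<Rightarrow> real \<Rightarrow> nat \<Rightarrow> nat \<Rightarrow> 'a trace \<Rightarrow> real" where
  "ucb D c i t h = avg i t h + bonus D c (cnt i t h)"

lemma ucb_restrict: "t \<le> Suc n \<Longrightarrow> ucb D c i t (restrict h {1..n}) = ucb D c i t h"
  by (simp add: ucb_def avg_restrict cnt_def selected_restrict)

lemma settled_restrict:
  assumes "t \<le> Suc n"
  shows "settled D c i t (restrict h {1..n}) = settled D c i t h"
proof -
  have "avg i s (restrict h {1..n}) = avg i s h" "cnt i s (restrict h {1..n}) = cnt i s h" if "s \<le> t" for s
    using that assms by (auto simp: avg_restrict cnt_def selected_restrict)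
  then show ?thesis by (simp add: settled_def)
qed

context bms
begin

text \<open>The minimiser inherits the regret bound \<open>D\<close> of the learner supplied by
  \<open>good\<close>. Dividing this bound by the number of observations gives the first claim. For
  the second, no average of means exceeds \<open>opt_mean\<close>, so an earlier average less its
  error lies below it, and the first claim finishes.\<close>

lemma good_imp_ucb:
  assumes h: "h \<in> space (Tr n)" and g: "good D c (Suc n) \<nu> h" and c: "0 \<le> c"
  defines "i \<equiv> arg_min_on (bms_potential Z \<nu> (Suc n) h) {1..M}"
  shows "opt_mean Z \<nu> \<le> ucb D c i (Suc n) h" and "settled D c i (Suc n) h"
proof -
  have i: "i \<in> {1..M}" unfolding i_def by (rule arg_min_on_in)
  let ?N = "cnt i (Suc n) h"
  have conc: "\<bar>dev \<nu> i s h\<bar> \<le> c * sqrt (cnt i s h)" if "s \<in> {1..Suc n}" for s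
    using g i that unfolding good_def concentrated_def by blast
  obtain j where j: "j \<in> {1..M}" "regret Z \<nu> j (Suc n) h \<le> D" using g by (auto simp: good_def)
  have "regret Z \<nu> i (Suc n) h \<le> regret Z \<nu> j (Suc n) h"
    unfolding potential_eq_regret[symmetric] i_def using j(1) by (intro arg_min_least) auto
  then have reg: "regret Z \<nu> i (Suc n) h \<le> D" using j by simp
  have means: "(\<Sum>l\<in>selected i s h. mean_reward Z \<nu> (action h l)) = cnt i s h * avg i s h + dev \<nu> i s h" for s
  proof (cases "cnt i s h = 0")
    case True
    then have "selected i s h = {}" by (simp add: cnt_def)
    then show ?thesis by (simp add: dev_def cnt_def)
  next
    case False
    then show ?thesis by (simp add: avg_def dev_def sum_subtractf)
  qed
  show opt: "opt_mean Z \<nu> \<le> ucb D c i (Suc n) h"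
  proof (cases "?N = 0")
    case True
    then show ?thesis using opt_le_1[of \<nu>] by (simp add: ucb_def avg_def bonus_def)
  next
    case False
    have "?N * opt_mean Z \<nu> - (?N * avg i (Suc n) h + dev \<nu> i (Suc n) h) \<le> D"
      using reg means[of "Suc n"] by (simp add: regret_def sum_subtractf cnt_def)
    then have "?N * opt_mean Z \<nu> \<le> ?N * avg i (Suc n) h + (D + c * sqrt ?N)"
      using conc[of "Suc n"] by simp
    then have "opt_mean Z \<nu> \<le> (?N * avg i (Suc n) h + (D + c * sqrt ?N)) / ?N"
      using False by (simp add: le_divide_eq mult.commute)
    then show ?thesis using False by (simp add: ucb_def bonus_def add_divide_distrib)
  qed
  show "settled D c i (Suc n) h"
    unfolding settled_def
  proof (rule disjI2, rule ballI)
    fix s assume s: "s \<in> {1..Suc n}"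
    let ?k = "cnt i s h"
    show "?k = 0 \<or> avg i s h - c / sqrt (real ?k) \<le> avg i (Suc n) h + bonus D c ?N"
    proof (cases "?k = 0")
      case False
      have "?k * avg i s h - c * sqrt ?k \<le> (\<Sum>l\<in>selected i s h. mean_reward Z \<nu> (action h l))"
        using conc[OF s] means[of s] by simp
      also have "\<dots> \<le> (\<Sum>l\<in>selected i s h. opt_mean Z \<nu>)"
      proof (rule sum_mono)
        fix l assume "l \<in> selected i s h"
        then have "l \<in> {1..n}" using s by (auto dest!: in_selected_less)
        from mean_le_opt[OF obs_space(2)[OF h this]]
        show "mean_reward Z \<nu> (action h l) \<le> opt_mean Z \<nu>" .
      qed
      also have "\<dots> = ?k * opt_mean Z \<nu>" by (simp add: cnt_def)
      also have "c * sqrt ?k = ?k * (c / sqrt ?k)"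
        using real_div_sqrt[of "real ?k"] by (metis mult.commute of_nat_0_le_iff times_divide_eq_left)
      finally have "?k * (avg i s h - c / sqrt ?k) \<le> ?k * opt_mean Z \<nu>"
        by (simp only: right_diff_distrib)
      then have "avg i s h - c / sqrt ?k \<le> opt_mean Z \<nu>" using False by simp
      then show ?thesis using opt by (simp add: ucb_def)
    qed simp
  qed
qed

lemma bonus_measurable:
  assumes "(\<lambda>x. real (k x)) \<in> borel_measurable N"
  shows "(\<lambda>x. bonus D c (k x)) \<in> borel_measurable N"
proof -
  have "(\<lambda>x. if real (k x) = 0 then 1 else (D + c * sqrt (real (k x))) / real (k x)) \<in> borel_measurable N"
    using assms by measurable
  then show ?thesis by (simp add: bonus_def cong: if_cong)
qed

lemma avg_measurable:
  assumes "H \<in> N \<rightarrow>\<^sub>M Tr n" "t \<le> Suc n"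
  shows "(\<lambda>x. avg i t (H x)) \<in> borel_measurable N"
  unfolding avg_def using rew_sum_measurable[OF assms] cnt_measurable[OF assms] by measurable

lemma ucb_measurable:
  assumes "H \<in> N \<rightarrow>\<^sub>M Tr n" "t \<le> Suc n"
  shows "(\<lambda>x. ucb D c i t (H x)) \<in> borel_measurable N"
  unfolding ucb_def
  using avg_measurable[OF assms] bonus_measurable[OF cnt_measurable[OF assms]] by measurable

lemma settled_measurable:
  assumes "H \<in> N \<rightarrow>\<^sub>M Tr n" "t \<le> Suc n"
  shows "Measurable.pred N (\<lambda>x. settled D c i t (H x))"
proof -
  have [measurable]: "(\<lambda>x. avg i s (H x)) \<in> borel_measurable N" "(\<lambda>x. real (cnt i s (H x))) \<in> borel_measurable N"
     if "s \<in> {1..t}" for s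
    using avg_measurable[OF assms(1), of s] cnt_measurable[OF assms(1), of s] that assms(2) by auto
  have [measurable]: "(\<lambda>x. real (cnt i t (H x))) \<in> borel_measurable N" "(\<lambda>x. avg i t (H x)) \<in> borel_measurable N"
    by (rule cnt_measurable[OF assms] avg_measurable[OF assms])+
  note bonus_measurable[OF cnt_measurable[OF assms], measurable]
  have "Measurable.pred N (\<lambda>x. real (cnt i t (H x)) = 0 \<or> (\<forall>s\<in>{1..t}. real (cnt i s (H x)) = 0 \<or>
     avg i s (H x) - c / sqrt (cnt i s (H x)) \<le> avg i t (H x) + bonus D c (cnt i t (H x))))"
    by measurable
  then show ?thesis by (simp add: settled_def)
qed

text \<open>The index is read off the run after round \<open>Suc n\<close>, and
  \<open>restrict\<close> removes the new entry from the trace. \<open>G\<close> takes no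
  environment: the exchange concerns the choice of the index alone.\<close>

lemma selected_learner_law:
  assumes n: "Suc n \<le> T" "M \<le> n" and G: "\<And>i. i \<in> {1..M} \<Longrightarrow> G i \<in> borel_measurable (Tr n)"
  shows "(\<integral>\<^sup>+y. G (fst (fst (snd y) (Suc n))) (restrict (fst (snd y)) {1..n}) \<partial>bayes (Suc n)) =
    (\<integral>\<^sup>+y. G (best n y) (fst (snd y)) \<partial>bayes n)"
proof -
  have n': "n \<le> T" using n by simp
  have Gm: "(\<lambda>x. G (I x) (H x)) \<in> borel_measurable N"
    if "I \<in> N \<rightarrow>\<^sub>M count_space {1..M}" "H \<in> N \<rightarrow>\<^sub>M Tr n" for I H and N :: "'x measure"
    by (rule measurable_compose_countable'[OF _ that(1)]) (use measurable_compose[OF that(2) G] in auto)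
  have r: "(\<lambda>h. restrict h {1..n}) \<in> Tr (Suc n) \<rightarrow>\<^sub>M Tr n"
    unfolding trace_space_def by (intro measurable_restrict_subset) auto
  have "(\<lambda>h. h (Suc n)) \<in> Tr (Suc n) \<rightarrow>\<^sub>M Obs"
    by (rule obs_component[where n="Suc n"]) auto
  then have [measurable]: "(\<lambda>h. fst (h (Suc n))) \<in> Tr (Suc n) \<rightarrow>\<^sub>M count_space {1..M}" by measurable
  have f: "(\<lambda>y. G (fst (snd y (Suc n))) (restrict (snd y) {1..n})) \<in> borel_measurable (borel \<Otimes>\<^sub>M Tr (Suc n))"
    by (rule Gm) (use r in measurable)
  have g: "(\<lambda>x. G (snd x) (fst (fst x))) \<in> borel_measurable (Run n \<Otimes>\<^sub>M count_space {1..M})"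
    by (rule Gm) measurable
  have gw: "(\<lambda>w. G (fst (snd w)) (fst (fst w))) \<in> borel_measurable (W n)"
    by (rule Gm) measurable
  have res: "restrict (h(Suc n := x)) {1..n} = h" if "h \<in> space (Tr n)" for h x
  proof -
    have "restrict (h(Suc n := x)) {1..n} = restrict h {1..n}" by (auto simp: restrict_def fun_eq_iff)
    also have "\<dots> = h" using that by (auto simp: trace_space_def space_PiM intro: PiE_restrict)
    finally show ?thesis .
  qed
  have "(\<integral>\<^sup>+y. G (fst (fst (snd y) (Suc n))) (restrict (fst (snd y)) {1..n}) \<partial>bayes (Suc n))
    = next_round n (\<lambda>y w r. G (fst (snd w)) (restrict (extend n w r) {1..n}))"
    using nn_integral_bayes_Suc_trace[OF n(1) f] by simp
  also have "\<dots> = (\<integral>\<^sup>+y. \<integral>\<^sup>+w. G (fst (snd w)) (fst (fst w)) \<partial>act_kernel n (snd y) \<partial>bayes n)"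
  proof (intro nn_integral_cong)
    fix y w assume "y \<in> space (bayes n)" "w \<in> space (act_kernel n (snd y))"
    then have w: "w \<in> space (W n)" by (rule space_act_bayes(1)[OF n(1)])
    then have a: "snd (snd w) \<in> space A" and h: "fst (fst w) \<in> space (Tr n)"
      using measurable_space[OF fst_run] by (auto simp: space_pair_measure)
    show "(\<integral>\<^sup>+r. G (fst (snd w)) (restrict (extend n w r) {1..n}) \<partial>reward Z (fst y) (snd (snd w)))
      = G (fst (snd w)) (fst (fst w))"
      using prob_space.emeasure_space_1[OF reward_prob[OF a, of "fst y"]] by (simp add: res[OF h])
  qed
  also have "\<dots> = (\<integral>\<^sup>+y. \<integral>\<^sup>+i. G i (fst (snd y)) \<partial>select (Suc n) (fst (snd y)) \<partial>bayes n)"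
  proof (rule nn_integral_cong)
    fix y assume "y \<in> space (bayes n)"
    then have y: "snd y \<in> space (Run n)" by (rule snd_space_bayes[OF n'])
    have sp: "space (select (Suc n) (fst (snd y))) = {1..M}"
      using prob_algebraD(3)[OF measurable_compose[OF fst_run select_measurable[OF n(1)]] y] by simp
    show "(\<integral>\<^sup>+w. G (fst (snd w)) (fst (fst w)) \<partial>act_kernel n (snd y)) = (\<integral>\<^sup>+i. G i (fst (snd y)) \<partial>select (Suc n) (fst (snd y)))"
      unfolding nn_integral_act[OF n(1) gw y]
    proof (rule nn_integral_cong)
      fix i assume "i \<in> space (select (Suc n) (fst (snd y)))"
      then have i: "i \<in> {1..M}" using sp by simp
      from prob_space.emeasure_space_1[OF prob_algebraD(1)[OF learner_kernels(2)[OF i] measurable_space[OF state_component[OF i] y]]]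
      show "(\<integral>\<^sup>+a. G (fst (snd (snd y, i, a))) (fst (fst (snd y, i, a))) \<partial>policy (B i) (Suc n) (snd (snd y) i)) = G i (fst (snd y))"
        by simp
    qed
  qed
  also have "\<dots> = (\<integral>\<^sup>+y. G (best n y) (fst (snd y)) \<partial>bayes n)"
    using select_nn_integral_exchange[OF n g] by simp
  finally show ?thesis .
qed

text \<open>Given environment and action, mean and reward have the same expectation. Their
  complements are used since these are almost surely nonnegative, so \<open>ennreal\<close>
  truncates nothing.\<close>

lemma mean_compl_law:
  assumes n: "Suc n \<le> T"
  shows "(\<integral>\<^sup>+y. ennreal (1 - mean_reward Z (fst y) (action (fst (snd y)) (Suc n))) \<partial>bayes (Suc n)) =
    (\<integral>\<^sup>+y. ennreal (1 - rew (fst (snd y)) (Suc n)) \<partial>bayes (Suc n))"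
proof -
  have n': "n \<le> T" using n by simp
  have o: "(\<lambda>h. h (Suc n)) \<in> Tr (Suc n) \<rightarrow>\<^sub>M Obs"
    by (rule obs_component[where n="Suc n"]) auto
  have r: "(\<lambda>y. ennreal (1 - rew (snd y) (Suc n))) \<in> borel_measurable (borel \<Otimes>\<^sub>M Tr (Suc n))"
    unfolding rew_def using o by measurable
  have "(\<lambda>y. (fst y, action (snd y) (Suc n))) \<in> borel \<Otimes>\<^sub>M Tr (Suc n) \<rightarrow>\<^sub>M borel \<Otimes>\<^sub>M A"
    unfolding action_def using o by measurable
  from measurable_compose[OF this mean_reward_measurable]
  have m: "(\<lambda>y. ennreal (1 - mean_reward Z (fst y) (action (snd y) (Suc n)))) \<in> borel_measurable (borel \<Otimes>\<^sub>M Tr (Suc n))"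
    by simp
  have "(\<integral>\<^sup>+y. ennreal (1 - mean_reward Z (fst y) (action (fst (snd y)) (Suc n))) \<partial>bayes (Suc n)) =
    next_round n (\<lambda>y w r. ennreal (1 - mean_reward Z (fst y) (snd (snd w))))"
    using nn_integral_bayes_Suc_trace[OF n m] by (simp add: action_def)
  also have "\<dots> = next_round n (\<lambda>y w r. ennreal (1 - r))"
  proof (rule nn_integral_cong, rule nn_integral_cong)
    fix y w assume "y \<in> space (bayes n)" "w \<in> space (act_kernel n (snd y))"
    then have a: "snd (snd w) \<in> space A" by (rule space_act_bayes(2)[OF n])
    show "(\<integral>\<^sup>+r. ennreal (1 - mean_reward Z (fst y) (snd (snd w))) \<partial>reward Z (fst y) (snd (snd w))) =
      (\<integral>\<^sup>+r. ennreal (1 - r) \<partial>reward Z (fst y) (snd (snd w)))"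
      using mean_compl_eq_nn_integral[OF a] prob_space.emeasure_space_1[OF reward_prob[OF a, of "fst y"]] by simp
  qed
  also have "\<dots> = (\<integral>\<^sup>+y. ennreal (1 - rew (fst (snd y)) (Suc n)) \<partial>bayes (Suc n))"
    using nn_integral_bayes_Suc_trace[OF n r] by (simp add: rew_def)
  finally show ?thesis .
qed

lemma rew_unit_AE:
  assumes "t \<in> {1..T}"
  shows "AE y in bayes T. 0 \<le> rew (fst (snd y)) t \<and> rew (fst (snd y)) t \<le> 1"
proof -
  obtain n where t: "t = Suc n" using assms by (cases t) auto
  have n: "Suc n \<le> T" and n': "n \<le> T" using assms t by auto
  let ?b = "\<lambda>h. (if 0 \<le> rew h t \<and> rew h t \<le> 1 then 0 else 1 :: ennreal)"
  have o: "(\<lambda>h. h t) \<in> Tr m \<rightarrow>\<^sub>M Obs" if "t \<le> m" for m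
    by (rule obs_component[where n=m]) (use that t in auto)
  have m: "(\<lambda>y. ?b (snd y)) \<in> borel_measurable (borel \<Otimes>\<^sub>M Tr m)" if "t \<le> m" for m
    unfolding rew_def using o[OF that] by measurable
  have mT: "(\<lambda>y. ?b (fst (snd y))) \<in> borel_measurable (bayes T)"
    using measurable_compose[OF _ m[of T], of "\<lambda>y. (fst y, fst (snd y))" "borel \<Otimes>\<^sub>M Run T"] assms sets_bayes[of T]
    by (simp cong: measurable_cong_sets)
  have "(\<integral>\<^sup>+y. ?b (fst (snd y)) \<partial>bayes T) = (\<integral>\<^sup>+y. ?b (fst (snd y)) \<partial>bayes (Suc n))"
    using bayes_marginal[OF n order_refl m[of "Suc n"]] t by (simp add: rew_def)
  also have "\<dots> = next_round n (\<lambda>y w r. (if 0 \<le> r \<and> r \<le> 1 then 0 else 1))"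
    using nn_integral_bayes_Suc_trace[OF n m[of "Suc n"]] by (simp add: rew_def t)
  also have "\<dots> = (\<integral>\<^sup>+y. \<integral>\<^sup>+w. 0 \<partial>act_kernel n (snd y) \<partial>bayes n)"
  proof (rule nn_integral_cong, rule nn_integral_cong)
    fix y w assume "y \<in> space (bayes n)" "w \<in> space (act_kernel n (snd y))"
    then have a: "snd (snd w) \<in> space A" by (rule space_act_bayes(2)[OF n])
    have "(\<integral>\<^sup>+r. (if 0 \<le> r \<and> r \<le> 1 then 0 else 1 :: ennreal) \<partial>reward Z (fst y) (snd (snd w))) = (\<integral>\<^sup>+r. 0 \<partial>reward Z (fst y) (snd (snd w)))"
      by (intro nn_integral_cong_AE eventually_mono[OF reward_unit[OF a]]) auto
    then show "(\<integral>\<^sup>+r. (if 0 \<le> r \<and> r \<le> 1 then 0 else 1 :: ennreal) \<partial>reward Z (fst y) (snd (snd w))) = 0"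
      by simp
  qed
  finally have "(\<integral>\<^sup>+y. ?b (fst (snd y)) \<partial>bayes T) = 0" by simp
  then show ?thesis
    using nn_integral_0_iff_AE[OF mT] by (auto elim!: eventually_mono split: if_splits)
qed

section \<open>The Bayesian regret\<close>

lemma ucb_selected_measurable:
  assumes "t \<in> {1..n}"
  shows "(\<lambda>y. ucb D c (fst (snd y t)) t (snd y)) \<in> borel_measurable (borel \<Otimes>\<^sub>M Tr n)"
    and "Measurable.pred (borel \<Otimes>\<^sub>M Tr n) (\<lambda>y. settled D c (fst (snd y t)) t (snd y))"
proof -
  have "(\<lambda>h. h t) \<in> Tr n \<rightarrow>\<^sub>M Obs" by (rule obs_component[where n=n]) (use assms in auto)
  then have i: "(\<lambda>y. fst (snd y t)) \<in> borel \<Otimes>\<^sub>M Tr n \<rightarrow>\<^sub>M count_space {1..M}" by measurable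
  have t: "t \<le> Suc n" using assms by simp
  show "(\<lambda>y. ucb D c (fst (snd y t)) t (snd y)) \<in> borel_measurable (borel \<Otimes>\<^sub>M Tr n)"
    by (rule measurable_compose_countable'[OF _ i]) (auto intro: ucb_measurable[OF measurable_snd t])
  show "Measurable.pred (borel \<Otimes>\<^sub>M Tr n) (\<lambda>y. settled D c (fst (snd y t)) t (snd y))"
    by (rule measurable_compose_countable'[OF _ i]) (auto intro: settled_measurable[OF measurable_snd t])
qed

abbreviation gap :: "nat \<Rightarrow> 'e \<times> 'a trace \<times> (nat \<Rightarrow> 's) \<Rightarrow> real" where
  "gap t y \<equiv> opt_mean Z (fst y) - mean_reward Z (fst y) (action (fst (snd y)) t)"

lemma instant_measurable:
  assumes "t \<in> {1..n}"
  shows "(\<lambda>y. mean_reward Z (fst y) (action (snd y) t)) \<in> borel_measurable (borel \<Otimes>\<^sub>M Tr n)"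
    and "(\<lambda>y. rew (snd y) t) \<in> borel_measurable (borel \<Otimes>\<^sub>M Tr n)"
proof -
  have o: "(\<lambda>h. h t) \<in> Tr n \<rightarrow>\<^sub>M Obs" by (rule obs_component[where n=n]) (use assms in auto)
  then have "(\<lambda>y. (fst y, action (snd y) t)) \<in> borel \<Otimes>\<^sub>M Tr n \<rightarrow>\<^sub>M borel \<Otimes>\<^sub>M A"
    unfolding action_def by measurable
  from measurable_compose[OF this mean_reward_measurable]
  show "(\<lambda>y. mean_reward Z (fst y) (action (snd y) t)) \<in> borel_measurable (borel \<Otimes>\<^sub>M Tr n)" by simp
  show "(\<lambda>y. rew (snd y) t) \<in> borel_measurable (borel \<Otimes>\<^sub>M Tr n)"
    unfolding rew_def using o by measurable
qed

lemma bayes_trace_measurable: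
  assumes "n \<le> T" and f: "f \<in> borel_measurable (borel \<Otimes>\<^sub>M Tr n)"
  shows "(\<lambda>y. f (fst y, fst (snd y))) \<in> borel_measurable (bayes n)"
  using measurable_compose[OF _ f, of "\<lambda>y. (fst y, fst (snd y))" "borel \<Otimes>\<^sub>M Run n"]
  by (simp add: measurable_cong_sets[OF sets_bayes[OF assms(1)] refl])

lemma fst_snd_space_bayes:
  "n \<le> T \<Longrightarrow> y \<in> space (bayes n) \<Longrightarrow> fst (snd y) \<in> space (Tr n)"
  using measurable_space[OF fst_run] snd_space_bayes by blast

lemma bayes_law:
  assumes t: "t \<le> T" and f: "f \<in> borel_measurable (borel \<Otimes>\<^sub>M Tr t)"
    and "\<And>\<nu> h. f (\<nu>, restrict h {1..t}) = f (\<nu>, h)"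
  shows "(\<integral>\<^sup>+y. f (fst y, fst (snd y)) \<partial>bayes T) = (\<integral>\<^sup>+y. f (fst y, fst (snd y)) \<partial>bayes t)"
  using bayes_marginal[OF t order_refl f] assms(3) by simp

text \<open>Gap plus 1 equals \<open>opt_mean\<close> plus \<open>1 - mean_reward\<close>. The first
  summand depends on the environment only, so it can be bounded before the round by the index of
  \<open>best\<close> and then by that of the selected learner, which has the same law. The second
  is replaced by \<open>1 - rew\<close>.\<close>

lemma round_bounds:
  assumes n: "Suc n \<le> T" "M \<le> n" and c: "0 \<le> c"
    and p: "(\<integral>\<^sup>+y. (if good D c (Suc n) (fst y) (fst (snd y)) then 0 else 1) \<partial>bayes n) \<le> p"
  shows "(\<integral>\<^sup>+y. ennreal (gap (Suc n) y) \<partial>bayes T) + 1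
     \<le> (\<integral>\<^sup>+y. ennreal (ucb D c (fst (fst (snd y) (Suc n))) (Suc n) (fst (snd y))) + ennreal (1 - rew (fst (snd y)) (Suc n)) \<partial>bayes T) + p"
    and "(\<integral>\<^sup>+y. (if settled D c (fst (fst (snd y) (Suc n))) (Suc n) (fst (snd y)) then 0 else 1) \<partial>bayes T) \<le> p"
proof -
  have n': "n \<le> T" using n by simp
  let ?t = "Suc n"
  let ?Jn = "bayes n" and ?Jt = "bayes (Suc n)"
  let ?v = "\<lambda>y. ucb D c (best n y) ?t (fst (snd y))" and ?u = "\<lambda>y. ucb D c (fst (fst (snd y) ?t)) ?t (fst (snd y))"
  let ?G = "\<lambda>y. good D c ?t (fst y) (fst (snd y))" and ?s = "\<lambda>y. settled D c (fst (fst (snd y) ?t)) ?t (fst (snd y))"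
  let ?r = "\<lambda>y. 1 - rew (fst (snd y)) ?t"
  interpret Jt: prob_space ?Jt by (rule bayes_prob[OF n(1)])
  have t: "?t \<in> {1..?t}" by simp
  note m = ucb_selected_measurable[OF t] instant_measurable[OF t]
  note [measurable] = m
  have selm: "best n \<in> borel \<Otimes>\<^sub>M Run n \<rightarrow>\<^sub>M count_space {1..M}"
    by (rule select_map_measurable[where n=n]) auto
  have idxm: "(\<lambda>y. ennreal (?v y)) \<in> borel_measurable ?Jn"
  proof -
    have "(\<lambda>y. ?v y) \<in> borel_measurable (borel \<Otimes>\<^sub>M Run n)"
      by (rule measurable_compose_countable'[OF _ selm]) (auto intro!: ucb_measurable[where n=n])
    then show ?thesis by (simp add: measurable_cong_sets[OF sets_bayes[OF n'] refl])
  qed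
  have badm: "(\<lambda>y. if ?G y then 0 else 1 :: ennreal) \<in> borel_measurable ?Jn"
    using good_measurable[where n=n and D=D and c=c] by (simp add: measurable_cong_sets[OF sets_bayes[OF n'] refl])
  have wm: "(\<lambda>y. ennreal (ucb D c (fst (snd y ?t)) ?t (snd y)) + ennreal (1 - rew (snd y) ?t)) \<in> borel_measurable (borel \<Otimes>\<^sub>M Tr ?t)"
    by measurable
  have em: "(\<lambda>y. ennreal (opt_mean Z (fst y) - mean_reward Z (fst y) (action (snd y) ?t))) \<in> borel_measurable (borel \<Otimes>\<^sub>M Tr ?t)"
    by measurable
  have "(\<integral>\<^sup>+y. ennreal (gap ?t y) \<partial>bayes T) + 1
    = (\<integral>\<^sup>+y. ennreal (gap ?t y) \<partial>?Jt) + (\<integral>\<^sup>+y. 1 \<partial>?Jt)"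
    using bayes_law[OF n(1) em] by (simp add: action_def Jt.emeasure_space_1)
  also have "\<dots> = (\<integral>\<^sup>+y. ennreal (gap ?t y) + 1 \<partial>?Jt)"
    using bayes_trace_measurable[OF n(1), of "\<lambda>y. ennreal (opt_mean Z (fst y) - mean_reward Z (fst y) (action (snd y) ?t))"]
    by (subst nn_integral_add) auto
  also have "\<dots> = (\<integral>\<^sup>+y. ennreal (opt_mean Z (fst y)) + ennreal (1 - mean_reward Z (fst y) (action (fst (snd y)) ?t)) \<partial>?Jt)"
  proof (rule nn_integral_cong)
    fix y assume "y \<in> space ?Jt"
    then have a: "action (fst (snd y)) ?t \<in> space A"
      using obs_space(2)[OF fst_snd_space_bayes[OF n(1)] t] by simp
    show "ennreal (gap ?t y) + 1
      = ennreal (opt_mean Z (fst y)) + ennreal (1 - mean_reward Z (fst y) (action (fst (snd y)) ?t))"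
      using mean_le_opt[OF a, of "fst y"] mean_le_1[OF a, of "fst y"] opt_nonneg[of "fst y"]
      by (simp add: algebra_simps flip: ennreal_plus ennreal_1)
  qed
  also have "\<dots> = (\<integral>\<^sup>+y. ennreal (opt_mean Z (fst y)) \<partial>?Jt) + (\<integral>\<^sup>+y. ennreal (1 - mean_reward Z (fst y) (action (fst (snd y)) ?t)) \<partial>?Jt)"
    using bayes_trace_measurable[OF n(1), of "\<lambda>y. ennreal (opt_mean Z (fst y))"]
      bayes_trace_measurable[OF n(1), of "\<lambda>y. ennreal (1 - mean_reward Z (fst y) (action (snd y) ?t))"]
    by (intro nn_integral_add) auto
  also have "(\<integral>\<^sup>+y. ennreal (1 - mean_reward Z (fst y) (action (fst (snd y)) ?t)) \<partial>?Jt) = (\<integral>\<^sup>+y. ennreal (?r y) \<partial>?Jt)"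
    by (rule mean_compl_law[OF n(1)])
  also have "(\<integral>\<^sup>+y. ennreal (opt_mean Z (fst y)) \<partial>?Jt) = (\<integral>\<^sup>+y. ennreal (opt_mean Z (fst y)) \<partial>?Jn)"
    using bayes_marginal[OF _ n(1), of n "\<lambda>y. ennreal (opt_mean Z (fst y))"] by simp
  also have "\<dots> \<le> (\<integral>\<^sup>+y. ennreal (?v y) + (if ?G y then 0 else 1) \<partial>?Jn)"
  proof (rule nn_integral_mono)
    fix y assume "y \<in> space ?Jn"
    then have h: "fst (snd y) \<in> space (Tr n)" by (rule fst_snd_space_bayes[OF n'])
    show "ennreal (opt_mean Z (fst y)) \<le> ennreal (?v y) + (if ?G y then 0 else 1)"
    proof (cases "?G y")
      case True
      then show ?thesis using good_imp_ucb(1)[OF h True c] by (simp add: ennreal_leI)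
    next
      case False
      \<comment> \<open>Off the good event the trivial bound 1 is used; its expectation is the
        failure probability.\<close>
      have "ennreal (opt_mean Z (fst y)) \<le> 1" using opt_le_1[of "fst y"] by simp
      then show ?thesis using False by (simp add: add_increasing)
    qed
  qed
  also have "\<dots> = (\<integral>\<^sup>+y. ennreal (?v y) \<partial>?Jn)
      + (\<integral>\<^sup>+y. (if ?G y then 0 else 1) \<partial>?Jn)"
    by (rule nn_integral_add[OF idxm badm])
  also have "\<dots> \<le> (\<integral>\<^sup>+y. ennreal (?v y) \<partial>?Jn) + p"
    by (intro add_left_mono p)
  also have "(\<integral>\<^sup>+y. ennreal (?v y) \<partial>?Jn) = (\<integral>\<^sup>+y. ennreal (?u y) \<partial>?Jt)"
    using selected_learner_law[OF n, of "\<lambda>i h. ennreal (ucb D c i ?t h)"] ucb_measurable[of "\<lambda>h. h" "Tr n" n ?t]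
    by (simp add: ucb_restrict)
  finally have "(\<integral>\<^sup>+y. ennreal (gap ?t y) \<partial>bayes T) + 1
    \<le> (\<integral>\<^sup>+y. ennreal (?u y) \<partial>?Jt) + p + (\<integral>\<^sup>+y. ennreal (?r y) \<partial>?Jt)"
    by (auto intro: add_right_mono)
  also have "\<dots> = (\<integral>\<^sup>+y. ennreal (?u y) + ennreal (?r y) \<partial>?Jt) + p"
    using bayes_trace_measurable[OF n(1), of "\<lambda>y. ennreal (ucb D c (fst (snd y ?t)) ?t (snd y))"]
      bayes_trace_measurable[OF n(1), of "\<lambda>y. ennreal (1 - rew (snd y) ?t)"]
    by (subst nn_integral_add) (auto simp: ac_simps)
  also have "(\<integral>\<^sup>+y. ennreal (?u y) + ennreal (?r y) \<partial>?Jt)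
    = (\<integral>\<^sup>+y. ennreal (?u y) + ennreal (?r y) \<partial>bayes T)"
    using bayes_law[OF n(1) wm] by (simp add: ucb_restrict rew_def)
  finally show "(\<integral>\<^sup>+y. ennreal (gap ?t y) \<partial>bayes T) + 1
     \<le> (\<integral>\<^sup>+y. ennreal (?u y) + ennreal (?r y) \<partial>bayes T) + p" .
  have "(\<integral>\<^sup>+y. (if ?s y then 0 else 1) \<partial>bayes T)
    = (\<integral>\<^sup>+y. (if ?s y then 0 else 1) \<partial>?Jt)"
    using bayes_law[OF n(1), of "\<lambda>y. if settled D c (fst (snd y ?t)) ?t (snd y) then 0 else 1"]
    by (simp add: settled_restrict)
  also have "\<dots> = (\<integral>\<^sup>+y. (if settled D c (best n y) ?t (fst (snd y)) then 0 else 1) \<partial>?Jn)"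
    using selected_learner_law[OF n, of "\<lambda>i h. if settled D c i ?t h then 0 else 1"] settled_measurable[of "\<lambda>h. h" "Tr n" n ?t]
    by (simp add: settled_restrict)
  also have "\<dots> \<le> (\<integral>\<^sup>+y. (if ?G y then 0 else 1) \<partial>?Jn)"
  proof (rule nn_integral_mono)
    fix y assume "y \<in> space ?Jn"
    then have h: "fst (snd y) \<in> space (Tr n)" by (rule fst_snd_space_bayes[OF n'])
    show "(if settled D c (best n y) ?t (fst (snd y)) then 0 else 1) \<le> (if ?G y then 0 else 1 :: ennreal)"
      using good_imp_ucb(2)[OF h _ c] by auto
  qed
  also have "\<dots> \<le> p" by (rule p)
  finally show "(\<integral>\<^sup>+y. (if ?s y then 0 else 1) \<partial>bayes T) \<le> p" .
qed

lemma bayes_regret_eq: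
  "ennreal (bayes_regret Z M B post T) =
    (\<Sum>t=1..T. \<integral>\<^sup>+y. ennreal (gap t y) \<partial>bayes T)"
  (is "_ = (\<Sum>t=1..T. ?e t)") and bayes_regret_le: "bayes_regret Z M B post T \<le> T"
proof -
  let ?J = "bayes T"
  interpret J: prob_space ?J by (rule bayes_prob) simp
  have gm: "gap t \<in> borel_measurable ?J" if "t \<in> {1..T}" for t
    using bayes_trace_measurable[of T "\<lambda>y. opt_mean Z (fst y) - mean_reward Z (fst y) (action (snd y) t)"]
      instant_measurable(1)[OF that] by simp
  have g: "0 \<le> gap t y" "gap t y \<le> 1" if "t \<in> {1..T}" "y \<in> space ?J" for t y
  proof -
    have a: "action (fst (snd y)) t \<in> space A"
      using obs_space(2)[OF fst_snd_space_bayes[OF order_refl that(2)] that(1)] .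
    show "0 \<le> gap t y" "gap t y \<le> 1"
      using mean_le_opt[OF a, of "fst y"] mean_nonneg[OF a, of "fst y"] opt_le_1[of "fst y"] by auto
  qed
  have gi: "integrable ?J (gap t)" if "t \<in> {1..T}" for t
    using gm[OF that] g[OF that] by (intro J.integrable_const_bound[where B=1]) (auto intro!: AE_I2)
  have eq: "bayes_regret Z M B post T = (\<Sum>t=1..T. \<integral>y. gap t y \<partial>?J)"
    unfolding bayes_regret_def case_prod_beta' using gi by (subst Bochner_Integration.integral_sum[symmetric]) auto
  have "(\<Sum>t=1..T. \<integral>y. gap t y \<partial>?J) \<le> (\<Sum>t=1..T. 1)"
    using g gi by (intro sum_mono J.integral_le_const) (auto intro!: AE_I2)
  then show "bayes_regret Z M B post T \<le> T" by (simp add: eq)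
  have "ennreal (\<Sum>t=1..T. \<integral>y. gap t y \<partial>?J) = (\<Sum>t=1..T. ennreal (\<integral>y. gap t y \<partial>?J))"
    using g by (intro sum_ennreal[symmetric] integral_nonneg_AE AE_I2) auto
  also have "\<dots> = (\<Sum>t=1..T. ?e t)"
    using g gi by (intro sum.cong refl nn_integral_eq_integral[symmetric] AE_I2) auto
  finally show "ennreal (bayes_regret Z M B post T) = (\<Sum>t=1..T. ?e t)" by (simp add: eq)
qed

text \<open>A failure is charged twice in each late round: once where the index may fall below
  \<open>opt_mean\<close>, once where the selected learner may be unsettled. The first
  \<open>M\<close> rounds cost at most 1 each, which turns \<open>4 * M\<close> into
  \<open>5 * M\<close>.\<close>

lemma regret_bound_with_failures:
  assumes MT: "M \<le> T" and D: "0 \<le> D" and c: "0 \<le> c" and p0: "0 \<le> p"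
    and p: "\<And>n. Suc n \<le> T \<Longrightarrow> (\<integral>\<^sup>+y. (if good D c (Suc n) (fst y) (fst (snd y)) then 0 else 1) \<partial>bayes n) \<le> ennreal p"
  shows "bayes_regret Z M B post T \<le> 5 * real M + real M * D * (2 + ln (real T)) + 7 * c * sqrt (real M * real T) + 2 * real T * p"
proof -
  let ?J = "bayes T"
  interpret J: prob_space ?J by (rule bayes_prob) simp
  let ?e = "\<lambda>t. \<integral>\<^sup>+y. ennreal (gap t y) \<partial>?J"
  let ?w = "\<lambda>t y. ucb D c (fst (fst (snd y) t)) t (fst (snd y))"
  let ?r = "\<lambda>t y. 1 - rew (fst (snd y)) t"
  let ?s = "\<lambda>t y. if settled D c (fst (fst (snd y) t)) t (fst (snd y)) then 0 else 1 :: ennreal"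
  define K where "K = 4 * real M + real M * D * (2 + ln (real T)) + 7 * c * sqrt (real M * real T)"
  have K: "0 \<le> K" using D c M MT by (auto simp: K_def)
  have e1: "?e t \<le> 1" if "t \<in> {1..T}" for t
  proof -
    have "?e t \<le> (\<integral>\<^sup>+y. 1 \<partial>?J)"
    proof (rule nn_integral_mono)
      fix y assume "y \<in> space ?J"
      then have a: "action (fst (snd y)) t \<in> space A"
        using obs_space(2)[OF fst_snd_space_bayes[OF order_refl] that] by simp
      show "ennreal (gap t y) \<le> 1"
        using mean_nonneg[OF a, of "fst y"] opt_le_1[of "fst y"] by simp
    qed
    then show ?thesis by (simp add: J.emeasure_space_1)
  qed
  have wm: "(\<lambda>y. ennreal (?w t y) + ennreal (?r t y)) \<in> borel_measurable ?J" "?s t \<in> borel_measurable ?J" if "t \<in> {1..T}" for t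
    using bayes_trace_measurable[of T "\<lambda>y. ennreal (ucb D c (fst (snd y t)) t (snd y)) + ennreal (1 - rew (snd y) t)"]
      bayes_trace_measurable[of T "\<lambda>y. if settled D c (fst (snd y t)) t (snd y) then 0 else 1"]
      ucb_selected_measurable[OF that, measurable] instant_measurable(2)[OF that, measurable] by auto
  have late: "?e t + 1 \<le> (\<integral>\<^sup>+y. ennreal (?w t y) + ennreal (?r t y) \<partial>?J) + ennreal p"
    "(\<integral>\<^sup>+y. ?s t y \<partial>?J) \<le> ennreal p" if mt: "t \<in> {M<..T}" for t
  proof -
    obtain n where t: "t = Suc n" using mt by (cases t) auto
    have n: "Suc n \<le> T" "M \<le> n" using mt t by auto
    show "?e t + 1 \<le> (\<integral>\<^sup>+y. ennreal (?w t y) + ennreal (?r t y) \<partial>?J) + ennreal p"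
      "(\<integral>\<^sup>+y. ?s t y \<partial>?J) \<le> ennreal p"
      using round_bounds[OF n c p[OF n(1)]] by (simp_all add: t)
  qed
  have path: "AE y in ?J. (\<Sum>t\<in>{M<..T}. ennreal (?w t y) + ennreal (?r t y)) \<le> ennreal (real (T - M) + K) + (\<Sum>t\<in>{M<..T}. ?s t y)"
  proof -
    have "AE y in ?J. \<forall>t\<in>{1..T}. 0 \<le> rew (fst (snd y)) t \<and> rew (fst (snd y)) t \<le> 1"
      using rew_unit_AE by (intro AE_finite_allI) auto
    then show ?thesis
      using AE_space
    proof eventually_elim
      case (elim y)
      let ?h = "fst (snd y)"
      have h: "?h \<in> space (Tr T)" by (rule fst_snd_space_bayes[OF order_refl elim(2)])
      have idx: "fst (?h t) \<in> {1..M}" if "t \<in> {1..T}" for t using obs_space(1)[OF h that] .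
      have rw: "0 \<le> rew ?h t \<and> rew ?h t \<le> 1" if "t \<in> {1..T}" for t using elim(1) that by blast
      have w0: "0 \<le> ?w t y" if "t \<in> {M<..T}" for t
      proof -
        have "0 \<le> avg (fst (?h t)) t ?h" by (rule avg_bounds(1)[OF rw]) (use that in auto)
        then show ?thesis using D c by (simp add: ucb_def bonus_def)
      qed
      have r0: "0 \<le> ?r t y" if "t \<in> {M<..T}" for t using rw[of t] that by auto
      have "(\<Sum>t\<in>{M<..T}. ennreal (?w t y) + ennreal (?r t y)) = ennreal (\<Sum>t\<in>{M<..T}. ?w t y + ?r t y)"
        using w0 r0 by (subst sum_ennreal[symmetric]) (auto intro!: sum.cong add_nonneg_nonneg simp: ennreal_plus)
      also have "\<dots> \<le> ennreal (real (T - M) + K + (\<Sum>t\<in>{M<..T}. if settled D c (fst (?h t)) t ?h then 0 else 1))"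
        using pathwise_regret_bound[OF rw D c M MT idx] by (intro ennreal_leI) (simp add: K_def ucb_def)
      also have "\<dots> = ennreal (real (T - M) + K) + ennreal (\<Sum>t\<in>{M<..T}. if settled D c (fst (?h t)) t ?h then 0 else 1)"
        using K by (intro ennreal_plus sum_nonneg) auto
      also have "ennreal (\<Sum>t\<in>{M<..T}. if settled D c (fst (?h t)) t ?h then 0 else 1) = (\<Sum>t\<in>{M<..T}. ?s t y)"
        using sum_ennreal[of "{M<..T}" "\<lambda>t. if settled D c (fst (?h t)) t ?h then 0 else 1"]
        by (simp add: if_distrib[of ennreal] cong: if_cong)
      finally show ?case .
    qed
  qed
  let ?X = "\<Sum>t\<in>{M<..T}. ?e t"
  have "ennreal (real (T - M)) + ?X = (\<Sum>t\<in>{M<..T}. ?e t + 1)"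
    by (simp add: sum.distrib ennreal_of_nat_eq_real_of_nat add.commute)
  also have "\<dots> \<le> (\<Sum>t\<in>{M<..T}. (\<integral>\<^sup>+y. ennreal (?w t y) + ennreal (?r t y) \<partial>?J) + ennreal p)"
    by (intro sum_mono late)
  also have "\<dots> = (\<integral>\<^sup>+y. (\<Sum>t\<in>{M<..T}. ennreal (?w t y) + ennreal (?r t y)) \<partial>?J) + (\<Sum>t\<in>{M<..T}. ennreal p)"
    unfolding sum.distrib[of _ "\<lambda>_. ennreal p"]
    by (subst nn_integral_sum) (use wm(1) in auto)
  also have "\<dots> \<le> (\<integral>\<^sup>+y. ennreal (real (T - M) + K) + (\<Sum>t\<in>{M<..T}. ?s t y) \<partial>?J) + (\<Sum>t\<in>{M<..T}. ennreal p)"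
    by (intro add_right_mono nn_integral_mono_AE path)
  also have "(\<integral>\<^sup>+y. ennreal (real (T - M) + K) + (\<Sum>t\<in>{M<..T}. ?s t y) \<partial>?J)
    = ennreal (real (T - M) + K) + (\<integral>\<^sup>+y. (\<Sum>t\<in>{M<..T}. ?s t y) \<partial>?J)"
    using wm(2) by (subst nn_integral_add) (auto simp: J.emeasure_space_1)
  also have "(\<integral>\<^sup>+y. (\<Sum>t\<in>{M<..T}. ?s t y) \<partial>?J) = (\<Sum>t\<in>{M<..T}. \<integral>\<^sup>+y. ?s t y \<partial>?J)"
    using wm(2) by (intro nn_integral_sum) auto
  also have "\<dots> \<le> (\<Sum>t\<in>{M<..T}. ennreal p)"
    by (intro sum_mono late)
  also have "(\<Sum>t\<in>{M<..T}. ennreal p) = ennreal (real (T - M) * p)"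
    using p0 by (simp add: ennreal_mult ennreal_of_nat_eq_real_of_nat)
  also have "ennreal (real (T - M) + K) + ennreal (real (T - M) * p) + ennreal (real (T - M) * p)
    = ennreal (real (T - M)) + ennreal (K + 2 * (real (T - M) * p))"
    using K p0 by (simp add: algebra_simps flip: ennreal_plus)
  \<comment> \<open>The summand \<open>T - M\<close>, one unit for each late round, is finite and
    cancels in \<open>ennreal\<close>.\<close>
  finally have X: "?X \<le> ennreal (K + 2 * (real (T - M) * p))"
    by (auto simp: ennreal_add_left_cancel_le add_right_mono)
  have split: "{1..T} = {1..M} \<union> {M<..T}" "{1..M} \<inter> {M<..T} = {}" using M MT by auto
  have "ennreal (bayes_regret Z M B post T) = (\<Sum>t=1..M. ?e t) + ?X"
    unfolding bayes_regret_eq split(1) by (rule sum.union_disjoint) (use split in auto)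
  also have "\<dots> \<le> (\<Sum>t=1..M. 1) + ennreal (K + 2 * (real (T - M) * p))"
    using e1 MT by (intro add_mono X sum_mono) auto
  also have "\<dots> = ennreal (real M + (K + 2 * (real (T - M) * p)))"
    using K p0 by (simp add: ennreal_of_nat_eq_real_of_nat)
  finally have "bayes_regret Z M B post T \<le> real M + (K + 2 * (real (T - M) * p))"
    using K p0 by (subst (asm) ennreal_le_iff) auto
  also have "real (T - M) * p \<le> real T * p"
    using p0 by (intro mult_right_mono) auto
  finally show ?thesis by (simp add: K_def)
qed

lemma bayes_regret_bound:
  assumes \<delta>: "0 < \<delta>" "\<delta> < 1" and T: "1 \<le> T"
  shows "bayes_regret Z M B post T \<le> 21 * (1 + ln (real T)) *
    (d_star Z M B post T \<delta> * real M * sqrt (real T) + sqrt (real M * real T) + \<delta> * real T)"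
    (is "?V \<le> 21 * ?L * (?d * real M * sqrt (real T) + ?S + \<delta> * real T)")
proof -
  have L: "1 \<le> ?L" using T by simp
  have d0: "0 \<le> ?d" by (rule d_star_nonneg[OF \<delta> T])
  have S0: "0 \<le> ?S" by simp
  show ?thesis
  proof (cases "M \<le> T")
    case False
    \<comment> \<open>With more learners than rounds the trivial bound \<open>T\<close> is already
      below \<open>sqrt (M * T)\<close>.\<close>
    have "real T = sqrt (real T * real T)" by simp
    also have "\<dots> \<le> ?S" using False by (intro real_sqrt_le_mono mult_right_mono) auto
    also have "\<dots> \<le> 1 * (?d * real M * sqrt (real T) + ?S + \<delta> * real T)" using d0 \<delta> by simp
    also have "\<dots> \<le> 21 * ?L * (?d * real M * sqrt (real T) + ?S + \<delta> * real T)"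
      using L d0 \<delta> by (intro mult_right_mono add_nonneg_nonneg mult_nonneg_nonneg) auto
    finally show ?thesis using bayes_regret_le by simp
  next
    case MT: True
    \<comment> \<open>This makes \<open>exp (- 2 * c\<^sup>2)\<close> equal to
      \<open>exp (-4) / T ^ 4\<close>. The union bound, summed over \<open>T\<close> rounds, is then
      \<open>2 * exp (-4) * M / T\<close>, which is at most 1 because
      \<open>M \<le> T\<close>.\<close>
    define c where "c = sqrt (2 * ?L)"
    have c0: "0 \<le> c" using L unfolding c_def by (intro real_sqrt_ge_zero) argo
    have c2: "c\<^sup>2 = 2 * ?L" using L unfolding c_def by (intro real_sqrt_pow2) argo
    have cL: "c \<le> 2 * ?L"
    proof -
      have "2 * ?L \<le> (2 * ?L)\<^sup>2" using L by (intro self_le_power) auto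
      then show ?thesis unfolding c_def using L by (intro real_le_lsqrt) argo+
    qed
    define q where "q = real M * real T * real T * (2 * exp (- 2 * c\<^sup>2))"
    have Tq: "real T * q \<le> 1"
    proof -
      have "exp (- 2 * c\<^sup>2) = exp (-4) * exp (- (ln (real T ^ 4)))"
        using T by (simp add: c2 ln_realpow flip: exp_add)
      also have "\<dots> = exp (-4) / real T ^ 4" using T by (simp add: exp_minus divide_inverse)
      finally have e: "exp (- 2 * c\<^sup>2) = exp (-4) / real T ^ 4" .
      have "real T * q = real M / real T * (2 * exp (-4))"
        unfolding q_def e using T by (simp add: power4_eq_xxxx field_simps)
      also have "\<dots> \<le> 1 * (2 * exp (-4))"
        using MT T by (intro mult_right_mono) auto
      also have "2 * exp (-4) \<le> (1 :: real)"
        using exp_ge_add_one_self[of "4 :: real"] by (simp add: exp_minus divide_inverse[symmetric] field_simps)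
      finally show ?thesis by simp
    qed
    have q0: "0 \<le> q" by (simp add: q_def)
    have M_S: "real M \<le> ?S"
    proof -
      have "real M = sqrt (real M * real M)" by simp
      also have "\<dots> \<le> ?S" using MT by (intro real_sqrt_le_mono mult_left_mono) auto
      finally show ?thesis .
    qed
    have S1: "1 \<le> ?S" using M M_S by linarith
    show ?thesis
    proof (rule field_le_epsilon)
      fix e :: real assume e: "0 < e"
      \<comment> \<open>\<open>bad_prob\<close> asks for a value strictly above
        \<open>d_star\<close>. The excess is scaled so that its contribution to the bound is exactly
        \<open>e\<close>.\<close>
      define \<epsilon> where "\<epsilon> = e / (21 * ?L * (real M * sqrt (real T)))"
      have pos: "0 < 21 * ?L * (real M * sqrt (real T))" using L M T by (intro mult_pos_pos) (linarith | simp)+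
      then have \<epsilon>: "0 < \<epsilon>" using e by (simp add: \<epsilon>_def)
      define D where "D = (?d + \<epsilon>) * sqrt (real T)"
      have D0: "0 \<le> D" using d0 \<epsilon> by (simp add: D_def)
      have "?V \<le> 5 * real M + real M * D * (2 + ln (real T)) + 7 * c * ?S + 2 * real T * (\<delta> + q)"
      proof (rule regret_bound_with_failures[OF MT D0 c0])
        show "0 \<le> \<delta> + q" using \<delta> q0 by simp
        show "(\<integral>\<^sup>+y. (if good D c (Suc n) (fst y) (fst (snd y)) then 0 else 1) \<partial>bayes n) \<le> ennreal (\<delta> + q)"
          if "Suc n \<le> T" for n
          using bad_prob[OF \<delta> T that c0, of "?d + \<epsilon>"] \<epsilon> by (simp add: D_def q_def)
      qed
      also have "\<dots> \<le> 5 * (?L * ?S) + (real M * D) * (2 * ?L) + 14 * (?L * ?S) + (2 * (?L * (\<delta> * real T)) + 2 * (?L * ?S))"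
      proof (intro add_mono)
        have "real M \<le> 1 * ?S" using M_S by simp
        also have "\<dots> \<le> ?L * ?S" by (intro mult_right_mono L S0)
        finally show "5 * real M \<le> 5 * (?L * ?S)" by simp
        show "real M * D * (2 + ln (real T)) \<le> real M * D * (2 * ?L)"
          using D0 T by (intro mult_left_mono) auto
        show "7 * c * ?S \<le> 14 * (?L * ?S)"
          using mult_right_mono[OF cL S0] by (simp add: algebra_simps)
        have "1 * (\<delta> * real T) \<le> ?L * (\<delta> * real T)" using \<delta> by (intro mult_right_mono L) auto
        moreover have "1 * 1 \<le> ?L * ?S" using L S1 by (intro mult_mono) auto
        ultimately show "2 * real T * (\<delta> + q) \<le> 2 * (?L * (\<delta> * real T)) + 2 * (?L * ?S)"
          using Tq by (simp add: algebra_simps)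
      qed
      \<comment> \<open>The 21 is the coefficient \<open>5 + 14 + 2\<close> of
        \<open>?L * ?S\<close>; the other two terms have coefficient 2.\<close>
      also have "\<dots> \<le> 21 * ?L * (real M * D + ?S + \<delta> * real T)"
      proof -
        have "0 \<le> ?L * (real M * D)" "0 \<le> ?L * (\<delta> * real T)" using L D0 \<delta> by auto
        then show ?thesis by (simp add: algebra_simps)
      qed
      also have "\<dots> = 21 * ?L * (?d * real M * sqrt (real T) + ?S + \<delta> * real T) + \<epsilon> * (21 * ?L * (real M * sqrt (real T)))"
        by (simp add: D_def algebra_simps)
      also have "\<epsilon> * (21 * ?L * (real M * sqrt (real T))) = e"
        using pos unfolding \<epsilon>_def by (metis less_irrefl nonzero_mult_div_cancel_right times_divide_eq_left)
      finally show "?V \<le> 21 * ?L * (?d * real M * sqrt (real T) + ?S + \<delta> * real T) + e" .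
    qed
  qed
qed

end

text \<open>The summand \<delta> T comes from the failure probability of the regret coefficients. If
  it is at most \<open>sqrt (M * T)\<close>, absorbing it at most doubles the bound, which turns 21
  into 42. One logarithmic factor suffices, so \<open>k = 1\<close>.\<close>

theorem theorem5p5:
  shows "\<exists>C>0. \<exists>k::nat.
    \<forall>(Z :: ('e::second_countable_topology, 'a) bandit) (M :: nat)
     (B :: nat \<Rightarrow> ('a, 's) learner) (post :: ('e, 'a) posterior) (T :: nat) (\<delta> :: real).
      bayesian_bandit Z \<longrightarrow>
      rewards_in_unit_interval Z \<longrightarrow>
      1 \<le> M \<longrightarrow> 1 \<le> T \<longrightarrow>
      (\<forall>i\<in>{1..M}. base_learner Z (B i)) \<longrightarrow>
      (\<forall>t\<in>{1..T}. is_posterior Z M B post t) \<longrightarrow>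
      0 < \<delta> \<longrightarrow> \<delta> < 1 \<longrightarrow>
      (\<delta> * real T \<le> sqrt (real M * real T) \<longrightarrow>
        bayes_regret Z M B post T
          \<le> C * (1 + ln (real T)) ^ k *
              (d_star Z M B post T \<delta> * real M * sqrt (real T) + sqrt (real M * real T))) \<and>
      bayes_regret Z M B post T
        \<le> C * (1 + ln (real T)) ^ k *
            (d_star Z M B post T \<delta> * real M * sqrt (real T) + sqrt (real M * real T)
              + \<delta> * real T)"
proof (rule exI[of _ 42], rule conjI, simp, rule exI[of _ 1], intro allI impI conjI)
  fix Z :: "('e, 'a) bandit" and M :: nat and B :: "nat \<Rightarrow> ('a, 's) learner"
    and post :: "('e, 'a) posterior" and T :: nat and \<delta> :: real
  assume "bayesian_bandit Z" "rewards_in_unit_interval Z" "1 \<le> M" "1 \<le> T"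
    "\<forall>i\<in>{1..M}. base_learner Z (B i)" "\<forall>t\<in>{1..T}. is_posterior Z M B post t" "0 < \<delta>" "\<delta> < 1"
  then interpret bms Z M B post T by unfold_locales auto
  let ?V = "bayes_regret Z M B post T" and ?L = "1 + ln (real T)"
  let ?a = "d_star Z M B post T \<delta> * real M * sqrt (real T)" and ?S = "sqrt (real M * real T)"
  have b: "?V \<le> 21 * ?L * (?a + ?S + \<delta> * real T)"
    by (rule bayes_regret_bound) fact+
  have L: "0 \<le> ?L" using \<open>1 \<le> T\<close> by simp
  have a: "0 \<le> ?a" using d_star_nonneg[OF \<open>0 < \<delta>\<close> \<open>\<delta> < 1\<close> \<open>1 \<le> T\<close>] by simp
  have "21 * ?L * (?a + ?S + \<delta> * real T) \<le> 42 * ?L * (?a + ?S + \<delta> * real T)"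
    using L a \<open>0 < \<delta>\<close> by (intro mult_right_mono) auto
  then show "?V \<le> 42 * ?L ^ 1 * (?a + ?S + \<delta> * real T)" using b by simp
  assume "\<delta> * real T \<le> ?S"
  then have "?a + ?S + \<delta> * real T \<le> 2 * (?a + ?S)" using a by argo
  then have "21 * ?L * (?a + ?S + \<delta> * real T) \<le> 21 * ?L * (2 * (?a + ?S))"
    using L by (intro mult_left_mono) auto
  also have "\<dots> = 42 * ?L ^ 1 * (?a + ?S)" by (simp add: algebra_simps)
  finally show "?V \<le> 42 * ?L ^ 1 * (?a + ?S)" using b by (rule order_trans[rotated])
qed

end
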